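(* Let $n,m\ge1$ and suppose that $f(z,w)=\sum_{k=-n}^n\sum_{l=-m}^mf_{kl}z^kw^l$ satisfies $f(z,w)>0$ for $|z|=|w|=1$. Let $\mathcal K_{n,m}$ be the matrix defined in the context for the functional $$\mathcal L(g)=\frac1{(2\pi)^2}\int_{\mathbb{T}^2}\frac{g(e^{i\theta},e^{i\phi})}{f(e^{i\theta},e^{i\phi})}\,d\theta\,d\phi .$$ Then there exists a polynomial $p(z,w)=\sum_{k=0}^n\sum_{l=0}^mp_{kl}z^kw^l$ with $p(z,w)\ne0$ for $|z|,|w|\le1$ and $f(z,w)=|p(z,w)|^2$ for $|z|=|w|=1$ if and only if $\mathcal K_{n,m}=0$.
   Context: For a (matrix valued) Laurent polynomial $Q$, $Q^\dagger(z,w)=Q(1/\bar z,1/\bar w)^\dagger$; functionals are applied entrywise and $\langle X,Y\rangle=\mathcal L(XY^\dagger)$. Lexicographic orthonormal polynomials with respect to $\mathcal L$: for $a,b\ge0$ and $0\le l\le b$, $\phi^l_{a,b}$ is the unique element of $\mathrm{span}(\{z^iw^j:0\le i<a,0\le j\le b\}\cup\{z^aw^j:0\le j\le l\})$ with positive coefficient of $z^aw^l$, $\langle\phi^l_{a,b},\phi^l_{a,b}\rangle=1$, orthogonal to all of these monomials except $z^aw^l$; $\Phi_{a,b}=[\phi^b_{a,b},\dots,\phi^0_{a,b}]^T$. Reverse lexicographic: for $0\le l\le a$, $\tilde\phi^l_{a,b}$ is the unique element of $\mathrm{span}(\{z^iw^j:0\le i\le a,0\le j<b\}\cup\{z^iw^b:0\le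 i\le l\})$ with positive coefficient of $z^lw^b$, norm one, orthogonal to all of these monomials except $z^lw^b$; $\tilde\Phi_{a,b}=[\tilde\phi^a_{a,b},\dots,\tilde\phi^0_{a,b}]^T$. $\mathcal K_{n,m}=\langle\Phi_{n,m-1},\tilde\Phi_{n-1,m}\rangle$, an $m\times n$ matrix. *)

theory Defs
  imports
    "HOL-Analysis.Analysis"
    "HOL-Library.Poly_Mapping"
    "HOL-Library.Product_Plus"
    "Jordan_Normal_Form.Matrix"
begin

text \<open>
  Laurent polynomials in \<open>z, w\<close> with complex coefficients: \<open>lookup Q (i, j)\<close> is the coefficient
  of \<open>z\<^sup>i w\<^sup>j\<close>, and the ring structure of \<^theory>\<open>HOL-Library.Poly_Mapping\<close> is the usual one
  (convolution). The span of a set of monomials with exponents in \<open>S\<close> is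
  \<open>{Q. keys Q \<subseteq> S}\<close>; polynomials are the elements with nonnegative exponents.
\<close>

type_synonym laurent = "(int \<times> int) \<Rightarrow>\<^sub>0 complex"

definition laurent_eval :: "laurent \<Rightarrow> complex \<Rightarrow> complex \<Rightarrow> complex" where
  "laurent_eval Q z w =
     (\<Sum>(i, j)\<in>Poly_Mapping.keys Q. Poly_Mapping.lookup Q (i, j) * z powi i * w powi j)"

definition monomial :: "int \<times> int \<Rightarrow> laurent" where
  "monomial e = Poly_Mapping.single e 1"

definition dagger :: "laurent \<Rightarrow> laurent" where
  "dagger Q = (\<Sum>e\<in>Poly_Mapping.keys Q. Poly_Mapping.single (- e) (cnj (Poly_Mapping.lookup Q e)))"

lemma lookup_dagger: "Poly_Mapping.lookup (dagger Q) e = cnj (Poly_Mapping.lookup Q (- e))"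
proof -
  have "Poly_Mapping.lookup (dagger Q) e =
      (\<Sum>d\<in>Poly_Mapping.keys Q. if d = - e then cnj (Poly_Mapping.lookup Q d) else 0)"
    unfolding dagger_def lookup_sum
    by (rule sum.cong) (auto simp: lookup_single when_def)
  also have "\<dots> = cnj (Poly_Mapping.lookup Q (- e))"
    by (simp add: sum.delta in_keys_iff)
  finally show ?thesis .
qed

lemma laurent_eval_dagger:
  "laurent_eval (dagger Q) z w = cnj (laurent_eval Q (1 / cnj z) (1 / cnj w))"
proof -
  have keys: "Poly_Mapping.keys (dagger Q) = uminus ` Poly_Mapping.keys Q"
    by (force simp: in_keys_iff lookup_dagger image_iff intro: minus_minus[symmetric])
  have "laurent_eval (dagger Q) z w =
      (\<Sum>e\<in>uminus ` Poly_Mapping.keys Q. cnj (Poly_Mapping.lookup Q (- e)) * z powi fst e * w powi snd e)"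
    unfolding laurent_eval_def keys by (simp add: case_prod_unfold lookup_dagger uminus_prod_def)
  also have "\<dots> = (\<Sum>e\<in>Poly_Mapping.keys Q.
      cnj (Poly_Mapping.lookup Q e) * z powi (- fst e) * w powi (- snd e))"
    by (subst sum.reindex) (auto simp: inj_on_def)
  also have "\<dots> = cnj (laurent_eval Q (1 / cnj z) (1 / cnj w))"
    unfolding laurent_eval_def cnj_sum
    by (simp add: case_prod_unfold power_int_minus power_int_divide_distrib field_simps)
  finally show ?thesis .
qed

definition laurent_inner :: "(laurent \<Rightarrow> complex) \<Rightarrow> laurent \<Rightarrow> laurent \<Rightarrow> complex" where
  "laurent_inner L X Y = L (X * dagger Y)"

definition mat_dagger :: "laurent mat \<Rightarrow> laurent mat" where
  "mat_dagger X = transpose_mat (map_mat dagger X)"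

definition mat_inner :: "(laurent \<Rightarrow> complex) \<Rightarrow> laurent mat \<Rightarrow> laurent mat \<Rightarrow> complex mat" where
  "mat_inner L X Y = map_mat L (X * mat_dagger Y)"

text \<open>
  The element of the span of the monomials with exponents in \<open>S\<close> that has positive leading
  coefficient (at \<open>e\<close>), norm one, and is orthogonal to all the monomials except the leading one.
  It is meaningful when it exists and is unique, e.g. for a positive definite functional.
\<close>

definition orthonormal_poly ::
    "(laurent \<Rightarrow> complex) \<Rightarrow> (int \<times> int) set \<Rightarrow> int \<times> int \<Rightarrow> laurent" where
  "orthonormal_poly L S e = (THE p.
     Poly_Mapping.keys p \<subseteq> S \<and>
     Poly_Mapping.lookup p e \<in> \<real> \<and> Re (Poly_Mapping.lookup p e) > 0 \<and>
     laurent_inner L p p = 1 \<and>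
     (\<forall>s\<in>S - {e}. laurent_inner L p (monomial s) = 0))"

definition lex_poly :: "(laurent \<Rightarrow> complex) \<Rightarrow> nat \<Rightarrow> nat \<Rightarrow> nat \<Rightarrow> laurent" where
  "lex_poly L a b l = orthonormal_poly L
     ({0..<int a} \<times> {0..int b} \<union> {int a} \<times> {0..int l}) (int a, int l)"

definition revlex_poly :: "(laurent \<Rightarrow> complex) \<Rightarrow> nat \<Rightarrow> nat \<Rightarrow> nat \<Rightarrow> laurent" where
  "revlex_poly L a b l = orthonormal_poly L
     ({0..int a} \<times> {0..<int b} \<union> {0..int l} \<times> {int b}) (int l, int b)"

text \<open>Column vectors, represented as one-column matrices; the upper index decreases downwards.\<close>

definition lex_vec :: "(laurent \<Rightarrow> complex) \<Rightarrow> nat \<Rightarrow> nat \<Rightarrow> laurent mat" where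
  "lex_vec L a b = mat (b + 1) 1 (\<lambda>(r, _). lex_poly L a b (b - r))"

definition revlex_vec :: "(laurent \<Rightarrow> complex) \<Rightarrow> nat \<Rightarrow> nat \<Rightarrow> laurent mat" where
  "revlex_vec L a b = mat (a + 1) 1 (\<lambda>(r, _). revlex_poly L a b (a - r))"

text \<open>For \<open>n, m \<ge> 1\<close> this is an \<open>m \<times> n\<close> matrix.\<close>

definition K_mat :: "(laurent \<Rightarrow> complex) \<Rightarrow> nat \<Rightarrow> nat \<Rightarrow> complex mat" where
  "K_mat L n m = mat_inner L (lex_vec L n (m - 1)) (revlex_vec L (n - 1) m)"

lemma K_mat_carrier: "n \<ge> 1 \<Longrightarrow> m \<ge> 1 \<Longrightarrow> K_mat L n m \<in> carrier_mat m n"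
  by (rule carrier_matI) (simp_all add: K_mat_def mat_inner_def mat_dagger_def lex_vec_def revlex_vec_def)

definition recip_functional :: "laurent \<Rightarrow> laurent \<Rightarrow> complex" where
  "recip_functional f g = complex_of_real (1 / (2 * pi)\<^sup>2) *
     set_lebesgue_integral lborel ({0..2 * pi} \<times> {0..2 * pi})
       (\<lambda>(\<theta>, \<phi>). laurent_eval g (cis \<theta>) (cis \<phi>) / laurent_eval f (cis \<theta>) (cis \<phi>))"

end

theory Submission
  imports Defs "HOL-Complex_Analysis.Cauchy_Integral_Formula"
begin

text \<open>
  Let \<open>V a b\<close> be the polynomials of degree at most \<open>(a, b)\<close>. That the matrix vanishes means that
  \<open>V n (m - 1) \<ominus> V (n - 1) (m - 1)\<close> and \<open>V (n - 1) m \<ominus> V (n - 1) (m - 1)\<close> are orthogonal.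

  If \<open>f = |p|\<^sup>2\<close> with \<open>p\<close> stable, then for fixed \<open>z\<close> on the circle the Gram matrix of \<open>1, w, \<dots>, w\<^sup>m\<close>
  has an inverse that is a Laurent polynomial of degree \<open>n\<close> in \<open>z\<close> (the Gohberg-Semencul formula).
  Because of this bandedness every \<open>y\<close> in \<open>V n m \<ominus> V (n - 1) m\<close> is orthogonal to \<open>z\<^sup>i w\<^sup>j\<close> for
  all \<open>i < n\<close>, \<open>0 \<le> j \<le> m\<close>, and if in addition \<open>y\<close> has no coefficient at \<open>z\<^sup>n w\<^sup>m\<close>, it has degree
  at most \<open>m - 1\<close> in \<open>w\<close>. So the polynomials \<open>\<phi>\<^sup>l\<close> of the boxes \<open>(n, m - 1)\<close> and \<open>(n, m)\<close> agree
  for \<open>l < m\<close>, and they are orthogonal to \<open>V (n - 1) m\<close>.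

  Conversely, the orthogonality expresses the reproducing kernel of \<open>V n m\<close> through those of the
  three smaller spaces in two ways. The difference of the two expressions is a two-variable
  Christoffel-Darboux formula for the polynomial \<open>p\<close> that is orthogonal to all monomials but \<open>1\<close>; on the
  diagonal it shows that \<open>p\<close> has no zeros in the closed bidisk. On \<open>|z| = 1\<close> it identifies the kernel of
  \<open>V n m \<ominus> V (n - 1) m\<close> with the Gohberg-Semencul kernel of \<open>1 / |p|\<^sup>2\<close>. A Wold decomposition
  for multiplication by \<open>z\<close> then shows that \<open>1 / f\<close> and \<open>1 / |p|\<^sup>2\<close> have the same moments in the box
  of \<open>f\<close>. Hence \<open>(f - |p|\<^sup>2)\<^sup>2 / (f |p|\<^sup>2)\<close> has mean zero, and \<open>f = |p|\<^sup>2\<close>.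
\<close>

subsection \<open>Laurent polynomials\<close>

abbreviation coef :: "laurent \<Rightarrow> int \<times> int \<Rightarrow> complex" where
  "coef \<equiv> Poly_Mapping.lookup"

abbreviation supp :: "laurent \<Rightarrow> (int \<times> int) set" where
  "supp \<equiv> Poly_Mapping.keys"

abbreviation cst :: "complex \<Rightarrow> laurent" where
  "cst c \<equiv> Poly_Mapping.single 0 c"

abbreviation grid :: "int \<Rightarrow> int \<Rightarrow> (int \<times> int) set" where
  "grid a b \<equiv> {0..a} \<times> {0..b}"

definition pval :: "complex \<Rightarrow> complex \<Rightarrow> int \<times> int \<Rightarrow> complex" where
  "pval z w e = z powi fst e * w powi snd e"

definition restr :: "(int \<times> int \<Rightarrow> bool) \<Rightarrow> laurent \<Rightarrow> laurent" where
  "restr P x = (\<Sum>e\<in>{e \<in> supp x. P e}. Poly_Mapping.single e (coef x e))"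

text \<open>The square of the l2 norm of the coefficients; by Parseval
  (\<open>torus_mean_norm_eval\<close>) it is the mean of the squared modulus over the
  torus.\<close>

definition nrm :: "laurent \<Rightarrow> real" where
  "nrm x = (\<Sum>e\<in>supp x. (cmod (coef x e))\<^sup>2)"

lemma coef_zero_iff: "e \<notin> supp x \<longleftrightarrow> coef x e = 0"
  by (simp add: in_keys_iff)

lemma suppD: "supp x \<subseteq> S \<Longrightarrow> e \<notin> S \<Longrightarrow> coef x e = 0"
  by (auto simp: in_keys_iff)

lemma supp_subset_iff: "supp x \<subseteq> S \<longleftrightarrow> (\<forall>e. e \<notin> S \<longrightarrow> coef x e = 0)"
  by (auto simp: in_keys_iff)

lemma laurent_sum:
  assumes "finite S" "supp x \<subseteq> S"
  shows "x = (\<Sum>e\<in>S. Poly_Mapping.single e (coef x e))"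
proof (rule poly_mapping_eqI)
  fix s
  have "coef (\<Sum>e\<in>S. Poly_Mapping.single e (coef x e)) s = (\<Sum>e\<in>S. if e = s then coef x e else 0)"
    unfolding lookup_sum by (rule sum.cong) (auto simp: lookup_single when_def)
  also have "\<dots> = coef x s"
    using assms suppD[OF assms(2)] by (auto simp: sum.delta)
  finally show "coef x s = coef (\<Sum>e\<in>S. Poly_Mapping.single e (coef x e)) s" by simp
qed

lemma single_mult_sum:
  "Poly_Mapping.single k c * x = (\<Sum>e\<in>supp x. Poly_Mapping.single (k + e) (c * coef x e))" for x :: laurent
  by (subst laurent_sum[of "supp x" x]) (auto simp: sum_distrib_left mult_single)

lemma coef_single_mult: "coef (Poly_Mapping.single k c * x) s = c * coef x (s - k)"
proof -
  have "coef (Poly_Mapping.single k c * x) s = (\<Sum>e\<in>supp x. if e = s - k then c * coef x e else 0)"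
    unfolding single_mult_sum lookup_sum by (rule sum.cong) (auto simp: lookup_single when_def)
  also have "\<dots> = c * coef x (s - k)"
    by (auto simp: sum.delta in_keys_iff)
  finally show ?thesis .
qed

lemma coef_cst_mult [simp]: "coef (cst c * x) s = c * coef x s"
  by (simp add: coef_single_mult)

lemma coef_monomial: "coef (monomial e) s = (if s = e then 1 else 0)"
  by (auto simp: monomial_def lookup_single when_def)

lemma coef_monomial_mult [simp]: "coef (monomial e * x) s = coef x (s - e)"
  by (simp add: monomial_def coef_single_mult)

lemma supp_monomial [simp]: "supp (monomial e) = {e}"
  by (simp add: monomial_def)

lemma monomial_0 [simp]: "monomial 0 = 1"
  by (simp add: monomial_def)

lemma monomial_mult: "monomial a * monomial b = monomial (a + b)"
  by (simp add: monomial_def mult_single)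

lemma laurent_expand:
  assumes "finite S" "supp x \<subseteq> S"
  shows "x = (\<Sum>e\<in>S. cst (coef x e) * monomial e)"
  using laurent_sum[OF assms] by (simp add: monomial_def mult_single)

lemma dagger_add [simp]: "dagger (x + y) = dagger x + dagger y"
  by (rule poly_mapping_eqI) (simp add: lookup_dagger lookup_add)

lemma dagger_0 [simp]: "dagger 0 = 0"
  by (rule poly_mapping_eqI) (simp add: lookup_dagger)

lemma dagger_uminus [simp]: "dagger (- x) = - dagger x"
  by (rule poly_mapping_eqI) (simp add: lookup_dagger)

lemma dagger_diff [simp]: "dagger (x - y) = dagger x - dagger y"
  by (rule poly_mapping_eqI) (simp add: lookup_dagger lookup_minus)

lemma dagger_dagger [simp]: "dagger (dagger x) = x"
  by (rule poly_mapping_eqI) (simp add: lookup_dagger)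

lemma dagger_sum: "dagger (sum f A) = (\<Sum>a\<in>A. dagger (f a))"
  by (induction A rule: infinite_finite_induct) auto

lemma dagger_single: "dagger (Poly_Mapping.single e c) = Poly_Mapping.single (- e) (cnj c)"
proof (rule poly_mapping_eqI)
  fix s
  have "e = - s \<longleftrightarrow> - e = s" by (metis minus_minus)
  then show "coef (dagger (Poly_Mapping.single e c)) s = coef (Poly_Mapping.single (- e) (cnj c)) s"
    by (simp add: lookup_dagger lookup_single when_def)
qed

lemma dagger_monomial [simp]: "dagger (monomial e) = monomial (- e)"
  by (simp add: monomial_def dagger_single)

lemma dagger_cst [simp]: "dagger (cst c) = cst (cnj c)"
  by (simp add: dagger_single)

lemma dagger_one [simp]: "dagger 1 = 1"
  by (metis dagger_monomial monomial_0 neg_0_equal_iff_equal)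

lemma dagger_mult [simp]: "dagger (x * y) = dagger x * dagger y"
proof -
  have "dagger (x * y) = (\<Sum>a\<in>supp x. \<Sum>b\<in>supp y. dagger (Poly_Mapping.single a (coef x a) * Poly_Mapping.single b (coef y b)))"
    by (subst laurent_sum[of "supp x" x], simp, simp, subst laurent_sum[of "supp y" y], simp, simp)
       (simp only: sum_product dagger_sum)
  also have "\<dots> = (\<Sum>a\<in>supp x. \<Sum>b\<in>supp y. dagger (Poly_Mapping.single a (coef x a)) * dagger (Poly_Mapping.single b (coef y b)))"
    by (simp add: mult_single dagger_single)
  also have "\<dots> = dagger (\<Sum>a\<in>supp x. Poly_Mapping.single a (coef x a)) * dagger (\<Sum>b\<in>supp y. Poly_Mapping.single b (coef y b))"
    by (simp only: sum_product dagger_sum)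
  finally show ?thesis
    by (simp only: laurent_sum[OF finite_keys order_refl, symmetric])
qed

lemma supp_dagger: "supp (dagger x) = uminus ` supp x"
  by (force simp: in_keys_iff lookup_dagger image_iff intro: minus_minus[symmetric])

lemma supp_mult_in: "e \<in> supp (x * y) \<Longrightarrow> \<exists>a\<in>supp x. \<exists>b\<in>supp y. e = a + b"
  using keys_mult[of x y] by blast

lemma coef_restr [simp]: "coef (restr P x) s = (if P s then coef x s else 0)"
proof -
  have "coef (restr P x) s = (\<Sum>e\<in>{e \<in> supp x. P e}. if e = s then coef x e else 0)"
    unfolding restr_def lookup_sum by (rule sum.cong) (auto simp: lookup_single when_def)
  also have "\<dots> = (if P s then coef x s else 0)"
    by (auto simp: sum.delta in_keys_iff)
  finally show ?thesis .
qed

lemma nrm_eq: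
  assumes "finite S" "supp x \<subseteq> S"
  shows "nrm x = (\<Sum>e\<in>S. (cmod (coef x e))\<^sup>2)"
  unfolding nrm_def using assms by (intro sum.mono_neutral_left) (auto simp: in_keys_iff)

lemma nrm_nonneg: "0 \<le> nrm x"
  by (simp add: nrm_def sum_nonneg)

lemma nrm_coef_le: "(cmod (coef x e))\<^sup>2 \<le> nrm x"
proof (cases "e \<in> supp x")
  case True
  then show ?thesis unfolding nrm_def by (intro member_le_sum) auto
next
  case False
  then show ?thesis by (simp add: coef_zero_iff nrm_nonneg)
qed

lemma nrm_eq_0_iff [simp]: "nrm x = 0 \<longleftrightarrow> x = 0"
proof
  assume "nrm x = 0"
  then have "cmod (coef x e) ^ 2 \<le> 0" for e
    using nrm_coef_le[of x e] by simp
  then show "x = 0"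
    by (intro poly_mapping_eqI) simp
qed (simp add: nrm_def)

lemma laurent_eval_eq:
  assumes "finite S" "supp x \<subseteq> S"
  shows "laurent_eval x z w = (\<Sum>e\<in>S. coef x e * pval z w e)"
proof -
  have "laurent_eval x z w = (\<Sum>e\<in>supp x. coef x e * pval z w e)"
    unfolding laurent_eval_def pval_def by (simp add: case_prod_unfold mult.assoc)
  also have "\<dots> = (\<Sum>e\<in>S. coef x e * pval z w e)"
    using assms by (intro sum.mono_neutral_left) (auto simp: in_keys_iff)
  finally show ?thesis .
qed

lemma laurent_eval_add: "laurent_eval (x + y) z w = laurent_eval x z w + laurent_eval y z w"
  using keys_add[of x y]
  by (simp add: laurent_eval_eq[of "supp x \<union> supp y"] lookup_add sum.distrib ring_distribs)

lemma laurent_eval_0 [simp]: "laurent_eval 0 z w = 0"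
  by (simp add: laurent_eval_def)

lemma laurent_eval_single [simp]: "laurent_eval (Poly_Mapping.single e c) z w = c * pval z w e"
  by (subst laurent_eval_eq[of "{e}"]) auto

lemma laurent_eval_monomial [simp]: "laurent_eval (monomial e) z w = pval z w e"
  by (simp add: monomial_def)

lemma pval_0 [simp]: "pval z w 0 = 1"
  by (simp add: pval_def)

lemma laurent_eval_1 [simp]: "laurent_eval 1 z w = 1"
  by (metis laurent_eval_monomial monomial_0 pval_0)

lemma laurent_eval_sum: "laurent_eval (sum f A) z w = (\<Sum>a\<in>A. laurent_eval (f a) z w)"
  by (induction A rule: infinite_finite_induct) (auto simp: laurent_eval_add)

text \<open>Multiplicativity of \<open>pval\<close> is assumed just at the exponents that occur: at
  \<open>z = 0\<close> or \<open>w = 0\<close> it can fail when exponents of both signs meet, and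
  the kernels are later evaluated at such points.\<close>

lemma laurent_eval_single_mult:
  assumes "\<And>s. s \<in> supp x \<Longrightarrow> pval z w (e + s) = pval z w e * pval z w s"
  shows "laurent_eval (Poly_Mapping.single e c * x) z w = c * pval z w e * laurent_eval x z w"
  unfolding single_mult_sum laurent_eval_sum laurent_eval_eq[of "supp x" x, OF finite_keys subset_refl]
  using assms by (simp add: sum_distrib_left mult_ac)

lemma laurent_eval_cst_mult [simp]: "laurent_eval (cst c * x) z w = c * laurent_eval x z w"
  by (subst laurent_eval_single_mult) auto

lemma laurent_eval_monomial_mult:
  assumes "\<And>s. s \<in> supp x \<Longrightarrow> pval z w (e + s) = pval z w e * pval z w s"
  shows "laurent_eval (monomial e * x) z w = pval z w e * laurent_eval x z w"
  unfolding monomial_def using assms by (subst laurent_eval_single_mult) auto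

lemma laurent_eval_uminus: "laurent_eval (- x) z w = - laurent_eval x z w"
proof -
  have "- x = cst (-1) * x"
    by (rule poly_mapping_eqI) (simp only: coef_cst_mult lookup_uminus, simp)
  then show ?thesis
    by (simp only: laurent_eval_cst_mult) simp
qed

lemma laurent_eval_diff: "laurent_eval (x - y) z w = laurent_eval x z w - laurent_eval y z w"
  using laurent_eval_add[of x "- y" z w] by (simp add: laurent_eval_uminus)

lemma pval_add: "z \<noteq> 0 \<Longrightarrow> w \<noteq> 0 \<Longrightarrow> pval z w (a + b) = pval z w a * pval z w b"
  by (simp add: pval_def power_int_add)

lemma pval_add_nonneg:
  assumes "0 \<le> fst a" "0 \<le> snd a" "0 \<le> fst b" "0 \<le> snd b"
  shows "pval z w (a + b) = pval z w a * pval z w b"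
  using assms by (simp add: pval_def power_int_add_1 power_int_def nat_add_distrib power_add)

lemma laurent_eval_mult:
  assumes "z \<noteq> 0" "w \<noteq> 0"
  shows "laurent_eval (x * y) z w = laurent_eval x z w * laurent_eval y z w"
proof -
  have "x * y = (\<Sum>e\<in>supp x. Poly_Mapping.single e (coef x e) * y)"
    by (subst laurent_sum[of "supp x" x]) (auto simp: sum_distrib_right)
  then have "laurent_eval (x * y) z w = (\<Sum>e\<in>supp x. coef x e * pval z w e * laurent_eval y z w)"
    by (simp add: laurent_eval_sum laurent_eval_single_mult pval_add assms)
  then show ?thesis
    by (simp add: laurent_eval_eq[of "supp x" x] sum_distrib_right)
qed

lemma laurent_eval_dagger_torus:
  assumes "cmod z = 1" "cmod w = 1"
  shows "laurent_eval (dagger x) z w = cnj (laurent_eval x z w)"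
proof -
  have "1 / cnj z = z" "1 / cnj w = w"
    using assms complex_norm_square[of z] complex_norm_square[of w]
    by (auto intro!: divide_eq_eq[THEN iffD2])
  then show ?thesis by (simp add: laurent_eval_dagger)
qed

subsection \<open>Positive definite functionals on Laurent polynomials\<close>

text \<open>\<open>lower\<close> and \<open>upper\<close> make the form equivalent to the l2 norm of
  the coefficients: the first gives definiteness and control of coefficients, the second gives
  Bessel's inequality and norm limits from coefficient limits.\<close>

locale toeplitz_form =
  fixes L :: "laurent \<Rightarrow> complex"
  assumes L_add: "L (x + y) = L x + L y"
    and L_cst: "L (cst a * x) = a * L x"
    and L_dagger: "L (dagger x) = cnj (L x)"
    and lower: "\<exists>c>0. \<forall>x. c * nrm x \<le> Re (L (x * dagger x))"
    and upper: "\<exists>c>0. \<forall>x. Re (L (x * dagger x)) \<le> c * nrm x"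
begin

abbreviation ip :: "laurent \<Rightarrow> laurent \<Rightarrow> complex" where
  "ip \<equiv> laurent_inner L"

lemma L_0 [simp]: "L 0 = 0"
  using L_add[of 0 0] by simp

lemma L_uminus: "L (- x) = - L x"
  using L_add[of x "- x"] by (simp add: eq_neg_iff_add_eq_0 add.commute)

lemma L_diff: "L (x - y) = L x - L y"
  using L_add[of x "- y"] by (simp add: L_uminus)

lemma L_sum: "L (sum f A) = (\<Sum>a\<in>A. L (f a))"
  by (induction A rule: infinite_finite_induct) (auto simp: L_add)

lemma ip_add_left: "ip (x + y) z = ip x z + ip y z"
  by (simp add: laurent_inner_def ring_distribs L_add)

lemma ip_add_right: "ip z (x + y) = ip z x + ip z y"
  by (simp add: laurent_inner_def ring_distribs L_add)

lemma ip_diff_left: "ip (x - y) z = ip x z - ip y z"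
  by (simp add: laurent_inner_def ring_distribs L_diff)

lemma ip_diff_right: "ip z (x - y) = ip z x - ip z y"
  by (simp add: laurent_inner_def ring_distribs L_diff)

lemma ip_0_left [simp]: "ip 0 x = 0"
  by (simp add: laurent_inner_def)

lemma ip_0_right [simp]: "ip x 0 = 0"
  by (simp add: laurent_inner_def)

lemma ip_cst_left: "ip (cst a * x) y = a * ip x y"
  by (simp add: laurent_inner_def mult.assoc L_cst)

lemma ip_cst_right: "ip x (cst a * y) = cnj a * ip x y"
  by (simp add: laurent_inner_def mult.left_commute[of x] L_cst)

lemma ip_sum_left: "ip (sum f A) x = (\<Sum>a\<in>A. ip (f a) x)"
  by (simp add: laurent_inner_def sum_distrib_right L_sum)

lemma ip_sum_right: "ip x (sum f A) = (\<Sum>a\<in>A. ip x (f a))"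
  by (simp add: laurent_inner_def dagger_sum sum_distrib_left L_sum)

lemma ip_cnj: "cnj (ip x y) = ip y x"
  unfolding laurent_inner_def by (simp add: mult.commute flip: L_dagger)

lemma ip_swap_zero: "ip x y = 0 \<longleftrightarrow> ip y x = 0"
  by (metis ip_cnj complex_cnj_zero)

lemma ip_self: "ip x x = complex_of_real (Re (ip x x))"
  using ip_cnj[of x x] by (simp add: complex_eq_iff)

lemma monomial_cancel: "monomial e * (monomial (- e) * x) = x"
  by (simp add: monomial_mult flip: mult.assoc)

lemma monomial_cancel': "monomial (- e) * (monomial e * x) = x"
  by (simp add: monomial_mult flip: mult.assoc)

lemma ip_monomial_left: "ip (monomial e * x) y = ip x (monomial (- e) * y)"
  by (simp add: laurent_inner_def ac_simps)

lemma ip_shift: "ip (monomial e * x) (monomial e * y) = ip x y"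
  by (simp add: ip_monomial_left monomial_cancel')

lemma ip_monomials: "ip (monomial a) (monomial b) = L (monomial (a - b))"
  by (simp add: laurent_inner_def monomial_mult)

lemma ip_nonneg: "0 \<le> Re (ip x x)"
proof -
  obtain c where "c > 0" "c * nrm x \<le> Re (L (x * dagger x))"
    using lower by blast
  then show ?thesis
    using nrm_nonneg[of x] by (simp add: laurent_inner_def) (smt (verit) mult_nonneg_nonneg)
qed

lemma ip_self_eq_0 [simp]: "ip x x = 0 \<longleftrightarrow> x = 0"
proof
  assume *: "ip x x = 0"
  obtain c where c: "c > 0" "c * nrm x \<le> Re (L (x * dagger x))"
    using lower by blast
  have "c * nrm x \<le> 0"
    using c(2) * by (simp add: laurent_inner_def)
  then have "nrm x = 0"
    using c(1) nrm_nonneg[of x] by (simp add: mult_le_0_iff)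
  then show "x = 0" by simp
qed auto

lemma ip_pos: "x \<noteq> 0 \<Longrightarrow> 0 < Re (ip x x)"
  using ip_nonneg[of x] ip_self[of x] ip_self_eq_0[of x] by (cases "Re (ip x x) = 0") auto

lemma ip_expand_right:
  assumes "finite S" "supp y \<subseteq> S"
  shows "ip x y = (\<Sum>s\<in>S. cnj (coef y s) * ip x (monomial s))"
  by (subst laurent_expand[OF assms]) (simp add: ip_sum_right ip_cst_right)

lemma ip_expand_left:
  assumes "finite S" "supp y \<subseteq> S"
  shows "ip y x = (\<Sum>s\<in>S. coef y s * ip (monomial s) x)"
  by (subst laurent_expand[OF assms]) (simp add: ip_sum_left ip_cst_left)

lemma ip_zero_right:
  assumes "\<And>s. s \<in> supp y \<Longrightarrow> ip x (monomial s) = 0"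
  shows "ip x y = 0"
  using assms by (simp add: ip_expand_right[of "supp y" y])

lemma ip_zero_left:
  assumes "\<And>s. s \<in> supp y \<Longrightarrow> ip (monomial s) x = 0"
  shows "ip y x = 0"
  using assms by (simp add: ip_expand_left[of "supp y" y])

lemma supp_diff: "supp x \<subseteq> S \<Longrightarrow> supp y \<subseteq> S \<Longrightarrow> supp (x - y) \<subseteq> S"
  by (auto simp: supp_subset_iff lookup_minus)

lemma supp_add: "supp x \<subseteq> S \<Longrightarrow> supp y \<subseteq> S \<Longrightarrow> supp (x + y) \<subseteq> S"
  by (auto simp: supp_subset_iff lookup_add)

lemma supp_cst_mult: "supp x \<subseteq> S \<Longrightarrow> supp (cst a * x) \<subseteq> S"
  by (auto simp: supp_subset_iff)

lemma supp_sum: "(\<And>a. a \<in> A \<Longrightarrow> supp (f a) \<subseteq> S) \<Longrightarrow> supp (sum f A) \<subseteq> S"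
  by (auto simp: supp_subset_iff lookup_sum)

section \<open>Orthogonal projections and coefficient representers\<close>

lemma projection_exists:
  assumes "finite S"
  shows "\<exists>p. supp p \<subseteq> S \<and> (\<forall>s\<in>S. ip (x - p) (monomial s) = 0)"
  using assms
proof (induction S arbitrary: x)
  case empty
  then show ?case by (intro exI[of _ 0]) auto
next
  case (insert s S)
  obtain p where p: "supp p \<subseteq> S" "\<And>t. t \<in> S \<Longrightarrow> ip (x - p) (monomial t) = 0"
    using insert.IH[of x] by blast
  obtain q where q: "supp q \<subseteq> S" "\<And>t. t \<in> S \<Longrightarrow> ip (monomial s - q) (monomial t) = 0"
    using insert.IH[of "monomial s"] by blast
  \<comment> \<open>Gram-Schmidt: \<open>r\<close> is the part of the new monomial orthogonal to the
    old span, nonzero because \<open>q\<close> cannot touch the coefficient at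
    \<open>s\<close>.\<close>
  define r where "r = monomial s - q"
  have "coef r s = 1"
    using suppD[OF q(1) insert.hyps(2)] by (simp add: r_def lookup_minus coef_monomial)
  then have "r \<noteq> 0" by auto
  then have rr: "ip r r \<noteq> 0" by simp
  define p' where "p' = p + cst (ip (x - p) r / ip r r) * r"
  have 1: "supp p' \<subseteq> insert s S"
    unfolding p'_def r_def using p(1) q(1)
    by (intro supp_add supp_cst_mult supp_diff) auto
  have 2: "ip (x - p') (monomial t) = 0" if "t \<in> S" for t
    using p(2)[OF that] q(2)[OF that]
    by (simp add: p'_def diff_diff_eq[symmetric] ip_diff_left ip_cst_left r_def[symmetric])
  have "ip (x - p') r = 0"
    using rr by (simp add: p'_def diff_diff_eq[symmetric] ip_diff_left[of _ "cst _ * _"] ip_cst_left)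
  moreover have "ip (x - p') q = 0"
    by (rule ip_zero_right, rule 2) (use q(1) in auto)
  ultimately have "ip (x - p') (monomial s) = 0"
    using ip_add_right[of "x - p'" r q] by (simp add: r_def)
  with 1 2 show ?case by blast
qed

text \<open>The Riesz representer of the coefficient functional at \<open>s\<close> on the span of
  \<open>S\<close>. For \<open>s \<in> S\<close> these form the basis dual to the monomials; their
  coefficients are, up to conjugation, the columns of the inverse Gram matrix.\<close>

definition represents :: "(int \<times> int) set \<Rightarrow> int \<times> int \<Rightarrow> laurent \<Rightarrow> bool" where
  "represents S s k \<longleftrightarrow> supp k \<subseteq> S \<and> (\<forall>g. supp g \<subseteq> S \<longrightarrow> ip g k = coef g s)"

definition kap :: "(int \<times> int) set \<Rightarrow> int \<times> int \<Rightarrow> laurent" where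
  "kap S s = (SOME k. represents S s k)"

lemma represents_unique:
  assumes "represents S s k" "represents S s k'"
  shows "k = k'"
proof -
  have "supp (k - k') \<subseteq> S"
    using assms by (intro supp_diff) (auto simp: represents_def)
  then have "ip (k - k') k = ip (k - k') k'"
    using assms by (simp add: represents_def)
  then have "ip (k - k') (k - k') = 0"
    by (simp add: ip_diff_right)
  then show ?thesis by simp
qed

lemma represents_exists:
  assumes "finite S"
  shows "\<exists>k. represents S s k"
proof (cases "s \<in> S")
  case False
  then show ?thesis
    by (intro exI[of _ 0]) (auto simp: represents_def suppD)
next
  case True
  obtain q where q: "supp q \<subseteq> S - {s}" "\<And>t. t \<in> S - {s} \<Longrightarrow> ip (monomial s - q) (monomial t) = 0"
    using projection_exists[of "S - {s}" "monomial s"] assms by blast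
  \<comment> \<open>The residual of \<open>monomial s\<close> modulo the other monomials is
    orthogonal to all of them, so just a scalar factor remains to be fixed.\<close>
  define r where "r = monomial s - q"
  have "coef r s = 1"
    using suppD[OF q(1)] by (simp add: r_def lookup_minus coef_monomial)
  then have "r \<noteq> 0" by auto
  then have rr: "ip r r \<noteq> 0" by simp
  have r0: "ip g r = 0" if "supp g \<subseteq> S - {s}" for g
    by (rule ip_zero_left) (use q(2) that ip_swap_zero in \<open>auto simp: r_def\<close>)
  have "ip r r = ip (monomial s) r"
    using r0[OF q(1)] by (simp add: r_def ip_diff_left)
  have main: "ip g (cst (1 / ip r r) * r) = coef g s" if "supp g \<subseteq> S" for g
  proof -
    have "supp (g - cst (coef g s) * monomial s) \<subseteq> S - {s}"
      using that True by (auto simp: supp_subset_iff lookup_minus coef_monomial)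
    then have "ip g r = coef g s * ip (monomial s) r"
      using r0[of "g - cst (coef g s) * monomial s"] by (simp add: ip_diff_left ip_cst_left)
    then have "ip g r = coef g s * ip r r"
      using \<open>ip r r = ip (monomial s) r\<close> by simp
    then show ?thesis
      using rr by (simp add: ip_cst_right ip_cnj)
  qed
  have "supp (cst (1 / ip r r) * r) \<subseteq> S"
    unfolding r_def using q(1) True by (intro supp_cst_mult supp_diff) auto
  with main show ?thesis
    unfolding represents_def by blast
qed

lemma represents_kap: "finite S \<Longrightarrow> represents S s (kap S s)"
  unfolding kap_def using represents_exists[of S s] by (rule someI_ex)

lemma supp_kap: "finite S \<Longrightarrow> supp (kap S s) \<subseteq> S"
  using represents_kap by (simp add: represents_def)

lemma ip_kap: "finite S \<Longrightarrow> supp g \<subseteq> S \<Longrightarrow> ip g (kap S s) = coef g s"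
  using represents_kap by (simp add: represents_def)

lemma kap_eqI: "finite S \<Longrightarrow> represents S s k \<Longrightarrow> kap S s = k"
  using represents_kap represents_unique by blast

lemma kap_outside: "finite S \<Longrightarrow> s \<notin> S \<Longrightarrow> kap S s = 0"
  by (rule kap_eqI) (auto simp: represents_def suppD)

lemma ip_kap_right:
  assumes "finite S" "s \<in> S"
  shows "ip (kap S t) (monomial s) = (if t = s then 1 else 0)"
proof -
  have "ip (monomial s) (kap S t) = (if t = s then 1 else 0)"
    using assms by (subst ip_kap) (auto simp: coef_monomial)
  then show ?thesis
    by (metis ip_cnj complex_cnj_one complex_cnj_zero)
qed

text \<open>Expansion in the dual basis: by \<open>ip_kap_right\<close> it has the same products
  with the monomials in \<open>S\<close> as \<open>x\<close>, so it is the orthogonal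
  projection.\<close>

definition proj :: "(int \<times> int) set \<Rightarrow> laurent \<Rightarrow> laurent" where
  "proj S x = (\<Sum>s\<in>S. cst (ip x (monomial s)) * kap S s)"

lemma supp_proj: "finite S \<Longrightarrow> supp (proj S x) \<subseteq> S"
  unfolding proj_def by (intro supp_sum supp_cst_mult supp_kap)

lemma ip_proj_monomial:
  assumes "finite S" "s \<in> S"
  shows "ip (proj S x) (monomial s) = ip x (monomial s)"
  using assms by (simp add: proj_def ip_sum_left ip_cst_left ip_kap_right if_distrib cong: if_cong)

lemma ip_proj:
  assumes "finite S" "supp y \<subseteq> S"
  shows "ip (proj S x) y = ip x y"
  using assms ip_zero_right[of y "proj S x - x"] ip_proj_monomial[of S _ x]
  by (auto simp: ip_diff_left)

lemma proj_same:
  assumes "finite S" "supp x \<subseteq> S"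
  shows "proj S x = x"
proof -
  have "supp (proj S x - x) \<subseteq> S"
    using assms by (intro supp_diff supp_proj)
  then have "ip (proj S x) (proj S x - x) = ip x (proj S x - x)"
    using ip_proj assms by blast
  then have "ip (proj S x - x) (proj S x - x) = 0"
    by (simp add: ip_diff_left)
  then show ?thesis by simp
qed

section \<open>Cauchy-Schwarz, Bessel and their consequences for limits\<close>

lemma ip_cauchy_schwarz: "(cmod (ip x y))\<^sup>2 \<le> Re (ip x x) * Re (ip y y)"
proof (cases "y = 0")
  case False
  then have yy: "0 < Re (ip y y)" by (rule ip_pos)
  define a where "a = ip x y / ip y y"
  have a: "a * ip y y = ip x y"
    using False by (simp add: a_def)
  have "ip (x - cst a * y) y = 0"
    using a by (simp add: ip_diff_left ip_cst_left)
  then have "ip (x - cst a * y) (x - cst a * y) = ip (x - cst a * y) x"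
    by (simp only: ip_diff_right ip_cst_right) simp
  also have "\<dots> = ip x x - a * ip y x"
    by (simp only: ip_diff_left ip_cst_left)
  also have "a * ip y x = complex_of_real ((cmod (ip x y))\<^sup>2 / Re (ip y y))"
    unfolding a_def of_real_divide complex_norm_square ip_cnj ip_self[symmetric] by simp
  finally have "0 \<le> Re (ip x x) - (cmod (ip x y))\<^sup>2 / Re (ip y y)"
    using ip_nonneg[of "x - cst a * y"] by simp
  then show ?thesis
    using yy by (simp add: divide_le_eq)
qed simp

lemma bessel:
  obtains c where "c > 0"
    "\<And>T y. finite T \<Longrightarrow> (\<Sum>s\<in>T. (cmod (ip y (monomial s)))\<^sup>2) \<le> c * Re (ip y y)"
proof -
  obtain c where c: "c > 0" "\<And>x. Re (L (x * dagger x)) \<le> c * nrm x"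
    using upper by blast
  show thesis
  proof (rule that[OF c(1)])
    fix T :: "(int \<times> int) set" and y
    assume "finite T"
    \<comment> \<open>Test vector for Cauchy-Schwarz: \<open>ip y x\<close> is the sum
      \<open>B\<close> to be bounded, while \<open>upper\<close> bounds \<open>ip x x\<close> by
      \<open>c * B\<close>, so one factor \<open>B\<close> cancels.\<close>
    define x where "x = (\<Sum>s\<in>T. cst (ip y (monomial s)) * monomial s)"
    define B where "B = (\<Sum>s\<in>T. (cmod (ip y (monomial s)))\<^sup>2)"
    have "0 \<le> B" by (simp add: B_def sum_nonneg)
    have sx: "supp x \<subseteq> T"
      unfolding x_def by (intro supp_sum supp_cst_mult) auto
    have cx: "coef x s = ip y (monomial s)" if "s \<in> T" for s
      using that \<open>finite T\<close>
      by (simp add: x_def lookup_sum coef_monomial if_distrib cong: if_cong)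
    have "nrm x = B"
      using cx by (simp add: nrm_eq[OF \<open>finite T\<close> sx] B_def)
    then have xx: "Re (ip x x) \<le> c * B"
      using c(2)[of x] by (simp add: laurent_inner_def)
    have "ip y x = complex_of_real B"
      using cx by (simp add: ip_expand_right[OF \<open>finite T\<close> sx] B_def complex_norm_square mult.commute del: of_real_power)
    then have "B\<^sup>2 \<le> Re (ip y y) * Re (ip x x)"
      using ip_cauchy_schwarz[of y x] by simp
    also have "\<dots> \<le> Re (ip y y) * (c * B)"
      by (intro mult_left_mono xx ip_nonneg)
    finally have "B * B \<le> (c * Re (ip y y)) * B"
      by (simp add: power2_eq_square mult_ac)
    then have "B \<le> c * Re (ip y y)"
      using \<open>0 \<le> B\<close> c(1) ip_nonneg[of y] by (cases "B = 0") (auto simp: mult_le_cancel_right)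
    then show "(\<Sum>s\<in>T. (cmod (ip y (monomial s)))\<^sup>2) \<le> c * Re (ip y y)"
      by (simp add: B_def)
  qed
qed

text \<open>A Riemann-Lebesgue lemma: Bessel bounds the partial sums of the squared products along
  an injective sequence, so the terms tend to zero.\<close>

lemma ip_monomial_tendsto_0:
  fixes e :: "nat \<Rightarrow> int \<times> int"
  assumes "inj e"
  shows "(\<lambda>k. ip y (monomial (e k))) \<longlonglongrightarrow> 0"
proof -
  obtain c where c: "\<And>T. finite T \<Longrightarrow> (\<Sum>s\<in>T. (cmod (ip y (monomial s)))\<^sup>2) \<le> c * Re (ip y y)"
    using bessel by metis
  have "(\<Sum>k\<le>N. (cmod (ip y (monomial (e k))))\<^sup>2) \<le> c * Re (ip y y)" for N
    using c[of "e ` {..N}"] assms by (simp add: sum.reindex inj_on_subset)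
  then have "summable (\<lambda>k. (cmod (ip y (monomial (e k))))\<^sup>2)"
    by (intro bounded_imp_summable[where B = "c * Re (ip y y)"]) auto
  then have "(\<lambda>k. (cmod (ip y (monomial (e k))))\<^sup>2) \<longlonglongrightarrow> 0"
    by (rule summable_LIMSEQ_zero)
  then have "(\<lambda>k. sqrt ((cmod (ip y (monomial (e k))))\<^sup>2)) \<longlonglongrightarrow> sqrt 0"
    by (rule tendsto_real_sqrt)
  then show ?thesis
    by (simp add: tendsto_norm_zero_iff)
qed

text \<open>The supports may drift with \<open>e k\<close> but stay in translates of one finite set,
  so coefficientwise convergence gives norm convergence through \<open>upper\<close>.\<close>

lemma ip_tendsto_0:
  fixes x :: "nat \<Rightarrow> laurent"
  assumes "finite T" "\<And>k. supp (x k) \<subseteq> (\<lambda>t. t + e k) ` T"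
    and "\<And>t. t \<in> T \<Longrightarrow> (\<lambda>k. coef (x k) (t + e k)) \<longlonglongrightarrow> 0"
  shows "(\<lambda>k. Re (ip (x k) (x k))) \<longlonglongrightarrow> 0"
proof -
  obtain c where c: "c > 0" "\<And>x. Re (L (x * dagger x)) \<le> c * nrm x"
    using upper by blast
  have "nrm (x k) = (\<Sum>t\<in>T. (cmod (coef (x k) (t + e k)))\<^sup>2)" for k
    using assms(1) by (subst nrm_eq[OF _ assms(2)]) (auto simp: sum.reindex inj_on_def)
  moreover have "(\<lambda>k. c * (\<Sum>t\<in>T. (cmod (coef (x k) (t + e k)))\<^sup>2)) \<longlonglongrightarrow> c * (\<Sum>t\<in>T. (cmod 0)\<^sup>2)"
    by (intro tendsto_intros assms(3))
  ultimately have "(\<lambda>k. c * nrm (x k)) \<longlonglongrightarrow> 0"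
    by simp
  then show ?thesis
    by (rule tendsto_sandwich[OF _ _ tendsto_const, rotated 2])
       (use c(2) ip_nonneg in \<open>auto simp: laurent_inner_def\<close>)
qed

end

subsection \<open>Functionals with weight the inverse square modulus of a stable polynomial\<close>

lemma supp_monomial_mult: "e \<in> supp (monomial k * x) \<longleftrightarrow> e - k \<in> supp x"
  by (simp add: in_keys_iff)

lemma supp_shifted_difference:
  assumes "e \<in> supp (monomial k * (a * dagger b - dagger c * d))"
  shows "(\<exists>x\<in>supp a. \<exists>y\<in>supp b. e = x - y + k) \<or> (\<exists>x\<in>supp d. \<exists>y\<in>supp c. e = x - y + k)"
proof -
  have "e - k \<in> supp (a * dagger b) \<or> e - k \<in> supp (dagger c * d)"
    using assms keys_diff[of "a * dagger b" "dagger c * d"] by (auto simp: supp_monomial_mult)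
  then show ?thesis
  proof
    assume "e - k \<in> supp (a * dagger b)"
    then obtain x y where "x \<in> supp a" "y \<in> supp b" "e - k = x + - y"
      using supp_mult_in[of "e - k" a "dagger b"] by (auto simp: supp_dagger)
    then show ?thesis by (metis diff_add_cancel add_uminus_conv_diff)
  next
    assume "e - k \<in> supp (dagger c * d)"
    then obtain x y where "x \<in> supp d" "y \<in> supp c" "e - k = - y + x"
      using supp_mult_in[of "e - k" "dagger c" d] by (auto simp: supp_dagger)
    then show ?thesis by (metis diff_add_cancel uminus_add_conv_diff)
  qed
qed

text \<open>The functional of the weight \<open>1 / |p|\<^sup>2\<close>; \<open>orth_z\<close> and \<open>orth_w\<close> say that \<open>1 / p\<close> has no
  Fourier coefficient with a negative index.\<close>

locale stable_form = toeplitz_form +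
  fixes p :: laurent and n m :: int
  assumes nm: "0 \<le> n" "0 \<le> m"
    and supp_p: "supp p \<subseteq> grid n m"
    and orth_z: "0 < i \<Longrightarrow> ip (monomial (i, j)) p = 0"
    and orth_w: "0 < j \<Longrightarrow> ip (monomial (i, j)) p = 0"
    and L_p_dagger_p: "L (x * (p * dagger p)) = coef x 0"
begin

definition p_rev :: laurent where
  "p_rev = monomial (n, m) * dagger p"

definition below :: "int \<Rightarrow> laurent \<Rightarrow> laurent" where
  "below l = restr (\<lambda>e. snd e \<le> l)"

definition above :: "int \<Rightarrow> laurent \<Rightarrow> laurent" where
  "above l = restr (\<lambda>e. l < snd e)"

text \<open>For fixed \<open>z\<close> on the circle, \<open>dual 0 l\<close> is the coefficient of the \<open>l\<close>-th power of the conjugate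
  \<open>\<eta>'\<close> of \<open>\<eta>\<close> in \<open>(p(w) p(\<eta>)' - w \<eta>' p_rev(w) p_rev(\<eta>)') / (1 - w \<eta>')\<close>, the reproducing kernel of the
  polynomials of degree at most \<open>m\<close> in \<open>w\<close>. The truncations \<open>below\<close> result from dividing power series.\<close>

definition dual :: "int \<Rightarrow> int \<Rightarrow> laurent" where
  "dual i l = monomial (i, l) * (p * dagger (below l p) - p_rev * dagger (below (l - 1) p_rev))"

lemma below_above: "below l x + above l x = x"
  by (rule poly_mapping_eqI) (simp add: below_def above_def lookup_add)

lemma coef_p_outside: "e \<notin> grid n m \<Longrightarrow> coef p e = 0"
  using suppD supp_p by blast

lemma coef_p_rev: "coef p_rev s = cnj (coef p ((n, m) - s))"
  by (simp add: p_rev_def lookup_dagger)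

lemma supp_prev: "supp p_rev \<subseteq> grid n m"
  unfolding supp_subset_iff by (auto simp: coef_p_rev coef_p_outside)

lemma L_neg_z: "i < 0 \<Longrightarrow> L (monomial (i, j) * p) = 0"
  using orth_z[of "- i" "- j"] ip_cnj[of "monomial (- i, - j)" p]
  by (simp add: laurent_inner_def mult.commute)

lemma L_neg_w: "j < 0 \<Longrightarrow> L (monomial (i, j) * p) = 0"
  using orth_w[of "- j" "- i"] ip_cnj[of "monomial (- i, - j)" p]
  by (simp add: laurent_inner_def mult.commute)

lemma dagger_below_p_rev: "dagger (below (l - 1) p_rev) = monomial (- n, - m) * above (m - l) p"
proof (rule poly_mapping_eqI)
  fix s :: "int \<times> int"
  have "(n, m) - (- s) = s - (- n, - m)" by (cases s) simp
  then show "coef (dagger (below (l - 1) p_rev)) s = coef (monomial (- n, - m) * above (m - l) p) s"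
    by (cases s) (auto simp: lookup_dagger below_def above_def coef_p_rev add.commute)
qed

lemma dual_alt1: "dual i l = monomial (i, l) * (p * dagger (below l p) - dagger p * above (m - l) p)"
proof -
  have "p_rev * dagger (below (l - 1) p_rev) = dagger p * (monomial (n, m) * (monomial (- (n, m)) * above (m - l) p))"
    unfolding dagger_below_p_rev by (simp add: p_rev_def mult_ac)
  then show ?thesis
    by (simp only: dual_def monomial_cancel)
qed

text \<open>Splitting one factor of \<open>p * dagger p\<close> at \<open>l\<close> and,
  alternatively, the other at \<open>m - l\<close> exchanges the kept and the discarded parts in
  \<open>dual_alt1\<close>.\<close>

lemma dual_alt2: "dual i l = monomial (i, l) * (dagger p * below (m - l) p - p * dagger (above l p))"
proof -
  have "p * dagger (below l p) + p * dagger (above l p) = dagger p * below (m - l) p + dagger p * above (m - l) p"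
    by (simp add: below_above mult.commute flip: distrib_left dagger_add)
  then have "p * dagger (below l p) - dagger p * above (m - l) p = dagger p * below (m - l) p - p * dagger (above l p)"
    by (simp add: algebra_simps)
  then show ?thesis by (simp add: dual_alt1)
qed

lemma dual_shift: "dual (k + i) l = monomial (k, 0) * dual i l"
  by (simp add: dual_def monomial_mult flip: mult.assoc)

lemma coef_dual_shift: "coef (dual (k + i) l) (k + a, b) = coef (dual i l) (a, b)"
  by (simp add: dual_shift)

text \<open>In \<open>dual_alt1\<close> the truncations leave no negative power of \<open>w\<close>,
  in \<open>dual_alt2\<close> none above \<open>m\<close>. The band of half-width \<open>n\<close>
  in \<open>z\<close> comes from the degrees of \<open>p\<close> and
  \<open>dagger p\<close>.\<close>

lemma supp_dual: "supp (dual i l) \<subseteq> {i - n..i + n} \<times> {0..m}"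
proof
  fix e assume e: "e \<in> supp (dual i l)"
  have in_p: "0 \<le> fst a \<and> fst a \<le> n \<and> 0 \<le> snd a \<and> snd a \<le> m" if "a \<in> supp p" for a
    using that supp_p by auto
  have above: "a \<in> supp p \<and> k < snd a" if "a \<in> supp (above k p)" for a k
    using that by (auto simp: in_keys_iff above_def split: if_splits)
  have below: "a \<in> supp p \<and> snd a \<le> k" if "a \<in> supp (below k p)" for a k
    using that by (auto simp: in_keys_iff below_def split: if_splits)
  have "fst e \<in> {i - n..i + n} \<and> 0 \<le> snd e"
    using supp_shifted_difference[OF e[unfolded dual_alt1]]
  proof (elim disjE bexE)
    fix x y assume "x \<in> supp p" "y \<in> supp (below l p)" "e = x - y + (i, l)"
    then show ?thesis using in_p[of x] in_p[of y] below[of y l] by auto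
  next
    fix x y assume "x \<in> supp (above (m - l) p)" "y \<in> supp p" "e = x - y + (i, l)"
    then show ?thesis using in_p[of x] in_p[of y] above[of x "m - l"] by auto
  qed
  moreover have "snd e \<le> m"
  proof -
    have "dual i l = monomial (i, l) * ((- p) * dagger (above l p) - dagger p * (- below (m - l) p))"
      by (simp add: dual_alt2)
    from supp_shifted_difference[OF e[unfolded this]] show ?thesis
    proof (elim disjE bexE)
      fix x y assume "x \<in> supp (- p)" "y \<in> supp (above l p)" "e = x - y + (i, l)"
      then show ?thesis using in_p[of x] above[of y l] by auto
    next
      fix x y assume "x \<in> supp (- below (m - l) p)" "y \<in> supp p" "e = x - y + (i, l)"
      then show ?thesis using in_p[of y] below[of x "m - l"] by auto
    qed
  qed
  ultimately show "e \<in> {i - n..i + n} \<times> {0..m}"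
    by (cases e) auto
qed

text \<open>With \<open>z^i w^l\<close> moved over to \<open>g\<close>, the second product in
  \<open>dual\<close> contributes negative powers of \<open>w\<close> times \<open>p\<close>, on
  which \<open>L\<close> vanishes. In the first product \<open>below l p\<close> may be completed to
  \<open>p\<close>, since the added part pairs with \<open>p\<close> in positive powers of
  \<open>w\<close>; then \<open>L_p_dagger_p\<close> applies.\<close>

lemma ip_dual:
  assumes "supp g \<subseteq> UNIV \<times> {0..m}"
  shows "ip g (dual i l) = coef g (i, l)"
proof -
  define x where "x = g * monomial (- i, - l)"
  have "coef x 0 = coef g (i, l)"
    using coef_monomial_mult[of "(- i, - l)" g 0] by (simp add: x_def mult.commute)
  have x_supp: "- l \<le> snd e \<and> snd e \<le> m - l" if "e \<in> supp x" for e
    using supp_mult_in[OF that[unfolded x_def]] assms by auto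
  have 1: "L (x * above l p * dagger p) = 0"
  proof -
    have "ip (x * above l p) p = 0"
    proof (rule ip_zero_left)
      fix s assume "s \<in> supp (x * above l p)"
      then obtain a b where ab: "a \<in> supp x" "b \<in> supp (above l p)" "s = a + b"
        using supp_mult_in by blast
      then have "0 < snd s"
        using x_supp[of a] by (auto simp: in_keys_iff above_def split: if_splits)
      then show "ip (monomial s) p = 0"
        using orth_w by (cases s) auto
    qed
    then show ?thesis by (simp add: laurent_inner_def)
  qed
  have 2: "L (x * (dagger p_rev * below (l - 1) p_rev)) = 0"
  proof -
    have "L (x * monomial (- n, - m) * below (l - 1) p_rev * dagger (dagger p)) = 0"
      unfolding laurent_inner_def[symmetric]
    proof (rule ip_zero_left)
      fix s assume "s \<in> supp (x * monomial (- n, - m) * below (l - 1) p_rev)"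
      then obtain a b where ab: "a \<in> supp (x * monomial (- n, - m))" "b \<in> supp (below (l - 1) p_rev)" "s = a + b"
        using supp_mult_in by blast
      obtain c where c: "c \<in> supp x" "a = c + (- n, - m)"
        using supp_mult_in[OF ab(1)] by auto
      have "snd s < 0"
        using ab c x_supp[of c] by (auto simp: in_keys_iff below_def split: if_splits)
      then show "ip (monomial s) (dagger p) = 0"
        using L_neg_w by (cases s) (auto simp: laurent_inner_def)
    qed
    then show ?thesis by (simp add: p_rev_def ac_simps)
  qed
  have "ip g (dual i l) = L (x * (dagger p * below l p) - x * (dagger p_rev * below (l - 1) p_rev))"
    by (simp add: laurent_inner_def dual_def x_def algebra_simps)
  also have "\<dots> = L (x * (dagger p * below l p))"
    by (simp add: L_diff 2)
  also have "\<dots> = L (x * (dagger p * (below l p + above l p)))"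
    using 1 by (simp add: distrib_left L_add ac_simps)
  also have "\<dots> = coef g (i, l)"
    using L_p_dagger_p[of x] \<open>coef x 0 = coef g (i, l)\<close> by (simp add: below_above mult.commute)
  finally show ?thesis .
qed

text \<open>\<open>ip_dual\<close> applied to \<open>dual\<close> itself exhibits its coefficients
  as inner products, and the form is Hermitian.\<close>

lemma coef_dual_sym: "coef (dual k l) (i, j) = cnj (coef (dual i j) (k, l))"
proof -
  have "ip (dual k l) (dual i j) = coef (dual k l) (i, j)" for i j k l
    by (rule ip_dual) (use supp_dual[of k l] in auto)
  then show ?thesis
    by (metis ip_cnj)
qed

lemma ip_dual_monomial:
  assumes "0 \<le> j" "j \<le> m"
  shows "ip (dual k l) (monomial (i, j)) = (if k = i \<and> l = j then 1 else 0)"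
proof -
  have "ip (monomial (i, j)) (dual k l) = (if k = i \<and> l = j then 1 else 0)"
    using assms by (subst ip_dual) (auto simp: coef_monomial)
  then show ?thesis
    by (metis ip_cnj complex_cnj_one complex_cnj_zero)
qed

text \<open>By bandedness of \<open>dual\<close>, the combination \<open>u N\<close> that has the same products as \<open>y\<close> with the
  monomials \<open>z\<^sup>i w\<^sup>j\<close>, \<open>-N \<le> i < 0\<close>, consists of a part \<open>v N\<close> with \<open>i \<ge> 0\<close>, to which it is orthogonal, and of a
  part \<open>r N\<close> with \<open>i\<close> near \<open>-N\<close>, which tends to zero by Bessel's inequality.\<close>

lemma orth_extends_left:
  assumes y: "supp y \<subseteq> grid n m"
    and perp: "\<And>i j. 0 \<le> i \<Longrightarrow> i < n \<Longrightarrow> 0 \<le> j \<Longrightarrow> j \<le> m \<Longrightarrow> ip y (monomial (i, j)) = 0"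
    and ij: "i < n" "0 \<le> j" "j \<le> m"
  shows "ip y (monomial (i, j)) = 0"
proof (cases "0 \<le> i")
  case True
  then show ?thesis using perp ij by blast
next
  case False
  define t where "t s = ip y (monomial s)" for s
  define u where "u N = (\<Sum>s\<in>{- int N..-1} \<times> {0..m}. cst (t s) * dual (fst s) (snd s))" for N
  define v where "v N = restr (\<lambda>e. 0 \<le> fst e) (u N)" for N
  define r where "r N = restr (\<lambda>e. fst e < 0) (u N)" for N
  have uvr: "u N = v N + r N" for N
    by (rule poly_mapping_eqI) (simp add: v_def r_def lookup_add)
  have ipu: "ip (u N) (monomial (a, b)) = (if - int N \<le> a \<and> a < 0 then t (a, b) else 0)"
    if "0 \<le> b" "b \<le> m" for N a b
  proof -
    have "ip (u N) (monomial (a, b)) = (\<Sum>s\<in>{- int N..-1} \<times> {0..m}. if s = (a, b) then t s else 0)"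
      unfolding u_def ip_sum_left
      by (rule sum.cong) (auto simp: ip_cst_left ip_dual_monomial[OF that] prod_eq_iff)
    also have "\<dots> = (if - int N \<le> a \<and> a < 0 then t (a, b) else 0)"
      using that by (auto simp: sum.delta')
    finally show ?thesis .
  qed
  have cu: "coef (u N) s = (\<Sum>e\<in>{- int N..-1} \<times> {0..m}. t e * coef (dual (fst e) (snd e)) s)" for N s
    by (simp add: u_def lookup_sum)
  have su: "supp (u N) \<subseteq> {- int N - n..n - 1} \<times> {0..m}" for N
    unfolding u_def
  proof (intro supp_sum supp_cst_mult)
    fix a assume "a \<in> {- int N..-1} \<times> {0..m}"
    then show "supp (dual (fst a) (snd a)) \<subseteq> {- int N - n..n - 1} \<times> {0..m}"
      using supp_dual[of "fst a" "snd a"] by fastforce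
  qed
  \<comment> \<open>Between the two parts nothing survives: for such \<open>a\<close> the band of
    \<open>dual a b\<close> stays inside \<open>- N \<le> i < n\<close>, and \<open>perp\<close>
    removes \<open>0 \<le> i\<close>, so the coefficient is \<open>ip y (dual a b)\<close>, a
    coefficient of \<open>y\<close> at a negative power of \<open>z\<close>.\<close>
  have gap: "coef (u N) (a, b) = 0" if "- int N + n \<le> a" "a < 0" for N a b
  proof -
    have "supp (dual a b) \<subseteq> {- int N..n - 1} \<times> {0..m}"
      using supp_dual[of a b] that by fastforce
    then have "ip y (dual a b) = (\<Sum>e\<in>{- int N..n - 1} \<times> {0..m}. t e * coef (dual (fst e) (snd e)) (a, b))"
      by (subst ip_expand_right[of "{- int N..n - 1} \<times> {0..m}"])
         (auto simp: t_def coef_dual_sym[of _ _ a b] mult.commute intro!: sum.cong)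
    also have "\<dots> = coef (u N) (a, b)"
      unfolding cu
    proof (intro sum.mono_neutral_right ballI)
      fix e assume "e \<in> {- int N..n - 1} \<times> {0..m} - {- int N..-1} \<times> {0..m}"
      then have "0 \<le> fst e" "fst e < n" "0 \<le> snd e" "snd e \<le> m"
        by (cases e, force)+
      then have "t e = 0"
        using perp[of "fst e" "snd e"] by (simp add: t_def)
      then show "t e * coef (dual (fst e) (snd e)) (a, b) = 0" by simp
    qed (use nm in auto)
    finally have "coef (u N) (a, b) = ip y (dual a b)" by simp
    also have "\<dots> = coef y (a, b)"
      using y by (intro ip_dual) auto
    also have "\<dots> = 0"
      using suppD[OF y] that by auto
    finally show ?thesis .
  qed
  have "ip (u N) (v N) = 0" for N
  proof (rule ip_zero_right)
    fix s assume "s \<in> supp (v N)"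
    then have "0 \<le> fst s" "s \<in> supp (u N)"
      by (auto simp: v_def in_keys_iff split: if_splits)
    then show "ip (u N) (monomial s) = 0"
      using su[of N] ipu[of "snd s" N "fst s"] by (cases s) auto
  qed
  then have "ip (u N) (u N) = ip (u N) (r N)" for N
    using ip_add_right[of "u N" "v N" "r N"] by (simp flip: uvr)
  then have "(Re (ip (u N) (u N)))\<^sup>2 \<le> Re (ip (u N) (u N)) * Re (ip (r N) (r N))" for N
    using ip_cauchy_schwarz[of "u N" "r N"] ip_self[of "u N"]
    by (metis norm_of_real power2_abs)
  then have ur: "Re (ip (u N) (u N)) \<le> Re (ip (r N) (r N))" for N
    using ip_nonneg[of "u N"] ip_nonneg[of "r N"]
    by (cases "Re (ip (u N) (u N)) = 0") (auto simp: power2_eq_square mult_le_cancel_left)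
  have "(\<lambda>N. Re (ip (r N) (r N))) \<longlonglongrightarrow> 0"
  proof (rule ip_tendsto_0[where T = "{- n..n - 1} \<times> {0..m}" and e = "\<lambda>N. (- int N, 0)"])
    fix N
    show "supp (r N) \<subseteq> (\<lambda>t. t + (- int N, 0)) ` ({- n..n - 1} \<times> {0..m})"
    proof
      fix e assume "e \<in> supp (r N)"
      then have e: "fst e < 0" "coef (u N) e \<noteq> 0"
        by (auto simp: r_def in_keys_iff split: if_splits)
      then have "e \<in> {- int N - n..n - 1} \<times> {0..m}"
        using su[of N] by (auto simp: in_keys_iff)
      moreover have "fst e < - int N + n"
        using gap[of N "fst e" "snd e"] e by fastforce
      ultimately have "e = (fst e + int N, snd e) + (- int N, 0)" "(fst e + int N, snd e) \<in> {- n..n - 1} \<times> {0..m}"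
        by auto
      then show "e \<in> (\<lambda>t. t + (- int N, 0)) ` ({- n..n - 1} \<times> {0..m})"
        by (rule image_eqI)
    qed
  next
    fix s :: "int \<times> int" assume s: "s \<in> {- n..n - 1} \<times> {0..m}"
    \<comment> \<open>By bandedness the coefficient of \<open>r N\<close> involves just the products
      \<open>t\<close> within \<open>2 * n\<close> of \<open>- N\<close>, and by shift invariance of
      \<open>dual\<close> their weights do not depend on \<open>N\<close>.\<close>
    define c where "c N = (\<Sum>e\<in>{0..2 * n} \<times> {0..m}. t (- int N + fst e, snd e) * coef (dual (fst e) (snd e)) s)" for N
    have "(\<lambda>N. t (- int N + fst e, snd e)) \<longlonglongrightarrow> 0" for e
      unfolding t_def by (rule ip_monomial_tendsto_0) (auto simp: inj_def)
    then have "c \<longlonglongrightarrow> (\<Sum>e\<in>{0..2 * n} \<times> {0..m}. 0 * coef (dual (fst e) (snd e)) s)"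
      unfolding c_def by (intro tendsto_sum tendsto_mult tendsto_const)
    then have c0: "c \<longlonglongrightarrow> 0" by simp
    have eq: "coef (r N) (s + (- int N, 0)) = c N" if N: "2 * n < int N" for N
    proof -
      have "coef (r N) (s + (- int N, 0)) = coef (u N) (- int N + fst s, snd s)"
        using s N by (cases s) (auto simp: r_def)
      also have "\<dots> = (\<Sum>e\<in>{- int N..- int N + 2 * n} \<times> {0..m}. t e * coef (dual (fst e) (snd e)) (- int N + fst s, snd s))"
        unfolding cu
      proof (intro sum.mono_neutral_right ballI)
        fix e assume e: "e \<in> {- int N..-1} \<times> {0..m} - {- int N..- int N + 2 * n} \<times> {0..m}"
        then have "(- int N + fst s, snd s) \<notin> {fst e - n..fst e + n} \<times> {0..m}"
          using s by auto
        then show "t e * coef (dual (fst e) (snd e)) (- int N + fst s, snd s) = 0"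
          using suppD[OF supp_dual] by simp
      qed (use N in auto)
      also have "\<dots> = c N"
        unfolding c_def
        by (rule sum.reindex_bij_witness[of _ "\<lambda>e. (- int N + fst e, snd e)" "\<lambda>e. (int N + fst e, snd e)"])
           (auto simp: coef_dual_shift[of "- int N", simplified] simp flip: coef_dual_shift[of "int N"])
      finally show ?thesis .
    qed
    have "\<forall>\<^sub>F N in sequentially. c N = coef (r N) (s + (- int N, 0))"
      using eventually_gt_at_top[of "nat (2 * n)"] by (rule eventually_mono) (use eq in auto)
    with c0 show "(\<lambda>N. coef (r N) (s + (- int N, 0))) \<longlonglongrightarrow> 0"
      by (rule Lim_transform_eventually)
  qed auto
  then have lim: "(\<lambda>N. Re (ip (r N) (r N)) * Re (ip (monomial (i, j)) (monomial (i, j)))) \<longlonglongrightarrow> 0"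
    by (rule tendsto_mult_left_zero)
  \<comment> \<open>Once \<open>N \<ge> - i\<close>, the product of \<open>u N\<close> with this
    fixed monomial is exactly \<open>t (i, j)\<close>, while the norm of \<open>u N\<close> is at
    most that of \<open>r N\<close>.\<close>
  have "\<forall>\<^sub>F N in sequentially. (cmod (t (i, j)))\<^sup>2 \<le> Re (ip (r N) (r N)) * Re (ip (monomial (i, j)) (monomial (i, j)))"
    using eventually_ge_at_top[of "nat (- i)"]
  proof eventually_elim
    case (elim N)
    then have "(cmod (t (i, j)))\<^sup>2 = (cmod (ip (u N) (monomial (i, j))))\<^sup>2"
      using False ij by (simp add: ipu)
    also have "\<dots> \<le> Re (ip (u N) (u N)) * Re (ip (monomial (i, j)) (monomial (i, j)))"
      by (rule ip_cauchy_schwarz)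
    also have "\<dots> \<le> Re (ip (r N) (r N)) * Re (ip (monomial (i, j)) (monomial (i, j)))"
      by (intro mult_right_mono ur ip_nonneg)
    finally show ?case .
  qed
  then have "(cmod (t (i, j)))\<^sup>2 \<le> 0"
    by (intro tendsto_lowerbound[OF lim]) auto
  then show ?thesis by (simp add: t_def)
qed

text \<open>\<open>dual i m\<close> is a multiple of \<open>p_rev\<close>, so its pairing with
  \<open>y\<close> combines pairings with \<open>z^k p_rev\<close>. These vanish for
  \<open>k < 0\<close> by \<open>orth_extends_left\<close>, and for \<open>k \<ge> 0\<close> because
  \<open>y\<close> lacks the corner \<open>(n, m)\<close>, which leaves a negative exponent in front
  of \<open>p\<close>.\<close>

lemma top_row_zero:
  assumes y: "supp y \<subseteq> grid n m - {(n, m)}"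
    and perp: "\<And>i j. 0 \<le> i \<Longrightarrow> i < n \<Longrightarrow> 0 \<le> j \<Longrightarrow> j \<le> m \<Longrightarrow> ip y (monomial (i, j)) = 0"
  shows "coef y (i, m) = 0"
proof -
  have pr: "ip y (monomial (k, 0) * p_rev) = 0" for k
  proof (cases "k < 0")
    case True
    show ?thesis
    proof (rule ip_zero_right)
      fix s assume "s \<in> supp (monomial (k, 0) * p_rev)"
      then have "s - (k, 0) \<in> grid n m"
        using supp_prev by (auto simp: supp_monomial_mult)
      then show "ip y (monomial s) = 0"
        using orth_extends_left[of y "fst s" "snd s"] y perp True by (cases s) auto
    qed
  next
    case False
    show ?thesis
    proof (rule ip_zero_left)
      fix s assume "s \<in> supp y"
      then obtain a b where s: "s = (a, b)" "a \<le> n" "b \<le> m" "a < n \<or> b < m"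
        using y by (cases s) force
      have "ip (monomial s) (monomial (k, 0) * p_rev) = L (monomial (a - k - n, b - m) * p)"
        by (simp add: s(1) laurent_inner_def p_rev_def monomial_mult algebra_simps flip: mult.assoc)
      then show "ip (monomial s) (monomial (k, 0) * p_rev) = 0"
        using s False L_neg_z[of "a - k - n" "b - m"] L_neg_w[of "b - m" "a - k - n"] by auto
    qed
  qed
  have "below 0 p = p - above 0 p"
    using below_above[of 0 p] by (simp add: algebra_simps)
  moreover have "below m p = p"
    using coef_p_outside by (intro poly_mapping_eqI) (auto simp: below_def)
  ultimately have "dual i m = monomial (i, m) * (p * dagger p - dagger p * (p - below 0 p))"
    by (simp add: dual_alt1)
  also have "p * dagger p - dagger p * (p - below 0 p) = dagger p * below 0 p"
    by (simp add: right_diff_distrib mult.commute)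
  also have "monomial (i, m) = monomial (i - n, 0) * monomial (n, m)"
    by (simp add: monomial_mult)
  finally have Em: "dual i m = below 0 p * (monomial (i - n, 0) * p_rev)"
    by (simp add: p_rev_def mult_ac)
  have "ip (y * dagger (monomial (i - n, 0) * p_rev)) (below 0 p) = 0"
  proof (rule ip_zero_right)
    fix s assume "s \<in> supp (below 0 p)"
    then have "snd s = 0"
      using supp_p by (auto simp: below_def in_keys_iff split: if_splits)
    then have "monomial (i - n + fst s, 0) = monomial (i - n, 0) * monomial s"
      by (cases s) (simp add: monomial_mult)
    then have "ip (y * dagger (monomial (i - n, 0) * p_rev)) (monomial s) = ip y (monomial (i - n + fst s, 0) * p_rev)"
      by (simp add: laurent_inner_def mult_ac)
    then show "ip (y * dagger (monomial (i - n, 0) * p_rev)) (monomial s) = 0"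
      by (simp add: pr)
  qed
  then have "ip y (dual i m) = 0"
    by (simp add: Em laurent_inner_def ac_simps)
  moreover have "ip y (dual i m) = coef y (i, m)"
    using y by (intro ip_dual) auto
  ultimately show ?thesis by simp
qed

end

subsection \<open>Reproducing kernels\<close>

lemma sum_shift_int:
  fixes f :: "int \<Rightarrow> 'a::ab_group_add"
  assumes "0 \<le> n" "f (-1) = 0" "f n = 0"
  shows "(\<Sum>i\<in>{0..n}. f (i - 1)) = (\<Sum>i\<in>{0..n}. f i)"
proof -
  have "(\<Sum>i\<in>{0..n}. f (i - 1)) = (\<Sum>i\<in>{-1..n - 1}. f i)"
    by (rule sum.reindex_bij_witness[of _ "\<lambda>i. i + 1" "\<lambda>i. i - 1"]) auto
  also have "\<dots> = sum f (insert n {-1..n - 1})"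
    using assms by simp
  also have "insert n {-1..n - 1} = insert (-1) {0..n}"
    using assms(1) by auto
  also have "sum f \<dots> = (\<Sum>i\<in>{0..n}. f i)"
    using assms by simp
  finally show ?thesis .
qed

context toeplitz_form
begin

lemma represents_monomials:
  assumes "finite U" "\<And>t. t \<in> U \<Longrightarrow> ip (monomial t) k = (if s = t then 1 else 0)" "supp h \<subseteq> U"
  shows "ip h k = coef h s"
proof -
  have "ip h k = (\<Sum>t\<in>U. if t = s then coef h t else 0)"
    unfolding ip_expand_left[OF assms(1,3)] by (rule sum.cong) (auto simp: assms(2))
  then show ?thesis
    using assms(1) suppD[OF assms(3), of s] by (simp add: sum.delta)
qed

lemma ip_monomial_kap:
  assumes "finite S" "t \<in> S"
  shows "ip (monomial t) (kap S s) = (if s = t then 1 else 0)"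
  using assms by (subst ip_kap) (auto simp: coef_monomial)

text \<open>The difference of representers lies in the span of \<open>S2\<close> and is orthogonal
  to that of the intersection, so just the part of \<open>g\<close> orthogonal to the intersection
  counts, and \<open>AB\<close> handles it.\<close>

lemma ip_kap_difference:
  assumes fin: "finite S1" "finite S2" and g: "supp g \<subseteq> S1"
    and AB: "\<And>q r. supp q \<subseteq> S1 \<Longrightarrow> supp r \<subseteq> S2 \<Longrightarrow>
      (\<And>t. t \<in> S1 \<inter> S2 \<Longrightarrow> ip q (monomial t) = 0) \<Longrightarrow>
      (\<And>t. t \<in> S1 \<inter> S2 \<Longrightarrow> ip r (monomial t) = 0) \<Longrightarrow> ip q r = 0"
  shows "ip g (kap S2 s - kap (S1 \<inter> S2) s) = 0"
proof -
  let ?S0 = "S1 \<inter> S2" and ?r = "kap S2 s - kap (S1 \<inter> S2) s"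
  have r: "supp ?r \<subseteq> S2"
    using fin supp_kap[of S2 s] supp_kap[of ?S0 s] by (intro supp_diff) auto
  have r0: "ip (monomial t) ?r = 0" if "t \<in> ?S0" for t
    using fin that by (simp add: ip_diff_right ip_monomial_kap)
  have pr: "supp (proj ?S0 g) \<subseteq> ?S0"
    using fin by (intro supp_proj) auto
  have "ip (proj ?S0 g) ?r = 0"
    by (rule ip_zero_left, rule r0) (use pr in auto)
  moreover have "ip (g - proj ?S0 g) ?r = 0"
  proof (rule AB)
    show "supp (g - proj ?S0 g) \<subseteq> S1"
      using g pr by (intro supp_diff) auto
    show "ip (g - proj ?S0 g) (monomial t) = 0" if "t \<in> ?S0" for t
      using fin that by (simp add: ip_diff_left ip_proj_monomial)
    show "ip ?r (monomial t) = 0" if "t \<in> ?S0" for t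
      using r0[OF that] ip_swap_zero by blast
  qed (rule r)
  ultimately show ?thesis
    by (simp add: ip_diff_left)
qed

text \<open>Inclusion-exclusion for kernels: by \<open>AB\<close> the two spans are orthogonal
  modulo their intersection. \<open>P\<close> is the unit vector that adds the one remaining
  dimension and contributes a rank one term.\<close>

lemma kap_decomposition:
  assumes fin: "finite S1" "finite S2" and e: "e \<notin> S1 \<union> S2"
    and P: "supp P \<subseteq> insert e (S1 \<union> S2)" "ip P P = 1"
      "\<And>t. t \<in> S1 \<union> S2 \<Longrightarrow> ip P (monomial t) = 0"
    and AB: "\<And>q r. supp q \<subseteq> S1 \<Longrightarrow> supp r \<subseteq> S2 \<Longrightarrow>
      (\<And>t. t \<in> S1 \<inter> S2 \<Longrightarrow> ip q (monomial t) = 0) \<Longrightarrow>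
      (\<And>t. t \<in> S1 \<inter> S2 \<Longrightarrow> ip r (monomial t) = 0) \<Longrightarrow> ip q r = 0"
  shows "kap (insert e (S1 \<union> S2)) s = kap S1 s + kap S2 s - kap (S1 \<inter> S2) s + cst (cnj (coef P s)) * P"
    (is "_ = ?k")
proof (rule kap_eqI)
  let ?T = "insert e (S1 \<union> S2)"
  have BA: "ip r q = 0" if "supp r \<subseteq> S2" "supp q \<subseteq> S1"
    "\<And>t. t \<in> S2 \<inter> S1 \<Longrightarrow> ip r (monomial t) = 0" "\<And>t. t \<in> S2 \<inter> S1 \<Longrightarrow> ip q (monomial t) = 0" for r q
    using AB[of q r] that ip_swap_zero by blast
  have P0: "ip (monomial t) P = 0" if "t \<in> S1 \<union> S2" for t
    using P(3)[OF that] ip_swap_zero by blast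
  have mono: "ip (monomial t) ?k = (if s = t then 1 else 0)" if t: "t \<in> S1 \<union> S2" for t
  proof (cases "t \<in> S1")
    case True
    have "ip (monomial t) (kap S2 s - kap (S1 \<inter> S2) s) = 0"
      by (rule ip_kap_difference[OF fin _ AB]) (use True in auto)
    then show ?thesis
      using True P0[OF t] fin by (simp add: ip_add_right ip_diff_right ip_cst_right ip_monomial_kap)
  next
    case False
    have "ip (monomial t) (kap S1 s - kap (S2 \<inter> S1) s) = 0"
      by (rule ip_kap_difference[OF fin(2,1) _ BA]) (use False t in auto)
    then show ?thesis
      using False t P0[OF t] fin
      by (simp add: ip_add_right ip_diff_right ip_cst_right ip_monomial_kap Int_commute)
  qed
  have small: "ip h ?k = coef h s" if "supp h \<subseteq> S1 \<union> S2" for h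
    using fin that mono by (intro represents_monomials[of "S1 \<union> S2"]) auto
  have "ip P x = 0" if "supp x \<subseteq> S1 \<union> S2" for x
    by (rule ip_zero_right, rule P(3)) (use that in auto)
  moreover have "supp (kap S1 s + kap S2 s - kap (S1 \<inter> S2) s) \<subseteq> S1 \<union> S2"
    using fin supp_kap[of S1 s] supp_kap[of S2 s] supp_kap[of "S1 \<inter> S2" s]
    by (intro supp_diff supp_add) auto
  ultimately have Pk: "ip P ?k = coef P s"
    by (simp add: ip_add_right ip_cst_right P(2))
  have Pe: "coef P e \<noteq> 0"
  proof
    assume "coef P e = 0"
    then have sub: "supp P \<subseteq> S1 \<union> S2"
      using P(1) by (auto simp: in_keys_iff)
    have "ip P P = 0"
      by (rule ip_zero_right, rule P(3)) (use sub in auto)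
    then show False using P(2) by simp
  qed
  show "represents ?T s ?k"
    unfolding represents_def
  proof (intro conjI allI impI)
    show "supp ?k \<subseteq> ?T"
      using fin supp_kap[of S1 s] supp_kap[of S2 s] supp_kap[of "S1 \<inter> S2" s] P(1)
      by (intro supp_diff supp_add supp_cst_mult) auto
  next
    fix g assume g: "supp g \<subseteq> ?T"
    \<comment> \<open>Subtracting this multiple of \<open>P\<close> removes the coefficient at
      \<open>e\<close> and reduces the claim to \<open>small\<close>.\<close>
    define c where "c = coef g e / coef P e"
    have "supp (g - cst c * P) \<subseteq> S1 \<union> S2"
      unfolding supp_subset_iff
    proof (intro allI impI)
      fix t assume "t \<notin> S1 \<union> S2"
      then show "coef (g - cst c * P) t = 0"
        using suppD[OF g, of t] suppD[OF P(1), of t] Pe by (cases "t = e") (simp_all add: lookup_minus c_def)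
    qed
    from small[OF this] show "ip g ?k = coef g s"
      by (simp add: ip_diff_left ip_cst_left Pk lookup_minus)
  qed
qed (use fin in simp)

text \<open>Multiplication by a monomial is isometric for the form, so it carries representers to
  representers.\<close>

lemma kap_shift:
  assumes "finite S"
  shows "kap ((\<lambda>t. t + e) ` S) s = monomial e * kap S (s - e)"
proof (rule kap_eqI)
  show "represents ((\<lambda>t. t + e) ` S) s (monomial e * kap S (s - e))"
    unfolding represents_def
  proof (intro conjI allI impI subsetI)
    fix x assume "x \<in> supp (monomial e * kap S (s - e))"
    then have "x - e \<in> supp (kap S (s - e))"
      by (simp only: supp_monomial_mult)
    then have "x - e \<in> S"
      using supp_kap[OF assms] by blast
    then show "x \<in> (\<lambda>t. t + e) ` S"
      by (intro image_eqI[of _ _ "x - e"]) auto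
  next
    fix g assume g: "supp g \<subseteq> (\<lambda>t. t + e) ` S"
    have "supp (monomial (- e) * g) \<subseteq> S"
      using g by (force simp: supp_monomial_mult)
    then have "ip (monomial (- e) * g) (kap S (s - e)) = coef g s"
      using assms by (subst ip_kap) auto
    then show "ip g (monomial e * kap S (s - e)) = coef g s"
      by (simp add: ip_monomial_left)
  qed
qed (use assms in simp)

text \<open>Reversal is conjugate linear and isometric, hence the exchanged arguments; it carries
  orthogonality from one corner of a grid to the opposite one.\<close>

lemma ip_reverse: "ip (monomial e * dagger x) (monomial e * dagger y) = ip y x"
  by (simp add: ip_shift) (simp add: laurent_inner_def mult.commute)

section \<open>Evaluation kernels and their values on the diagonal\<close>

definition point_kernel :: "(int \<times> int) set \<Rightarrow> complex \<Rightarrow> complex \<Rightarrow> laurent" where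
  "point_kernel S z w = (\<Sum>s\<in>S. cst (cnj (pval z w s)) * kap S s)"

definition kernel_diag :: "(int \<times> int) set \<Rightarrow> complex \<Rightarrow> complex \<Rightarrow> real" where
  "kernel_diag S z w = Re (ip (point_kernel S z w) (point_kernel S z w))"

lemma supp_point_kernel: "finite S \<Longrightarrow> supp (point_kernel S z w) \<subseteq> S"
  unfolding point_kernel_def by (intro supp_sum supp_cst_mult supp_kap)

lemma ip_point_kernel:
  assumes "finite S" "supp g \<subseteq> S"
  shows "ip g (point_kernel S z w) = laurent_eval g z w"
  using assms by (simp add: point_kernel_def ip_sum_right ip_cst_right ip_kap laurent_eval_eq) (simp add: mult.commute)

lemma eval_point_kernel:
  assumes "finite S"
  shows "laurent_eval (point_kernel S z w) z w = complex_of_real (kernel_diag S z w)"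
  unfolding kernel_diag_def
  using ip_point_kernel[OF assms supp_point_kernel[OF assms]] ip_self by metis

lemma kernel_diag_difference:
  assumes "finite T" "U \<subseteq> T"
  shows "ip (point_kernel T z w - point_kernel U z w) (point_kernel T z w - point_kernel U z w)
    = complex_of_real (kernel_diag T z w - kernel_diag U z w)"
proof -
  let ?a = "point_kernel U z w" and ?b = "point_kernel T z w"
  have fin: "finite U" using assms finite_subset by blast
  have "ip ?a ?b = complex_of_real (kernel_diag U z w)"
    using ip_point_kernel[OF assms(1) subset_trans[OF supp_point_kernel[OF fin] assms(2)]] eval_point_kernel[OF fin]
    by simp
  moreover from this have "ip ?b ?a = complex_of_real (kernel_diag U z w)"
    by (metis ip_cnj complex_cnj_complex_of_real)
  moreover have "ip ?a ?a = complex_of_real (kernel_diag U z w)" "ip ?b ?b = complex_of_real (kernel_diag T z w)"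
    unfolding kernel_diag_def by (rule ip_self)+
  ultimately show ?thesis
    by (simp add: ip_diff_left ip_diff_right)
qed

lemma kernel_diag_mono: "finite T \<Longrightarrow> U \<subseteq> T \<Longrightarrow> kernel_diag U z w \<le> kernel_diag T z w"
  using kernel_diag_difference[of T U z w] ip_nonneg by (metis Re_complex_of_real diff_ge_0_iff_ge)

lemma point_kernel_nonzero:
  assumes "finite S" "0 \<in> S"
  shows "point_kernel S z w \<noteq> 0"
proof
  assume "point_kernel S z w = 0"
  then have "laurent_eval 1 z w = 0"
    using assms ip_point_kernel[of S 1 z w] by simp
  then show False by simp
qed

text \<open>The support of a nonzero eigenvector would be closed under subtracting \<open>e\<close>,
  hence infinite.\<close>

lemma not_shift_eigenvector:
  assumes "e \<noteq> 0" "monomial e * x = cst c * x" "c \<noteq> 0"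
  shows "x = 0"
proof (rule ccontr)
  assume "x \<noteq> 0"
  then obtain s where "s \<in> supp x"
    by (metis all_not_in_conv keys_eq_empty)
  have "s - (int k * fst e, int k * snd e) \<in> supp x" for k :: nat
  proof (induction k)
    case (Suc k)
    let ?t = "s - (int k * fst e, int k * snd e)"
    have "coef (monomial e * x) ?t = coef (cst c * x) ?t"
      by (simp only: assms(2))
    then have "?t - e \<in> supp x"
      using Suc assms(3) by (simp add: in_keys_iff)
    moreover have "?t - e = s - (int (Suc k) * fst e, int (Suc k) * snd e)"
      by (simp add: prod_eq_iff algebra_simps)
    ultimately show ?case by simp
  qed (use \<open>s \<in> supp x\<close> in \<open>simp add: zero_prod_def[symmetric]\<close>)
  then have "range (\<lambda>k::nat. s - (int k * fst e, int k * snd e)) \<subseteq> supp x"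
    by auto
  moreover have "inj (\<lambda>k::nat. s - (int k * fst e, int k * snd e))"
    using assms(1) by (auto simp: inj_def prod_eq_iff)
  ultimately show False
    using finite_keys[of x] by (meson finite_subset infinite_UNIV_nat finite_imageD)
qed

text \<open>If the two kernels agreed, their common value \<open>\<kappa>\<close> would be an eigenvector of the
  isometry given by the shift, since \<open>\<langle>z\<^sup>e \<kappa>, \<kappa>\<rangle>\<close> would have at least the absolute value of \<open>\<langle>\<kappa>, \<kappa>\<rangle>\<close>.\<close>

lemma kernel_diag_strict_mono:
  assumes fin: "finite T" and U: "U \<subseteq> T" "(\<lambda>t. e + t) ` U \<subseteq> T" and "0 \<in> T" "e \<noteq> 0"
    and mult: "\<And>t. t \<in> U \<Longrightarrow> pval z w (e + t) = pval z w e * pval z w t"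
    and ge: "1 \<le> cmod (pval z w e)"
  shows "kernel_diag U z w < kernel_diag T z w"
proof (rule ccontr)
  assume "\<not> kernel_diag U z w < kernel_diag T z w"
  then have "kernel_diag U z w = kernel_diag T z w"
    using kernel_diag_mono[OF fin U(1), of z w] by simp
  then have eq: "point_kernel T z w = point_kernel U z w"
    using kernel_diag_difference[OF fin U(1), of z w] by simp
  define k where "k = point_kernel U z w"
  define c where "c = pval z w e"
  have sk: "supp k \<subseteq> U"
    unfolding k_def by (rule supp_point_kernel) (use fin U finite_subset in blast)
  have fU: "finite U" using fin U finite_subset by blast
  have se: "supp (monomial e * k) \<subseteq> T"
  proof
    fix x assume "x \<in> supp (monomial e * k)"
    then have "x - e \<in> U" using sk by (auto simp: supp_monomial_mult)
    then have "e + (x - e) \<in> T" using U(2) by blast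
    then show "x \<in> T" by simp
  qed
  have "ip (monomial e * k) k = laurent_eval (monomial e * k) z w"
    using ip_point_kernel[OF fin se, of z w] eq by (simp add: k_def)
  also have "\<dots> = c * laurent_eval k z w"
    unfolding c_def using mult sk by (intro laurent_eval_monomial_mult) auto
  also have "laurent_eval k z w = ip k k"
    unfolding k_def using ip_point_kernel[OF fU supp_point_kernel[OF fU]] by simp
  finally have 1: "ip (monomial e * k) k = c * ip k k" .
  then have 2: "ip k (monomial e * k) = cnj c * ip k k"
    by (metis ip_cnj complex_cnj_mult)
  have "ip (monomial e * k - cst c * k) (monomial e * k - cst c * k) = (1 - c * cnj c) * ip k k"
    by (simp only: ip_diff_left ip_diff_right ip_cst_left ip_cst_right ip_shift 1 2) (simp add: algebra_simps)
  also have "c * cnj c = complex_of_real ((cmod c)\<^sup>2)"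
    by (rule complex_norm_square[symmetric])
  finally have 3: "Re (ip (monomial e * k - cst c * k) (monomial e * k - cst c * k)) = (1 - (cmod c)\<^sup>2) * Re (ip k k)"
    by (simp del: of_real_power)
  have "1 \<le> (cmod c)\<^sup>2"
    using ge unfolding c_def by simp
  then have "Re (ip (monomial e * k - cst c * k) (monomial e * k - cst c * k)) \<le> 0"
    unfolding 3 using ip_nonneg[of k] by (simp add: mult_nonpos_nonneg)
  then have "monomial e * k - cst c * k = 0"
    using ip_pos not_le by blast
  moreover have "c \<noteq> 0"
    using ge by (metis c_def norm_zero not_one_le_zero)
  ultimately have "k = 0"
    using not_shift_eigenvector[of e k c] \<open>e \<noteq> 0\<close> by simp
  moreover have "k \<noteq> 0"
    using point_kernel_nonzero[OF fin \<open>0 \<in> T\<close>, of z w] eq by (simp add: k_def)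
  ultimately show False by simp
qed

text \<open>The sum runs over all of \<open>S\<close>, so that kernels of different subgrids can be
  summed over one common index set; indices outside the translate of \<open>U\<close> contribute
  zero.\<close>

lemma sum_shifted_kernel:
  assumes "finite S" and U: "(\<lambda>t. t + e) ` U \<subseteq> S"
    and mult: "\<And>t. t \<in> U \<Longrightarrow> pval z w (e + t) = pval z w e * pval z w t"
  shows "(\<Sum>s\<in>S. cnj (pval z w s) * laurent_eval (monomial e * kap U (s - e)) z w)
    = complex_of_real ((cmod (pval z w e))\<^sup>2 * kernel_diag U z w)"
proof -
  have fU: "finite U"
    by (rule finite_imageD[of "\<lambda>t. t + e", OF finite_subset[OF U assms(1)]]) (simp add: inj_on_def)
  have "(\<Sum>s\<in>S. cnj (pval z w s) * laurent_eval (monomial e * kap U (s - e)) z w)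
    = (\<Sum>s\<in>(\<lambda>t. t + e) ` U. cnj (pval z w s) * laurent_eval (monomial e * kap U (s - e)) z w)"
  proof (rule sum.mono_neutral_right[OF assms(1) U], intro ballI)
    fix s assume "s \<in> S - (\<lambda>t. t + e) ` U"
    then have "s - e \<notin> U" by force
    then show "cnj (pval z w s) * laurent_eval (monomial e * kap U (s - e)) z w = 0"
      using fU by (simp add: kap_outside)
  qed
  also have "\<dots> = (\<Sum>t\<in>U. cnj (pval z w (t + e)) * laurent_eval (monomial e * kap U t) z w)"
    by (subst sum.reindex) (auto simp: inj_on_def)
  also have "\<dots> = (\<Sum>t\<in>U. pval z w e * cnj (pval z w e) * (cnj (pval z w t) * laurent_eval (kap U t) z w))"
  proof (rule sum.cong)
    fix t assume "t \<in> U"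
    have "laurent_eval (monomial e * kap U t) z w = pval z w e * laurent_eval (kap U t) z w"
      using supp_kap[OF fU] by (intro laurent_eval_monomial_mult mult) blast
    then show "cnj (pval z w (t + e)) * laurent_eval (monomial e * kap U t) z w
      = pval z w e * cnj (pval z w e) * (cnj (pval z w t) * laurent_eval (kap U t) z w)"
      using mult[OF \<open>t \<in> U\<close>] by (simp add: add.commute)
  qed simp
  also have "\<dots> = pval z w e * cnj (pval z w e) * laurent_eval (point_kernel U z w) z w"
    by (simp add: point_kernel_def laurent_eval_sum sum_distrib_left)
  finally show ?thesis
    using fU by (simp add: eval_point_kernel complex_norm_square del: of_real_power)
qed

lemma kernel_diag_shift:
  assumes "finite U" "\<And>t. t \<in> U \<Longrightarrow> pval z w (e + t) = pval z w e * pval z w t"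
  shows "kernel_diag ((\<lambda>t. t + e) ` U) z w = (cmod (pval z w e))\<^sup>2 * kernel_diag U z w"
proof -
  have "complex_of_real (kernel_diag ((\<lambda>t. t + e) ` U) z w)
    = (\<Sum>s\<in>(\<lambda>t. t + e) ` U. cnj (pval z w s) * laurent_eval (kap ((\<lambda>t. t + e) ` U) s) z w)"
    using assms(1) by (simp add: point_kernel_def laurent_eval_sum flip: eval_point_kernel)
  also have "\<dots> = complex_of_real ((cmod (pval z w e))\<^sup>2 * kernel_diag U z w)"
    using sum_shifted_kernel[of "(\<lambda>t. t + e) ` U" e U z w] assms by (simp add: kap_shift)
  finally show ?thesis
    using of_real_eq_iff by blast
qed

end

subsection \<open>Christoffel-Darboux identity and stability\<close>

context toeplitz_form
begin

definition orthonormal_at :: "(int \<times> int) set \<Rightarrow> int \<times> int \<Rightarrow> laurent \<Rightarrow> bool" where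
  "orthonormal_at S e q \<longleftrightarrow> supp q \<subseteq> S \<and> coef q e \<in> \<real> \<and> Re (coef q e) > 0 \<and> ip q q = 1 \<and>
    (\<forall>s\<in>S - {e}. ip q (monomial s) = 0)"

text \<open>Multiplied by its leading coefficient, \<open>q\<close> becomes the representer of that
  coefficient, and positivity fixes the scalar. This is the uniqueness behind \<open>THE\<close> in
  \<open>orthonormal_poly\<close>.\<close>

lemma orthonormal_at_unique:
  assumes "finite S" "orthonormal_at S e q"
  shows "q = cst (complex_of_real (1 / sqrt (Re (ip (kap S e) (kap S e))))) * kap S e"
proof -
  define c where "c = Re (coef q e)"
  have c: "coef q e = complex_of_real c" "0 < c"
    using assms(2) by (auto simp: orthonormal_at_def c_def)
  have q: "supp q \<subseteq> S" "ip q q = 1" "\<And>s. s \<in> S \<Longrightarrow> s \<noteq> e \<Longrightarrow> ip q (monomial s) = 0"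
    using assms(2) by (auto simp: orthonormal_at_def)
  have "e \<in> S"
    using c q(1) by (auto simp: in_keys_iff)
  have red: "ip g q = coef g e * ip (monomial e) q" if "supp g \<subseteq> S" for g
  proof -
    have "ip (g - cst (coef g e) * monomial e) q = 0"
    proof (rule ip_zero_left)
      fix s assume "s \<in> supp (g - cst (coef g e) * monomial e)"
      then have "s \<noteq> e" "s \<in> S"
        using that suppD[OF that, of s] by (auto simp: in_keys_iff lookup_minus coef_monomial split: if_splits)
      then show "ip (monomial s) q = 0"
        using q(3) ip_swap_zero by blast
    qed
    then show ?thesis by (simp add: ip_diff_left ip_cst_left)
  qed
  have "represents S e (cst (complex_of_real c) * q)"
    unfolding represents_def
  proof (intro conjI allI impI)
    fix g assume "supp g \<subseteq> S"
    moreover have "complex_of_real c * ip (monomial e) q = 1"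
      using red[OF q(1)] q(2) c(1) by simp
    ultimately show "ip g (cst (complex_of_real c) * q) = coef g e"
      using red[of g] by (simp add: ip_cst_right mult.left_commute)
  qed (use q in \<open>simp add: supp_cst_mult\<close>)
  then have k: "kap S e = cst (complex_of_real c) * q"
    by (rule kap_eqI[OF assms(1)])
  then have "sqrt (Re (ip (kap S e) (kap S e))) = c"
    using c(2) q(2) by (simp add: ip_cst_left ip_cst_right real_sqrt_mult_self)
  then show ?thesis
    using c(2) by (intro poly_mapping_eqI) (simp add: k)
qed

lemma orthonormal_at_exists:
  assumes "finite S" "e \<in> S"
  shows "orthonormal_at S e (cst (complex_of_real (1 / sqrt (Re (ip (kap S e) (kap S e))))) * kap S e)"
proof -
  let ?k = "kap S e"
  define c where "c = 1 / sqrt (Re (ip ?k ?k))"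
  have "ip (monomial e) ?k = 1"
    using assms by (subst ip_monomial_kap) auto
  then have "?k \<noteq> 0" by auto
  then have pos: "0 < Re (ip ?k ?k)" by (rule ip_pos)
  then have c: "0 < c" by (simp add: c_def)
  have ke: "coef ?k e = complex_of_real (Re (ip ?k ?k))"
    using ip_kap[OF assms(1) supp_kap[OF assms(1)], of e e] ip_self by metis
  have "ip (cst (complex_of_real c) * ?k) (cst (complex_of_real c) * ?k) = complex_of_real (c * c) * ip ?k ?k"
    by (simp add: ip_cst_left ip_cst_right)
  also have "\<dots> = complex_of_real (c * c * Re (ip ?k ?k))"
    by (subst (1) ip_self) simp
  also have "c * c * Re (ip ?k ?k) = 1"
    using pos by (simp add: c_def)
  finally have norm: "ip (cst (complex_of_real c) * ?k) (cst (complex_of_real c) * ?k) = 1"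
    by simp
  show ?thesis
    unfolding orthonormal_at_def c_def[symmetric]
  proof (intro conjI ballI)
    show "supp (cst (complex_of_real c) * ?k) \<subseteq> S"
      by (intro supp_cst_mult supp_kap assms)
    have "coef (cst (complex_of_real c) * ?k) e = complex_of_real (c * Re (ip ?k ?k))"
      unfolding coef_cst_mult by (subst ke) simp
    then show "coef (cst (complex_of_real c) * ?k) e \<in> \<real>" "0 < Re (coef (cst (complex_of_real c) * ?k) e)"
      using c pos by simp_all
    show "ip (cst (complex_of_real c) * ?k) (monomial s) = 0" if "s \<in> S - {e}" for s
      using that assms by (subst ip_cst_left, subst ip_kap_right) auto
  qed (rule norm)
qed

lemma orthonormal_poly_eqI: "finite S \<Longrightarrow> orthonormal_at S e q \<Longrightarrow> orthonormal_poly L S e = q"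
  unfolding orthonormal_poly_def orthonormal_at_def[symmetric]
  using orthonormal_at_unique by (intro the_equality) (assumption, metis)

lemma orthonormal_at_orthonormal_poly: "finite S \<Longrightarrow> e \<in> S \<Longrightarrow> orthonormal_at S e (orthonormal_poly L S e)"
  using orthonormal_at_exists orthonormal_poly_eqI by metis

lemma orthonormal_polyD:
  assumes "finite S" "e \<in> S"
  shows "supp (orthonormal_poly L S e) \<subseteq> S" "coef (orthonormal_poly L S e) e \<noteq> 0"
    "ip (orthonormal_poly L S e) (orthonormal_poly L S e) = 1"
    "s \<in> S \<Longrightarrow> s \<noteq> e \<Longrightarrow> ip (orthonormal_poly L S e) (monomial s) = 0"
  using orthonormal_at_orthonormal_poly[OF assms] by (auto simp: orthonormal_at_def)

text \<open>Triangularity: the polynomial at \<open>e k\<close> involves \<open>U\<close> and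
  \<open>e 0, ..., e k\<close>, with a nonzero coefficient at \<open>e k\<close>, so orthogonality
  passes from polynomials to monomials by induction.\<close>

lemma orthonormal_polys_span:
  fixes e :: "nat \<Rightarrow> int \<times> int"
  assumes "finite U" and U: "\<And>t. t \<in> U \<Longrightarrow> ip (monomial t) r = 0"
    and zero: "\<And>j. j \<le> b \<Longrightarrow> ip (orthonormal_poly L (U \<union> e ` {..j}) (e j)) r = 0"
    and "k \<le> b"
  shows "ip (monomial (e k)) r = 0"
  using \<open>k \<le> b\<close>
proof (induction k rule: less_induct)
  case (less k)
  define q where "q = orthonormal_poly L (U \<union> e ` {..k}) (e k)"
  have q: "supp q \<subseteq> U \<union> e ` {..k}" "coef q (e k) \<noteq> 0"
    unfolding q_def using \<open>finite U\<close> orthonormal_polyD(1,2)[of "U \<union> e ` {..k}" "e k"] by simp_all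
  have "ip (q - cst (coef q (e k)) * monomial (e k)) r = 0"
  proof (rule ip_zero_left)
    fix s assume "s \<in> supp (q - cst (coef q (e k)) * monomial (e k))"
    then have s: "s \<noteq> e k" "s \<in> supp q"
      by (auto simp: in_keys_iff lookup_minus coef_monomial split: if_splits)
    then have "s \<in> U \<union> e ` {..k}" using q(1) by blast
    then consider "s \<in> U" | j where "j \<le> k" "s = e j" by blast
    then show "ip (monomial s) r = 0"
    proof cases
      case 2
      then have "j < k" using s(1) by (cases "j = k") auto
      then show ?thesis using less 2 by simp
    qed (rule U)
  qed
  then have "coef q (e k) * ip (monomial (e k)) r = ip q r"
    by (simp add: ip_diff_left ip_cst_left)
  also have "\<dots> = 0"
    unfolding q_def using less.prems by (rule zero)
  finally show ?case
    using q(2) by simp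
qed

end

text \<open>The basis-free form of the vanishing of \<open>K_mat L n m\<close>.\<close>

locale uncoupled_form = toeplitz_form +
  fixes n m :: int
  assumes nm1: "1 \<le> n" "1 \<le> m"
    and uncoupled: "\<lbrakk>supp q \<subseteq> grid n (m - 1); supp r \<subseteq> grid (n - 1) m;
      \<And>t. t \<in> grid (n - 1) (m - 1) \<Longrightarrow> ip q (monomial t) = 0;
      \<And>t. t \<in> grid (n - 1) (m - 1) \<Longrightarrow> ip r (monomial t) = 0\<rbrakk> \<Longrightarrow> ip q r = 0"
begin

definition lead :: laurent where
  "lead = orthonormal_poly L (grid n m) (n, m)"

text \<open>The reverse of \<open>lead\<close> is orthogonal to all monomials of the grid but
  \<open>1\<close>; it is the candidate for the stable factor.\<close>

definition base :: laurent where
  "base = monomial (n, m) * dagger lead"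

lemma
  shows supp_lead: "supp lead \<subseteq> grid n m" and ip_lead_lead: "ip lead lead = 1"
    and ip_lead_monomial: "t \<in> grid n m \<Longrightarrow> t \<noteq> (n, m) \<Longrightarrow> ip lead (monomial t) = 0"
  unfolding lead_def using nm1 orthonormal_polyD[of "grid n m" "(n, m)"] by simp_all

lemma supp_base: "supp base \<subseteq> grid n m"
proof
  fix e assume "e \<in> supp base"
  then have "(n, m) - e \<in> supp lead"
    by (simp add: base_def in_keys_iff lookup_dagger)
  then have "(n, m) - e \<in> grid n m"
    using supp_lead by blast
  then show "e \<in> grid n m" by (cases e) auto
qed

lemma ip_base_base: "ip base base = 1"
  by (simp add: base_def ip_reverse ip_lead_lead)

lemma ip_base_monomial:
  assumes "t \<in> grid n m" "t \<noteq> 0"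
  shows "ip base (monomial t) = 0"
proof -
  have "monomial t = monomial (n, m) * dagger (monomial ((n, m) - t))"
    by (simp add: monomial_mult)
  then have "ip base (monomial t) = ip (monomial ((n, m) - t)) lead"
    unfolding base_def by (metis ip_reverse)
  also have "\<dots> = 0"
    using assms ip_lead_monomial[of "(n, m) - t"] ip_swap_zero by (cases t) (auto simp: zero_prod_def)
  finally show ?thesis .
qed

text \<open>Reversal sends these translated boxes to the boxes in \<open>uncoupled\<close>, and
  their intersection to the common small grid.\<close>

lemma uncoupled_reversed:
  assumes q: "supp q \<subseteq> {0..n} \<times> {1..m}" and r: "supp r \<subseteq> {1..n} \<times> {0..m}"
    and q0: "\<And>t. t \<in> {1..n} \<times> {1..m} \<Longrightarrow> ip q (monomial t) = 0"
    and r0: "\<And>t. t \<in> {1..n} \<times> {1..m} \<Longrightarrow> ip r (monomial t) = 0"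
  shows "ip q r = 0"
proof -
  let ?R = "\<lambda>x. monomial (n, m) * dagger x"
  have orth: "ip (?R x) (monomial t) = 0"
    if "\<And>t. t \<in> {1..n} \<times> {1..m} \<Longrightarrow> ip x (monomial t) = 0" "t \<in> grid (n - 1) (m - 1)" for x t
  proof -
    have "monomial t = ?R (monomial ((n, m) - t))"
      by (simp add: monomial_mult)
    then have "ip (?R x) (monomial t) = ip (monomial ((n, m) - t)) x"
      by (metis ip_reverse)
    also have "\<dots> = 0"
      using that(1)[of "(n, m) - t"] that(2) ip_swap_zero by (cases t) auto
    finally show ?thesis .
  qed
  have sR: "e \<in> supp (?R x) \<Longrightarrow> (n, m) - e \<in> supp x" for e x
    by (simp add: in_keys_iff lookup_dagger)
  have "ip (?R q) (?R r) = 0"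
  proof (rule uncoupled)
    show "supp (?R q) \<subseteq> grid n (m - 1)" "supp (?R r) \<subseteq> grid (n - 1) m"
      using sR q r by fastforce+
  qed (use orth q0 r0 in blast)+
  then show ?thesis
    by (simp only: ip_reverse ip_swap_zero[of q r])
qed

text \<open>The grid consists of two overlapping subgrids and the corner \<open>(n, m)\<close>; the
  direction added by the corner is \<open>lead\<close>.\<close>

lemma kap_lead:
  "kap (grid n m) s = kap (grid n (m - 1)) s + kap (grid (n - 1) m) s - kap (grid (n - 1) (m - 1)) s
    + cst (cnj (coef lead s)) * lead"
proof -
  have grid: "grid n m = insert (n, m) (grid n (m - 1) \<union> grid (n - 1) m)"
    "grid (n - 1) (m - 1) = grid n (m - 1) \<inter> grid (n - 1) m"
    using nm1 by auto
  show ?thesis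
    unfolding grid
  proof (rule kap_decomposition)
    show "supp lead \<subseteq> insert (n, m) (grid n (m - 1) \<union> grid (n - 1) m)"
      using supp_lead grid(1) by simp
    show "ip lead (monomial t) = 0" if "t \<in> grid n (m - 1) \<union> grid (n - 1) m" for t
      using that by (intro ip_lead_monomial) auto
    show "ip q r = 0" if "supp q \<subseteq> grid n (m - 1)" "supp r \<subseteq> grid (n - 1) m"
      "\<And>t. t \<in> grid n (m - 1) \<inter> grid (n - 1) m \<Longrightarrow> ip q (monomial t) = 0"
      "\<And>t. t \<in> grid n (m - 1) \<inter> grid (n - 1) m \<Longrightarrow> ip r (monomial t) = 0" for q r
      using uncoupled[OF that(1,2)] that(3,4) by (simp only: grid(2))
  qed (auto simp: ip_lead_lead)
qed

lemma image_box: "(\<lambda>t. t + (a, b)) ` ({i..j} \<times> {k..l}) = {i + a..j + a} \<times> {k + b..l + b}" for a b i j k l :: int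
proof (intro equalityI subsetI)
  fix x assume "x \<in> {i + a..j + a} \<times> {k + b..l + b}"
  then have "x - (a, b) \<in> {i..j} \<times> {k..l}" by (cases x) auto
  then show "x \<in> (\<lambda>t. t + (a, b)) ` ({i..j} \<times> {k..l})"
    by (intro image_eqI[of _ _ "x - (a, b)"]) auto
qed auto

text \<open>The same decomposition seen from the opposite corner \<open>0\<close>: the subgrids are
  now translates, whose kernels are shifts, and the added direction is \<open>base\<close>.\<close>

lemma kap_base:
  "kap (grid n m) s = monomial (0, 1) * kap (grid n (m - 1)) (s - (0, 1))
    + monomial (1, 0) * kap (grid (n - 1) m) (s - (1, 0))
    - monomial (1, 1) * kap (grid (n - 1) (m - 1)) (s - (1, 1)) + cst (cnj (coef base s)) * base"
proof -
  have grid: "grid n m = insert 0 ({0..n} \<times> {1..m} \<union> {1..n} \<times> {0..m})"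
    "{1..n} \<times> {1..m} = {0..n} \<times> {1..m} \<inter> {1..n} \<times> {0..m}"
    using nm1 by (auto simp: zero_prod_def)
  have sh: "kap ({0..n} \<times> {1..m}) s = monomial (0, 1) * kap (grid n (m - 1)) (s - (0, 1))"
    "kap ({1..n} \<times> {0..m}) s = monomial (1, 0) * kap (grid (n - 1) m) (s - (1, 0))"
    "kap ({1..n} \<times> {1..m}) s = monomial (1, 1) * kap (grid (n - 1) (m - 1)) (s - (1, 1))"
    using kap_shift[of "grid n (m - 1)" "(0, 1)" s] kap_shift[of "grid (n - 1) m" "(1, 0)" s]
      kap_shift[of "grid (n - 1) (m - 1)" "(1, 1)" s]
    by (simp_all add: image_box)
  show ?thesis
    unfolding sh[symmetric] unfolding grid
  proof (rule kap_decomposition)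
    show "0 \<notin> {0..n} \<times> {1..m} \<union> {1..n} \<times> {0..m}"
      by (simp add: zero_prod_def)
    show "supp base \<subseteq> insert 0 ({0..n} \<times> {1..m} \<union> {1..n} \<times> {0..m})"
      using supp_base grid(1) by simp
    show "ip base (monomial t) = 0" if "t \<in> {0..n} \<times> {1..m} \<union> {1..n} \<times> {0..m}" for t
      using that by (intro ip_base_monomial) (auto simp: zero_prod_def)
    show "ip q r = 0" if "supp q \<subseteq> {0..n} \<times> {1..m}" "supp r \<subseteq> {1..n} \<times> {0..m}"
      "\<And>t. t \<in> {0..n} \<times> {1..m} \<inter> {1..n} \<times> {0..m} \<Longrightarrow> ip q (monomial t) = 0"
      "\<And>t. t \<in> {0..n} \<times> {1..m} \<inter> {1..n} \<times> {0..m} \<Longrightarrow> ip r (monomial t) = 0" for q r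
      using uncoupled_reversed[OF that(1,2)] that(3,4) by (simp only: grid(2))
  qed (auto simp: ip_base_base)
qed

lemma christoffel_darboux:
  "cst (cnj (coef base s)) * base - cst (cnj (coef lead s)) * lead =
    (kap (grid n (m - 1)) s - monomial (0, 1) * kap (grid n (m - 1)) (s - (0, 1)))
    + (kap (grid (n - 1) m) s - monomial (1, 0) * kap (grid (n - 1) m) (s - (1, 0)))
    - (kap (grid (n - 1) (m - 1)) s - monomial (1, 1) * kap (grid (n - 1) (m - 1)) (s - (1, 1)))"
  using kap_lead[of s] kap_base[of s] by (simp add: algebra_simps)

definition wrow :: "int \<Rightarrow> laurent \<Rightarrow> laurent" where
  "wrow l x = (\<Sum>i\<in>{0..n}. cst (coef x (i, l)) * monomial (i, 0))"

text \<open>The kernel of \<open>V n m \<ominus> V (n - 1) m\<close> with equal first arguments on the circle, expanded in the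
  conjugate of the remaining second argument. There the shifts by \<open>z\<close> cancel in the
  Christoffel-Darboux identity.\<close>

definition zsum :: "int \<Rightarrow> laurent" where
  "zsum l = (\<Sum>i\<in>{0..n}. monomial (- i, 0) * (kap (grid n m) (i, l) - kap (grid (n - 1) m) (i, l)))"

lemma dagger_row: "dagger (wrow l x) = (\<Sum>i\<in>{0..n}. monomial (- i, 0) * cst (cnj (coef x (i, l))))"
  by (simp add: wrow_def dagger_sum mult.commute)

text \<open>A shift by \<open>z\<close> reindexes the sum over \<open>i\<close>. For
  \<open>k = 1\<close> the grid has \<open>a = n - 1\<close>, so that the boundary terms at
  \<open>-1\<close> and \<open>n\<close> vanish.\<close>

lemma sum_kap_shift:
  assumes "a = n \<or> a = n - 1" "k = 0 \<or> k = 1" "a = n \<longrightarrow> k = 0"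
  shows "(\<Sum>i\<in>{0..n}. monomial (- i, 0) * (monomial (k, j) * kap (grid a b) (i - k, l)))
    = monomial (0, j) * (\<Sum>i\<in>{0..n}. monomial (- i, 0) * kap (grid a b) (i, l))"
proof -
  define f where "f i = monomial (- i, 0) * kap (grid a b) (i, l)" for i
  have "(\<Sum>i\<in>{0..n}. f (i - k)) = (\<Sum>i\<in>{0..n}. f i)"
  proof (cases "k = 0")
    case False
    then have "k = 1" "a = n - 1" using assms by auto
    then have "f (-1) = 0" "f n = 0"
      by (simp_all add: f_def kap_outside)
    then show ?thesis
      using \<open>k = 1\<close> nm1 by (simp add: sum_shift_int)
  qed simp
  moreover have "monomial (- i, 0) * (monomial (k, j) * kap (grid a b) (i - k, l)) = monomial (0, j) * f (i - k)" for i
    by (simp add: f_def monomial_mult flip: mult.assoc)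
  ultimately show ?thesis
    by (simp add: f_def flip: sum_distrib_left)
qed

text \<open>Summing \<open>christoffel_darboux\<close> against \<open>z^(-i)\<close> cancels the
  kernel of \<open>grid (n - 1) m\<close>, whose shift is by \<open>z\<close> alone, and leaves
  shifts by \<open>w\<close> of the other two.\<close>

lemma zsum_recursion:
  "zsum l - monomial (0, 1) * zsum (l - 1) = base * dagger (wrow l base) - monomial (0, 1) * (lead * dagger (wrow (l - 1) lead))"
proof -
  define A where "A l = (\<Sum>i\<in>{0..n}. monomial (- i, 0) * kap (grid n (m - 1)) (i, l))" for l
  define B where "B l = (\<Sum>i\<in>{0..n}. monomial (- i, 0) * kap (grid (n - 1) m) (i, l))" for l
  define C where "C l = (\<Sum>i\<in>{0..n}. monomial (- i, 0) * kap (grid (n - 1) (m - 1)) (i, l))" for l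
  have zsum: "zsum l = A l - C l + lead * dagger (wrow l lead)" for l
    unfolding zsum_def A_def C_def dagger_row sum_distrib_left sum_subtractf[symmetric] sum.distrib[symmetric]
    by (rule sum.cong) (simp_all add: kap_lead[of "(_, l)"] algebra_simps)
  have "base * dagger (wrow l base) - lead * dagger (wrow l lead)
    = (\<Sum>i\<in>{0..n}. monomial (- i, 0) * (cst (cnj (coef base (i, l))) * base - cst (cnj (coef lead (i, l))) * lead))"
    unfolding dagger_row sum_distrib_left sum_subtractf[symmetric]
    by (rule sum.cong) (simp_all add: algebra_simps)
  also have "\<dots> = (A l - (\<Sum>i\<in>{0..n}. monomial (- i, 0) * (monomial (0, 1) * kap (grid n (m - 1)) (i - 0, l - 1))))
    + (B l - (\<Sum>i\<in>{0..n}. monomial (- i, 0) * (monomial (1, 0) * kap (grid (n - 1) m) (i - 1, l))))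
    - (C l - (\<Sum>i\<in>{0..n}. monomial (- i, 0) * (monomial (1, 1) * kap (grid (n - 1) (m - 1)) (i - 1, l - 1))))"
    unfolding A_def B_def C_def sum_subtractf[symmetric] sum.distrib[symmetric] christoffel_darboux
    by (rule sum.cong) (simp_all add: ring_distribs right_diff_distrib)
  also have "\<dots> = (A l - monomial (0, 1) * A (l - 1)) + (B l - monomial (0, 0) * B l) - (C l - monomial (0, 1) * C (l - 1))"
    by (simp only: sum_kap_shift A_def B_def C_def simp_thms one_neq_zero)
  also have "monomial (0, 0) = 1"
    by (simp flip: zero_prod_def)
  finally show ?thesis
    by (simp add: zsum algebra_simps)
qed

lemma zsum_negative: "l < 0 \<Longrightarrow> zsum l = 0"
  unfolding zsum_def by (rule sum.neutral) (simp add: kap_outside)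

text \<open>\<open>christoffel_darboux\<close> evaluated at \<open>(z, w)\<close> and summed against
  the conjugates of \<open>pval z w s\<close>; each shift becomes the squared modulus of its
  monomial.\<close>

lemma kernel_diag_identity:
  "(cmod (laurent_eval base z w))\<^sup>2 - (cmod (laurent_eval lead z w))\<^sup>2
    = (1 - (cmod w)\<^sup>2) * kernel_diag (grid n (m - 1)) z w + (1 - (cmod z)\<^sup>2) * kernel_diag (grid (n - 1) m) z w
      - (1 - (cmod z)\<^sup>2 * (cmod w)\<^sup>2) * kernel_diag (grid (n - 1) (m - 1)) z w" (is "?l = ?r")
proof -
  let ?S = "\<lambda>f. \<Sum>s\<in>grid n m. cnj (pval z w s) * laurent_eval (f s) z w"
  have sq: "?S (\<lambda>s. cst (cnj (coef x s)) * x) = complex_of_real ((cmod (laurent_eval x z w))\<^sup>2)"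
    if "supp x \<subseteq> grid n m" for x
  proof -
    have "?S (\<lambda>s. cst (cnj (coef x s)) * x) = cnj (\<Sum>s\<in>grid n m. coef x s * pval z w s) * laurent_eval x z w"
      by (simp add: sum_distrib_right) (simp add: mult_ac)
    also have "\<dots> = cnj (laurent_eval x z w) * laurent_eval x z w"
      using that by (simp add: laurent_eval_eq[of "grid n m"])
    finally show ?thesis
      by (simp add: complex_norm_square mult.commute del: of_real_power)
  qed
  have plain: "?S (kap (grid a b)) = complex_of_real (kernel_diag (grid a b) z w)"
    if "a \<le> n" "b \<le> m" for a b
  proof -
    have "grid a b \<subseteq> grid n m" using that by (intro Sigma_mono) auto
    then show ?thesis
      using sum_shifted_kernel[of "grid n m" 0 "grid a b" z w] by simp
  qed
  have shift: "?S (\<lambda>s. monomial (i, j) * kap (grid a b) (s - (i, j)))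
      = complex_of_real ((cmod (pval z w (i, j)))\<^sup>2 * kernel_diag (grid a b) z w)"
    if "a + i \<le> n" "b + j \<le> m" "0 \<le> i" "0 \<le> j" for a b i j
    using that by (intro sum_shifted_kernel) (auto simp: image_box intro!: pval_add_nonneg)
  have pv: "pval z w (0, 1) = w" "pval z w (1, 0) = z" "pval z w (1, 1) = z * w"
    by (simp_all add: pval_def)
  have "complex_of_real ?l = ?S (\<lambda>s. cst (cnj (coef base s)) * base) - ?S (\<lambda>s. cst (cnj (coef lead s)) * lead)"
    by (simp only: sq supp_base supp_lead of_real_diff)
  also have "\<dots> = ?S (\<lambda>s. cst (cnj (coef base s)) * base - cst (cnj (coef lead s)) * lead)"
    by (simp add: laurent_eval_diff right_diff_distrib sum_subtractf)
  also have "\<dots> = ?S (kap (grid n (m - 1))) - ?S (\<lambda>s. monomial (0, 1) * kap (grid n (m - 1)) (s - (0, 1)))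
    + (?S (kap (grid (n - 1) m)) - ?S (\<lambda>s. monomial (1, 0) * kap (grid (n - 1) m) (s - (1, 0))))
    - (?S (kap (grid (n - 1) (m - 1))) - ?S (\<lambda>s. monomial (1, 1) * kap (grid (n - 1) (m - 1)) (s - (1, 1))))"
    unfolding christoffel_darboux sum_subtractf[symmetric] sum.distrib[symmetric]
    by (rule sum.cong) (simp_all add: laurent_eval_diff laurent_eval_add right_diff_distrib distrib_left)
  also have "\<dots> = complex_of_real ?r"
    by (simp add: shift plain pv norm_mult power_mult_distrib) (simp add: algebra_simps)
  finally show ?thesis
    using of_real_eq_iff by blast
qed

text \<open>On the circle \<open>z^(-i)\<close> is the conjugate of \<open>z^i\<close>, so the
  double sum over \<open>i\<close> and \<open>l\<close> is the full kernel on the diagonal.\<close>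

lemma eval_zsum_sum:
  assumes "cmod z = 1" "cmod w = 1"
  shows "(\<Sum>l\<in>{0..m}. cnj (w powi l) * laurent_eval (zsum l) z w)
    = complex_of_real (kernel_diag (grid n m) z w - kernel_diag (grid (n - 1) m) z w)"
proof -
  have nz: "z \<noteq> 0" "w \<noteq> 0" using assms by auto
  have "cnj z = inverse z"
    using complex_norm_square[of z] assms by (simp add: field_simps nz)
  then have zi: "z powi (- i) = cnj (z powi i)" for i
    by (simp add: power_int_minus flip: power_int_inverse)
  define G where "G s = cnj (pval z w s) * laurent_eval (kap (grid n m) s - kap (grid (n - 1) m) s) z w" for s
  have "cnj (w powi l) * laurent_eval (zsum l) z w = (\<Sum>i\<in>{0..n}. G (i, l))" for l
    unfolding zsum_def laurent_eval_sum sum_distrib_left G_def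
    by (rule sum.cong) (simp_all add: laurent_eval_mult nz pval_def zi mult_ac)
  then have "(\<Sum>l\<in>{0..m}. cnj (w powi l) * laurent_eval (zsum l) z w) = (\<Sum>l\<in>{0..m}. \<Sum>i\<in>{0..n}. G (i, l))"
    by simp
  also have "\<dots> = (\<Sum>s\<in>grid n m. G s)"
    by (subst sum.swap) (simp add: sum.cartesian_product)
  also have "\<dots> = (\<Sum>s\<in>grid n m. cnj (pval z w s) * laurent_eval (kap (grid n m) s) z w)
      - (\<Sum>s\<in>grid n m. cnj (pval z w s) * laurent_eval (kap (grid (n - 1) m) s) z w)"
    by (simp add: G_def laurent_eval_diff right_diff_distrib sum_subtractf)
  also have "\<dots> = complex_of_real (kernel_diag (grid n m) z w - kernel_diag (grid (n - 1) m) z w)"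
  proof -
    have "grid (n - 1) m \<subseteq> grid n m" by (intro Sigma_mono) auto
    then show ?thesis
      using sum_shifted_kernel[of "grid n m" 0 "grid n m" z w] sum_shifted_kernel[of "grid n m" 0 "grid (n - 1) m" z w]
      by simp
  qed
  finally show ?thesis .
qed

lemma base_nonzero:
  assumes z: "cmod z \<le> 1" and w: "cmod w \<le> 1"
  shows "laurent_eval base z w \<noteq> 0"
proof
  assume zero: "laurent_eval base z w = 0"
  define k0 k1 k2 where "k0 = kernel_diag (grid (n - 1) (m - 1)) z w"
    and "k1 = kernel_diag (grid n (m - 1)) z w" and "k2 = kernel_diag (grid (n - 1) m) z w"
  \<comment> \<open>Splitting \<open>1 - |z|^2 |w|^2\<close> as
    \<open>(1 - |w|^2) + |w|^2 (1 - |z|^2)\<close> makes the right side a sum of two nonnegative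
    terms, so at a zero of \<open>base\<close> everything vanishes.\<close>
  have id: "- (cmod (laurent_eval lead z w))\<^sup>2 = (1 - (cmod w)\<^sup>2) * (k1 - k0) + (1 - (cmod z)\<^sup>2) * (k2 - (cmod w)\<^sup>2 * k0)"
    using kernel_diag_identity[of z w] zero by (simp add: k0_def k1_def k2_def algebra_simps)
  have z2: "0 \<le> 1 - (cmod z)\<^sup>2" and w2: "0 \<le> 1 - (cmod w)\<^sup>2"
    using z w by (simp_all add: power_le_one)
  have k10: "k0 \<le> k1"
    unfolding k0_def k1_def by (rule kernel_diag_mono) auto
  have k20: "(cmod w)\<^sup>2 * k0 < k2"
  proof (cases "w = 0")
    case True
    have "point_kernel (grid (n - 1) m) z w \<noteq> 0"
      using nm1 by (intro point_kernel_nonzero) (auto simp: zero_prod_def)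
    then show ?thesis
      using True ip_pos by (simp add: k2_def kernel_diag_def)
  next
    case False
    have "kernel_diag ((\<lambda>t. t + (0, 1)) ` grid (n - 1) (m - 1)) z w = (cmod w)\<^sup>2 * k0"
      unfolding k0_def by (subst kernel_diag_shift) (auto simp: pval_def power_int_add False)
    \<comment> \<open>\<open>grid (n - 1) m\<close> contains both this translate and its shift by
      \<open>w^(-1)\<close>, whose modulus is at least one.\<close>
    moreover have "kernel_diag ((\<lambda>t. t + (0, 1)) ` grid (n - 1) (m - 1)) z w < k2"
      unfolding k2_def image_box
    proof (rule kernel_diag_strict_mono[where e = "(0, -1)"])
      show "1 \<le> cmod (pval z w (0, -1))"
        using w False by (simp add: pval_def power_int_minus norm_inverse one_le_inverse)
    qed (use nm1 False in \<open>auto simp: zero_prod_def pval_def power_int_diff divide_inverse mult_ac\<close>)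
    ultimately show ?thesis by simp
  qed
  have nn: "0 \<le> (1 - (cmod w)\<^sup>2) * (k1 - k0)" "0 \<le> (1 - (cmod z)\<^sup>2) * (k2 - (cmod w)\<^sup>2 * k0)"
    using z2 w2 k10 k20 by (auto intro!: mult_nonneg_nonneg)
  have eqs: "(1 - (cmod w)\<^sup>2) * (k1 - k0) = 0" "(1 - (cmod z)\<^sup>2) * (k2 - (cmod w)\<^sup>2 * k0) = 0"
    "(cmod (laurent_eval lead z w))\<^sup>2 = 0"
    using id nn zero_le_power2[of "cmod (laurent_eval lead z w)"] by linarith+
  \<comment> \<open>Strictness of \<open>k20\<close> forces \<open>|z| = 1\<close>; this in turn
    gives \<open>k0 < k1\<close>, which forces \<open>|w| = 1\<close>.\<close>
  then have "(cmod z)\<^sup>2 = 1" using k20 by auto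
  then have z1: "cmod z = 1"
    by (simp add: power2_eq_1_iff) (smt (verit) norm_ge_zero)
  have strict: "kernel_diag (grid (n - 1) b) z w < kernel_diag (grid n b) z w" if "0 \<le> b" for b
  proof (rule kernel_diag_strict_mono[where e = "(1, 0)"])
    show "pval z w ((1, 0) + t) = pval z w (1, 0) * pval z w t" if "t \<in> grid (n - 1) b" for t
      using that by (intro pval_add_nonneg) auto
  qed (use that nm1 z1 in \<open>auto simp: zero_prod_def pval_def\<close>)
  have "k0 < k1"
    unfolding k0_def k1_def using strict nm1 by simp
  then have "(cmod w)\<^sup>2 = 1" using eqs(1) by auto
  then have w1: "cmod w = 1"
    by (simp add: power2_eq_1_iff) (smt (verit) norm_ge_zero)
  have nz: "z \<noteq> 0" "w \<noteq> 0" using z1 w1 by auto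
  \<comment> \<open>Both \<open>base\<close> and \<open>lead\<close> vanish at this torus point, so
    the recursion for \<open>zsum\<close> is homogeneous there. Starting from
    \<open>zsum (-1) = 0\<close> it makes two diagonal values equal, against
    \<open>strict\<close>.\<close>
  have step: "laurent_eval (zsum l) z w = w * laurent_eval (zsum (l - 1)) z w" for l
  proof -
    have "laurent_eval (zsum l - monomial (0, 1) * zsum (l - 1)) z w = 0"
      unfolding zsum_recursion using zero eqs(3) by (simp add: laurent_eval_diff laurent_eval_mult nz)
    then show ?thesis
      by (simp add: laurent_eval_diff laurent_eval_mult nz pval_def)
  qed
  have "laurent_eval (zsum l) z w = 0" if "-1 \<le> l" for l
    using that by (induction l rule: int_ge_induct) (simp_all add: zsum_negative step[of "_ + 1"])
  then have "kernel_diag (grid n m) z w = kernel_diag (grid (n - 1) m) z w"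
    using eval_zsum_sum[OF z1 w1] by simp
  then show False
    using strict[of m] nm1 by simp
qed

end

subsection \<open>Comparison of moments\<close>

text \<open>In the application \<open>L'\<close> has the weight \<open>1 / |base|^2\<close>, where
  \<open>base\<close> is built from \<open>L\<close>.\<close>

locale matching_forms = uncoupled_form L n m + Q: stable_form L' "uncoupled_form.base L n m" n m
  for L :: "laurent \<Rightarrow> complex" and n m :: int and L' :: "laurent \<Rightarrow> complex"
begin

lemma p_rev_eq_lead: "Q.p_rev = lead"
proof -
  have "dagger base = monomial (- (n, m)) * lead"
    by (simp only: base_def dagger_mult dagger_dagger dagger_monomial)
  then show ?thesis
    by (simp only: Q.p_rev_def monomial_cancel)
qed

lemma coef_row:
  assumes "supp x \<subseteq> grid n m"
  shows "coef (wrow l x) t = (if snd t = 0 then coef x (fst t, l) else 0)"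
proof -
  have "coef (wrow l x) t = (\<Sum>i\<in>{0..n}. if i = fst t then (if snd t = 0 then coef x (i, l) else 0) else 0)"
    unfolding wrow_def lookup_sum by (rule sum.cong) (auto simp: coef_monomial prod_eq_iff)
  also have "\<dots> = (if snd t = 0 then coef x (fst t, l) else 0)"
    using suppD[OF assms, of "(fst t, l)"] by (auto simp: sum.delta)
  finally show ?thesis .
qed

lemma dagger_row_below:
  assumes "supp x \<subseteq> grid n m"
  shows "monomial (0, l) * (dagger (Q.below l x) - dagger (Q.below (l - 1) x)) = dagger (wrow l x)"
proof (rule poly_mapping_eqI)
  fix s :: "int \<times> int"
  show "coef (monomial (0, l) * (dagger (Q.below l x) - dagger (Q.below (l - 1) x))) s = coef (dagger (wrow l x)) s"
    by (cases s) (auto simp: lookup_minus lookup_dagger coef_row[OF assms] Q.below_def)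
qed

lemma dual_recursion:
  "Q.dual 0 l - monomial (0, 1) * Q.dual 0 (l - 1) = base * dagger (wrow l base) - monomial (0, 1) * (lead * dagger (wrow (l - 1) lead))"
proof -
  have 1: "monomial (0, 1) * (monomial (0, l - 1) * x) = monomial (0, l) * x" for x
    by (simp add: monomial_mult flip: mult.assoc)
  have "l - 1 - 1 = l - 2" by simp
  then show ?thesis
    unfolding dagger_row_below[OF supp_base, symmetric] dagger_row_below[OF supp_lead, symmetric]
      Q.dual_def p_rev_eq_lead 1
    by (simp add: algebra_simps) (simp add: mult.left_commute[of lead] 1)
qed

lemma dual_negative: "l < 0 \<Longrightarrow> Q.dual 0 l = 0"
proof -
  assume "l < 0"
  then have "Q.below l base = 0" "Q.below (l - 1) lead = 0"
    using suppD[OF supp_base] suppD[OF supp_lead]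
    by (auto intro!: poly_mapping_eqI simp: Q.below_def)
  then show ?thesis by (simp add: Q.dual_def p_rev_eq_lead)
qed

text \<open>A kernel of \<open>L\<close> is identified with one of \<open>L'\<close>: both obey the
  same recursion in \<open>l\<close>, and the induction starts at \<open>-1\<close>, where both are
  zero.\<close>

lemma zsum_eq_dual: "-1 \<le> l \<Longrightarrow> zsum l = Q.dual 0 l"
proof (induction l rule: int_ge_induct)
  case base
  then show ?case by (simp add: zsum_negative dual_negative)
next
  case (step l)
  have "zsum (l + 1) - monomial (0, 1) * zsum l = Q.dual 0 (l + 1) - monomial (0, 1) * Q.dual 0 l"
    using zsum_recursion[of "l + 1"] dual_recursion[of "l + 1"] by simp
  then show ?case
    using step by simp
qed

section \<open>Agreement of the two forms against the complement of the smaller grid\<close>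

definition kapA :: "int \<times> int \<Rightarrow> laurent" where
  "kapA s = kap (grid n m) s - kap (grid (n - 1) m) s"

lemma kapA_outside: "s \<notin> grid n m \<Longrightarrow> kapA s = 0"
proof -
  assume "s \<notin> grid n m"
  moreover from this have "s \<notin> grid (n - 1) m" by auto
  ultimately show ?thesis by (simp add: kapA_def kap_outside)
qed

lemma supp_kapA: "supp (kapA s) \<subseteq> grid n m"
  unfolding kapA_def using supp_kap[of "grid (n - 1) m" s]
  by (intro supp_diff supp_kap) fastforce+

lemma dual_kapA: "0 \<le> l \<Longrightarrow> Q.dual i l = (\<Sum>y\<in>{0..n}. monomial (i - y, 0) * kapA (y, l))"
proof -
  assume "0 \<le> l"
  then have "Q.dual i l = monomial (i, 0) * zsum l"
    using Q.dual_shift[of i 0 l] zsum_eq_dual[of l] by simp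
  then show ?thesis
    by (simp add: zsum_def kapA_def sum_distrib_left monomial_mult flip: mult.assoc)
qed

text \<open>By \<open>ip_cross\<close> this is the adjoint, between the forms of \<open>L'\<close>
  and \<open>L\<close>, of the projection onto \<open>V n m \<ominus> V (n - 1) m\<close> followed
  by multiplication by \<open>z^s\<close>.\<close>

definition cross :: "laurent \<Rightarrow> int \<Rightarrow> laurent" where
  "cross x s = (\<Sum>t\<in>grid n m. cst (Q.ip x (monomial (s, 0) * kapA t)) * monomial t)"

lemma coef_cross: "coef (cross x s) t = Q.ip x (monomial (s, 0) * kapA t)"
proof -
  have "coef (cross x s) t = (\<Sum>t'\<in>grid n m. if t' = t then Q.ip x (monomial (s, 0) * kapA t') else 0)"
    unfolding cross_def lookup_sum by (rule sum.cong) (auto simp: coef_monomial)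
  also have "\<dots> = Q.ip x (monomial (s, 0) * kapA t)"
    by (auto simp: sum.delta kapA_outside)
  finally show ?thesis .
qed

lemma supp_cross: "supp (cross x s) \<subseteq> grid n m"
  by (auto simp: supp_subset_iff coef_cross kapA_outside)

lemma ip_cross: "ip (cross x s) v = Q.ip x (monomial (s, 0) * (proj (grid n m) v - proj (grid (n - 1) m) v))"
proof -
  have "proj (grid (n - 1) m) v = (\<Sum>t\<in>grid n m. cst (ip v (monomial t)) * kap (grid (n - 1) m) t)"
    unfolding proj_def by (rule sum.mono_neutral_left) (auto simp: kap_outside)
  then have "proj (grid n m) v - proj (grid (n - 1) m) v = (\<Sum>t\<in>grid n m. cst (ip v (monomial t)) * kapA t)"
    by (simp add: proj_def kapA_def right_diff_distrib sum_subtractf)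
  then have "monomial (s, 0) * (proj (grid n m) v - proj (grid (n - 1) m) v)
      = (\<Sum>t\<in>grid n m. cst (ip v (monomial t)) * (monomial (s, 0) * kapA t))"
    by (simp add: sum_distrib_left mult.left_commute)
  then show ?thesis
    by (simp add: cross_def ip_sum_left ip_cst_left Q.ip_sum_right Q.ip_cst_right ip_cnj) (simp add: mult.commute)
qed

lemma ip_cross_monomial:
  assumes "t \<in> grid (n - 1) m"
  shows "ip (cross x s) (monomial t) = 0"
proof -
  have "proj (grid n m) (monomial t) = monomial t" "proj (grid (n - 1) m) (monomial t) = monomial t"
    using assms by (auto intro!: proj_same)
  then show ?thesis by (simp add: ip_cross)
qed

text \<open>Coefficientwise, the series of \<open>z^s cross x s\<close> over all \<open>s\<close>
  reproduces \<open>x\<close>: the contributions to \<open>z^i w^l\<close> add up to the pairing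
  with \<open>dual i l\<close>.\<close>

lemma sum_cross:
  assumes "supp x \<subseteq> grid n m" "0 \<le> l" "l \<le> m"
  shows "(\<Sum>y\<in>{0..n}. coef (cross x (i - y)) (y, l)) = coef x (i, l)"
proof -
  have "(\<Sum>y\<in>{0..n}. coef (cross x (i - y)) (y, l)) = Q.ip x (Q.dual i l)"
    using assms by (simp add: coef_cross dual_kapA Q.ip_sum_right)
  also have "\<dots> = coef x (i, l)"
    using assms by (intro Q.ip_dual) auto
  finally show ?thesis .
qed

lemma cross_tendsto_0: "(\<lambda>k. coef (cross x (int k + c)) t) \<longlonglongrightarrow> 0"
proof -
  have "coef (cross x s) t = (\<Sum>e\<in>grid n m. cnj (coef (kapA t) e) * Q.ip x (monomial ((s, 0) + e)))" for s
  proof -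
    have "coef (cross x s) t = Q.ip (monomial (- (s, 0)) * x) (kapA t)"
      by (simp add: coef_cross Q.ip_monomial_left)
    also have "\<dots> = (\<Sum>e\<in>grid n m. cnj (coef (kapA t) e) * Q.ip (monomial (- (s, 0)) * x) (monomial e))"
      by (rule Q.ip_expand_right) (simp_all add: supp_kapA)
    finally show ?thesis
      by (simp only: Q.ip_monomial_left minus_minus monomial_mult)
  qed
  moreover have "(\<lambda>k. \<Sum>e\<in>grid n m. cnj (coef (kapA t) e) * Q.ip x (monomial ((int k + c, 0) + e)))
      \<longlonglongrightarrow> (\<Sum>e\<in>grid n m. cnj (coef (kapA t) e) * 0)"
    by (intro tendsto_sum tendsto_mult tendsto_const Q.ip_monomial_tendsto_0) (auto simp: inj_def)
  ultimately show ?thesis by simp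
qed

text \<open>\<open>tail x N\<close> is the sum of \<open>z\<^sup>k cross x k\<close> over \<open>k > N\<close>, multiplied by \<open>z\<close> to the power \<open>- N - 1\<close>;
  the degree bound comes from \<open>sum_cross\<close>.\<close>

definition tail :: "laurent \<Rightarrow> int \<Rightarrow> laurent" where
  "tail x N = (\<Sum>t\<in>grid (n - 1) m. cst (\<Sum>y\<in>{0..fst t}. coef (cross x (N + 1 + fst t - y)) (y, snd t)) * monomial t)"

lemma coef_tail:
  "coef (tail x N) t = (if t \<in> grid (n - 1) m then \<Sum>y\<in>{0..fst t}. coef (cross x (N + 1 + fst t - y)) (y, snd t) else 0)"
proof -
  have "coef (tail x N) t = (\<Sum>t'\<in>grid (n - 1) m. if t' = t then \<Sum>y\<in>{0..fst t'}. coef (cross x (N + 1 + fst t' - y)) (y, snd t') else 0)"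
    unfolding tail_def lookup_sum by (rule sum.cong) (auto simp: coef_monomial)
  then show ?thesis
    by (simp add: sum.delta)
qed

lemma supp_tail: "supp (tail x N) \<subseteq> grid (n - 1) m"
  by (simp add: supp_subset_iff coef_tail)

lemma tail_recursion:
  assumes x: "supp x \<subseteq> grid n m" and N: "1 \<le> N"
  shows "monomial (1, 0) * tail x N = tail x (N - 1) - cross x N"
proof (rule poly_mapping_eqI)
  fix t :: "int \<times> int"
  obtain i l where t: "t = (i, l)" by (cases t)
  have outside: "coef (cross x N) (i, l) = 0" if "(i, l) \<notin> grid n m"
    using suppD[OF supp_cross that] .
  consider "(i, l) \<notin> grid n m" | "i = 0" "0 \<le> l" "l \<le> m" | "1 \<le> i" "i \<le> n" "0 \<le> l" "l \<le> m"
    by fastforce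
  then have "coef (tail x N) (i - 1, l) = coef (tail x (N - 1)) (i, l) - coef (cross x N) (i, l)"
  proof cases
    case 1
    then show ?thesis
      using outside nm1 by (auto simp: coef_tail)
  next
    case 2
    then show ?thesis
      using nm1 by (simp add: coef_tail)
  next
    case 3
    have split: "{0..i} = insert i {0..i - 1}" using 3 by auto
    have "coef (tail x N) (i - 1, l) + coef (cross x N) (i, l) = (\<Sum>y\<in>{0..i}. coef (cross x (N + i - y)) (y, l))"
      unfolding split using 3 by (simp add: coef_tail)
    also have "\<dots> = coef (tail x (N - 1)) (i, l)"
    proof (cases "i = n")
      \<comment> \<open>At the top degree the whole sum over \<open>y\<close> occurs, so
        \<open>sum_cross\<close> gives the coefficient of \<open>x\<close> at
        \<open>z^(N + n)\<close>, which is zero as \<open>N \<ge> 1\<close>.\<close>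
      case True
      then have "(\<Sum>y\<in>{0..i}. coef (cross x (N + i - y)) (y, l)) = coef x (N + n, l)"
        using sum_cross[OF x, of l "N + n"] 3 by simp
      then show ?thesis
        using True suppD[OF x, of "(N + n, l)"] N by (simp add: coef_tail)
    next
      case False
      then show ?thesis using 3 by (simp add: coef_tail)
    qed
    finally show ?thesis by (simp add: algebra_simps)
  qed
  then show "coef (monomial (1, 0) * tail x N) t = coef (tail x (N - 1) - cross x N) t"
    by (simp add: t lookup_minus)
qed

text \<open>\<open>cross\<close> is orthogonal to the space containing \<open>tail\<close>, so by
  Pythagoras in \<open>tail_recursion\<close> the norms of the tails increase; yet they tend to
  zero.\<close>

lemma tail_zero:
  assumes x: "supp x \<subseteq> grid n m"
  shows "tail x 0 = 0"
proof -
  define a where "a k = Re (ip (tail x (int k)) (tail x (int k)))" for k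
  have "a k \<le> a (Suc k)" for k
  proof -
    let ?h = "tail x (int k)" and ?d = "cross x (int k + 1)"
    have dh: "ip ?d ?h = 0"
      by (rule ip_zero_right, rule ip_cross_monomial) (use supp_tail in blast)
    then have hd: "ip ?h ?d = 0"
      using ip_swap_zero by blast
    have "ip (tail x (int (Suc k))) (tail x (int (Suc k))) = ip (?h - ?d) (?h - ?d)"
      using ip_shift[of "(1, 0)" "tail x (int (Suc k))" "tail x (int (Suc k))"]
        tail_recursion[OF x, of "int (Suc k)"]
      by (simp add: add.commute)
    also have "\<dots> = ip ?h ?h + ip ?d ?d"
      by (simp add: ip_diff_left ip_diff_right dh hd)
    finally show ?thesis
      using ip_nonneg[of ?d] by (simp add: a_def)
  qed
  then have inc: "incseq a" by (rule incseq_SucI)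
  have "a \<longlonglongrightarrow> 0"
    unfolding a_def
  proof (rule ip_tendsto_0[where T = "grid (n - 1) m" and e = "\<lambda>_. 0"])
    fix t :: "int \<times> int" assume "t \<in> grid (n - 1) m"
    have "(\<lambda>k. \<Sum>y\<in>{0..fst t}. coef (cross x (int k + (1 + fst t - y))) (y, snd t)) \<longlonglongrightarrow> (\<Sum>y\<in>{0..fst t}. 0)"
      by (intro tendsto_sum cross_tendsto_0)
    then show "(\<lambda>k. coef (tail x (int k)) (t + 0)) \<longlonglongrightarrow> 0"
      using \<open>t \<in> grid (n - 1) m\<close> by (simp add: coef_tail algebra_simps)
  qed (use supp_tail in auto)
  then have "a 0 \<le> 0"
    using inc by (rule incseq_le[rotated])
  then show ?thesis
    using ip_pos[of "tail x 0"] by (auto simp: a_def)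
qed

lemma ip_agree_orthogonal:
  assumes x: "supp x \<subseteq> grid n m" and v: "supp v \<subseteq> grid n m"
    and perp: "\<And>t. t \<in> grid (n - 1) m \<Longrightarrow> ip v (monomial t) = 0"
  shows "Q.ip x v = ip x v"
proof -
  \<comment> \<open>In the expansion of \<open>x\<close>, the top coefficient is that of
    \<open>cross x 0\<close> plus the contribution of positive shifts, which is a coefficient of
    \<open>tail x 0\<close>, hence zero.\<close>
  have top: "coef (x - cross x 0) (n, l) = 0" if "0 \<le> l" "l \<le> m" for l
  proof -
    have "{0..n} = insert n {0..n - 1}" using nm1 by auto
    then have "coef x (n, l) = coef (cross x 0) (n, l) + (\<Sum>y\<in>{0..n - 1}. coef (cross x (n - y)) (y, l))"
      using sum_cross[OF x that, of n] by simp
    also have "(\<Sum>y\<in>{0..n - 1}. coef (cross x (n - y)) (y, l)) = coef (tail x 0) (n - 1, l)"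
      using that nm1 by (simp add: coef_tail)
    finally show ?thesis
      by (simp add: tail_zero[OF x] lookup_minus)
  qed
  have small: "supp (x - cross x 0) \<subseteq> grid (n - 1) m"
    unfolding supp_subset_iff
  proof (intro allI impI)
    fix e assume e: "e \<notin> grid (n - 1) m"
    show "coef (x - cross x 0) e = 0"
    proof (cases "e \<in> grid n m")
      case True
      then have "e = (n, snd e)" "0 \<le> snd e" "snd e \<le> m"
        using e by (cases e, force)+
      then show ?thesis using top by metis
    next
      case False
      then show ?thesis
        using suppD[OF x False] suppD[OF supp_cross False] by (simp add: lookup_minus)
    qed
  qed
  have "ip v (x - cross x 0) = 0"
    by (rule ip_zero_right, rule perp) (use small in blast)
  then have "ip (x - cross x 0) v = 0"
    using ip_swap_zero by blast
  then have "ip x v = ip (cross x 0) v"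
    by (simp add: ip_diff_left)
  also have "\<dots> = Q.ip x (proj (grid n m) v - proj (grid (n - 1) m) v)"
    unfolding ip_cross by (simp flip: zero_prod_def)
  also have "proj (grid (n - 1) m) v = 0"
    unfolding proj_def by (rule sum.neutral) (simp add: perp)
  also have "proj (grid n m) v = v"
    using v by (intro proj_same) auto
  finally show ?thesis by simp
qed

section \<open>Agreement of the two forms on the whole grid\<close>

definition rest :: "laurent \<Rightarrow> laurent" where
  "rest x = monomial (1, 0) * proj (grid (n - 1) m) x"

lemma supp_proj_small: "supp (proj (grid (n - 1) m) x) \<subseteq> grid n m"
  using supp_proj[of "grid (n - 1) m" x] by fastforce

lemma supp_rest: "supp (rest x) \<subseteq> grid n m"
proof
  fix e assume "e \<in> supp (rest x)"
  then have "e - (1, 0) \<in> grid (n - 1) m"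
    using supp_proj[of "grid (n - 1) m" x] unfolding rest_def supp_monomial_mult by blast
  then show "e \<in> grid n m" by (cases e) auto
qed

lemma ip_rest: "ip x x = ip (x - proj (grid (n - 1) m) x) (x - proj (grid (n - 1) m) x) + ip (rest x) (rest x)"
proof -
  let ?p = "proj (grid (n - 1) m) x"
  have "ip (x - ?p) ?p = 0"
    using ip_proj[of "grid (n - 1) m" ?p x] supp_proj[of "grid (n - 1) m" x] by (simp add: ip_diff_left)
  moreover from this have "ip ?p (x - ?p) = 0"
    using ip_swap_zero by blast
  ultimately have "ip ((x - ?p) + ?p) ((x - ?p) + ?p) = ip (x - ?p) (x - ?p) + ip ?p ?p"
    by (simp only: ip_add_left ip_add_right) simp
  then show ?thesis
    by (simp add: rest_def ip_shift)
qed

text \<open>By \<open>ip_agree_orthogonal\<close> the component orthogonal to the smaller grid has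
  the same norm in both forms and is orthogonal to the projection in both; shifting the projection
  is isometric in both.\<close>

lemma Q_ip_rest:
  assumes "supp x \<subseteq> grid n m"
  shows "Q.ip x x - Q.ip (rest x) (rest x) = ip x x - ip (rest x) (rest x)"
proof -
  let ?p = "proj (grid (n - 1) m) x" and ?v = "x - proj (grid (n - 1) m) x"
  have v: "supp ?v \<subseteq> grid n m"
    by (intro supp_diff assms supp_proj_small)
  have perp: "ip ?v (monomial t) = 0" if "t \<in> grid (n - 1) m" for t
    using that by (simp add: ip_diff_left ip_proj_monomial)
  have "ip ?v ?p = 0"
    by (rule ip_zero_right, rule perp) (use supp_proj[of "grid (n - 1) m" x] in blast)
  then have "Q.ip ?p ?v = 0"
    using ip_agree_orthogonal[OF supp_proj_small v perp] ip_swap_zero by simp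
  moreover from this have "Q.ip ?v ?p = 0"
    using Q.ip_swap_zero by blast
  ultimately have "Q.ip (?v + ?p) (?v + ?p) = Q.ip ?v ?v + Q.ip ?p ?p"
    by (simp only: Q.ip_add_left Q.ip_add_right) simp
  then have "Q.ip x x = ip ?v ?v + Q.ip (rest x) (rest x)"
    using ip_agree_orthogonal[OF v v perp] by (simp add: rest_def Q.ip_shift)
  then show ?thesis
    using ip_rest[of x] by simp
qed

text \<open>Repeatedly removing the component orthogonal to the smaller grid and shifting is the Wold
  decomposition for the shift in the first variable; nothing remains in the limit.\<close>

lemma ip_agree_self:
  assumes x: "supp x \<subseteq> grid n m"
  shows "Q.ip x x = ip x x"
proof -
  define u where "u k = (rest ^^ k) x" for k
  define v where "v k = u k - proj (grid (n - 1) m) (u k)" for k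
  have u_Suc: "u (Suc k) = rest (u k)" for k
    by (simp add: u_def)
  have su: "supp (u k) \<subseteq> grid n m" for k
    using x supp_rest by (cases k) (simp_all add: u_def)
  define a where "a k = Re (ip (u k) (u k))" for k
  have step: "Re (ip (v k) (v k)) = a k - a (Suc k)" for k
    using ip_rest[of "u k"] by (simp add: a_def v_def u_Suc)
  \<comment> \<open>The squared norms of the removed components are differences of a convergent
    decreasing sequence, so they tend to zero, and \<open>lower\<close> passes this on to
    coefficients.\<close>
  have "decseq a"
    using step ip_nonneg by (intro decseq_SucI) (metis diff_ge_0_iff_ge)
  then obtain c where c: "a \<longlonglongrightarrow> c"
    using decseq_convergent[of a 0] ip_nonneg unfolding a_def by metis
  then have "(\<lambda>k. a k - a (Suc k)) \<longlonglongrightarrow> c - c"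
    by (intro tendsto_diff LIMSEQ_Suc)
  then have vlim: "(\<lambda>k. Re (ip (v k) (v k))) \<longlonglongrightarrow> 0"
    by (simp add: step)
  obtain b where b: "b > 0" "\<And>x. b * nrm x \<le> Re (L (x * dagger x))"
    using lower by blast
  have v0: "(\<lambda>k. coef (v k) e) \<longlonglongrightarrow> 0" for e
  proof -
    have le: "(cmod (coef (v k) e))\<^sup>2 \<le> Re (ip (v k) (v k)) / b" for k
    proof -
      have "b * (cmod (coef (v k) e))\<^sup>2 \<le> b * nrm (v k)"
        using b(1) by (intro mult_left_mono nrm_coef_le) simp
      also have "\<dots> \<le> Re (ip (v k) (v k))"
        using b(2) by (simp add: laurent_inner_def)
      finally show ?thesis
        using b(1) by (simp add: le_divide_eq mult.commute)
    qed
    have lim: "(\<lambda>k. Re (ip (v k) (v k)) / b) \<longlonglongrightarrow> 0"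
      using tendsto_divide[OF vlim tendsto_const[of b]] b(1) by simp
    have "(\<lambda>k. (cmod (coef (v k) e))\<^sup>2) \<longlonglongrightarrow> 0"
      by (rule tendsto_sandwich[OF _ _ tendsto_const lim]) (simp_all add: le)
    then have "(\<lambda>k. sqrt ((cmod (coef (v k) e))\<^sup>2)) \<longlonglongrightarrow> sqrt 0"
      by (rule tendsto_real_sqrt)
    then show ?thesis by (simp add: tendsto_norm_zero_iff)
  qed
  have shift: "coef (u k) (i, l) = coef (u (Suc k)) (i + 1, l) + coef (v k) (i, l)" for k i l
    by (simp add: u_Suc rest_def v_def lookup_minus)
  \<comment> \<open>Up to the vanishing \<open>v k\<close>, \<open>rest\<close> raises the degree in
    \<open>z\<close> by one, and degree \<open>n + 1\<close> is empty; hence a downward induction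
    from there.\<close>
  have u0: "(\<lambda>k. coef (u k) (i, l)) \<longlonglongrightarrow> 0" if "i \<le> n + 1" for i l
    using that
  proof (induction i rule: int_le_induct)
    case base
    have "coef (u k) (n + 1, l) = 0" for k
      using suppD[OF su[of k]] by auto
    then show ?case by simp
  next
    case (step i)
    have "(\<lambda>k. coef (u (Suc k)) (i, l) + coef (v k) (i - 1, l)) \<longlonglongrightarrow> 0 + 0"
      by (intro tendsto_add v0 LIMSEQ_Suc step.IH)
    then show ?case
      using shift[of _ "i - 1" l] by simp
  qed
  have lim: "(\<lambda>k. Re (ip (u k) (u k))) \<longlonglongrightarrow> 0" "(\<lambda>k. Re (Q.ip (u k) (u k))) \<longlonglongrightarrow> 0"
    using su
    by (intro ip_tendsto_0[where T = "grid n m" and e = "\<lambda>_. 0"]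
        Q.ip_tendsto_0[where T = "grid n m" and e = "\<lambda>_. 0"]; force intro: u0)+
  \<comment> \<open>The discrepancy of the two forms is invariant under \<open>rest\<close> and
    tends to zero, so it is zero from the start.\<close>
  define D where "D k = Re (Q.ip (u k) (u k)) - Re (ip (u k) (u k))" for k
  have "D (Suc k) = D k" for k
    using arg_cong[OF Q_ip_rest[OF su[of k]], of Re] by (simp add: D_def u_Suc)
  then have "D k = D 0" for k
    by (induction k) auto
  then have "D = (\<lambda>_. D 0)" by blast
  moreover have "D \<longlonglongrightarrow> 0 - 0"
    unfolding D_def by (intro tendsto_diff lim)
  ultimately have "D 0 = 0"
    by (metis LIMSEQ_const_iff diff_self)
  then have "Re (Q.ip x x) = Re (ip x x)"
    by (simp add: D_def u_def)
  then show ?thesis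
    using ip_self[of x] Q.ip_self[of x] by simp
qed

text \<open>Polarization of \<open>ip_agree_self\<close>.\<close>

lemma ip_agree:
  assumes "supp x \<subseteq> grid n m" "supp y \<subseteq> grid n m"
  shows "Q.ip x y = ip x y"
proof -
  define D where "D x y = Q.ip x y - ip x y" for x y
  have D0: "D z z = 0" if "supp z \<subseteq> grid n m" for z
    using ip_agree_self[OF that] by (simp add: D_def)
  have "D (x + y) (x + y) = D x x + D x y + D y x + D y y"
    by (simp add: D_def ip_add_left ip_add_right Q.ip_add_left Q.ip_add_right)
  then have 1: "D x y + D y x = 0"
    using D0 assms supp_add by simp
  have "D (x + cst \<i> * y) (x + cst \<i> * y) = D x x - \<i> * D x y + \<i> * D y x + D y y"
    by (simp add: D_def ip_add_left ip_add_right Q.ip_add_left Q.ip_add_right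
        ip_cst_left ip_cst_right Q.ip_cst_left Q.ip_cst_right) (simp add: algebra_simps)
  then have "\<i> * (D y x - D x y) = 0"
    using D0 assms supp_add supp_cst_mult by (simp add: algebra_simps)
  then have "D x y = 0"
    using 1 by simp
  then show ?thesis by (simp add: D_def)
qed

theorem L_agree:
  assumes x: "supp x \<subseteq> {- n..n} \<times> {- m..m}"
  shows "L' x = L x"
proof -
  have mono: "L' (monomial e) = L (monomial e)" if e: "e \<in> {- n..n} \<times> {- m..m}" for e
  proof -
    obtain i j where ij: "e = (i, j)" by (cases e)
    \<comment> \<open>Positive parts of the exponents: \<open>a\<close> and \<open>a - e\<close>
      both lie in the grid, and the product of \<open>monomial a\<close> with the dagger of
      \<open>monomial (a - e)\<close> is \<open>monomial e\<close>.\<close>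
    define a where "a = (max i 0, max j 0)"
    have "Q.ip (monomial a) (monomial (a - e)) = ip (monomial a) (monomial (a - e))"
      using e nm1 by (intro ip_agree) (auto simp: a_def ij)
    then show ?thesis
      by (simp add: ip_monomials Q.ip_monomials)
  qed
  have "L' x = Q.ip x 1" "L x = ip x 1"
    by (simp_all add: laurent_inner_def)
  then show ?thesis
    using mono x
    by (simp add: ip_expand_left[of "supp x" x 1] Q.ip_expand_left[of "supp x" x 1])
       (auto simp: laurent_inner_def intro!: sum.cong)
qed

end

subsection \<open>Means over the torus\<close>

definition torus_continuous :: "(complex \<Rightarrow> complex \<Rightarrow> complex) \<Rightarrow> bool" where
  "torus_continuous F \<longleftrightarrow> continuous_on (sphere 0 1 \<times> sphere 0 1) (\<lambda>x. F (fst x) (snd x))"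

definition torus_mean :: "(complex \<Rightarrow> complex \<Rightarrow> complex) \<Rightarrow> complex" where
  "torus_mean F = complex_of_real (1 / (2 * pi)\<^sup>2) *
    integral (cbox (0, 0) (2 * pi, 2 * pi)) (\<lambda>(s, t). F (cis s) (cis t))"

lemma continuous_on_cis_pair:
  assumes "torus_continuous F"
  shows "continuous_on A (\<lambda>(s, t). F (cis s) (cis t))"
proof -
  have "continuous_on A (\<lambda>x. (\<lambda>y. F (fst y) (snd y)) (cis (fst x), cis (snd x)))"
    by (rule continuous_on_compose2[OF assms[unfolded torus_continuous_def]])
       (auto intro!: continuous_intros simp: cis_conv_exp)
  then show ?thesis by (simp add: case_prod_unfold)
qed

lemma integrable_cis_pair:
  "torus_continuous F \<Longrightarrow> (\<lambda>(s, t). F (cis s) (cis t)) integrable_on cbox (0, 0) (2 * pi, 2 * pi)"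
  by (intro integrable_continuous continuous_on_cis_pair)

lemma torus_mean_cong:
  assumes "\<And>z w. cmod z = 1 \<Longrightarrow> cmod w = 1 \<Longrightarrow> F z w = G z w"
  shows "torus_mean F = torus_mean G"
  unfolding torus_mean_def using assms by simp

lemma torus_mean_add:
  assumes "torus_continuous F" "torus_continuous G"
  shows "torus_mean (\<lambda>z w. F z w + G z w) = torus_mean F + torus_mean G"
  using integral_add[OF assms[THEN integrable_cis_pair]]
  by (simp add: torus_mean_def case_prod_unfold distrib_left)

lemma torus_mean_mult: "torus_mean (\<lambda>z w. c * F z w) = c * torus_mean F"
  by (simp add: torus_mean_def case_prod_unfold)

lemma torus_mean_cnj: "torus_mean (\<lambda>z w. cnj (F z w)) = cnj (torus_mean F)"
  by (simp add: torus_mean_def case_prod_unfold integral_cnj)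

lemma torus_mean_swap:
  assumes "torus_continuous F"
  shows "torus_mean (\<lambda>z w. F w z) = torus_mean F"
  unfolding torus_mean_def
  using integral_swap_2dim[OF continuous_on_cis_pair[OF assms], of 0 0 "2 * pi" "2 * pi"] by simp

lemma torus_continuous_swap:
  assumes "torus_continuous F"
  shows "torus_continuous (\<lambda>z w. F w z)"
proof -
  have "continuous_on (sphere 0 1 \<times> sphere 0 1) (\<lambda>x. (\<lambda>y. F (fst y) (snd y)) (snd x, fst x))"
    by (rule continuous_on_compose2[OF assms[unfolded torus_continuous_def]]) (auto intro!: continuous_intros)
  then show ?thesis by (simp add: torus_continuous_def)
qed

lemma torus_mean_nonneg:
  assumes "torus_continuous F" "\<And>z w. cmod z = 1 \<Longrightarrow> cmod w = 1 \<Longrightarrow> 0 \<le> Re (F z w)"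
  shows "0 \<le> Re (torus_mean F)"
proof -
  let ?I = "cbox (0, 0) (2 * pi, 2 * pi) :: (real \<times> real) set"
  have int: "(\<lambda>(s, t). F (cis s) (cis t)) integrable_on ?I"
    by (rule integrable_cis_pair[OF assms(1)])
  have "0 \<le> integral ?I (Re \<circ> (\<lambda>(s, t). F (cis s) (cis t)))"
    using integrable_linear[OF int bounded_linear_Re] by (rule integral_nonneg) (auto simp: assms(2))
  also have "\<dots> = Re (integral ?I (\<lambda>(s, t). F (cis s) (cis t)))"
    by (rule integral_linear[OF int bounded_linear_Re])
  finally show ?thesis by (simp add: torus_mean_def del: of_real_divide of_real_power)
qed

lemma torus_mean_mono:
  assumes F: "torus_continuous F" and G: "torus_continuous G"
    and le: "\<And>z w. cmod z = 1 \<Longrightarrow> cmod w = 1 \<Longrightarrow> Re (F z w) \<le> Re (G z w)"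
  shows "Re (torus_mean F) \<le> Re (torus_mean G)"
proof -
  have "torus_continuous (\<lambda>z w. - 1 * F z w)"
    using F unfolding torus_continuous_def by (intro continuous_intros)
  moreover from this have "torus_continuous (\<lambda>z w. G z w + - 1 * F z w)"
    using F G unfolding torus_continuous_def by (intro continuous_intros)
  ultimately show ?thesis
    using torus_mean_nonneg[of "\<lambda>z w. G z w + - 1 * F z w"] le
      torus_mean_add[OF G, of "\<lambda>z w. - 1 * F z w"] torus_mean_mult[of "- 1" F]
    by simp
qed

lemma torus_mean_1: "torus_mean (\<lambda>z w. 1) = 1"
proof -
  have "measure lborel (cbox (0, 0) (2 * pi, 2 * pi) :: (real \<times> real) set) = (2 * pi) * (2 * pi)"
    by (simp add: content_Pair)
  then show ?thesis
    by (simp add: torus_mean_def case_prod_unfold power2_eq_square scaleR_conv_of_real)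
qed

text \<open>The mean value property: Cauchy's integral formula at the centre of the disc.\<close>

lemma circle_mean_zero:
  assumes "continuous_on (cball 0 1) H" "H holomorphic_on ball 0 1" "H 0 = 0"
  shows "integral {0..2 * pi} (\<lambda>t. H (cis t)) = 0"
proof -
  have "((\<lambda>u. H u / (u - 0)) has_contour_integral 2 * of_real pi * \<i> * H 0) (circlepath 0 1)"
    using assms by (intro Cauchy_integral_circlepath) auto
  then have "((\<lambda>t. H (cis t) / cis t * \<i> * cis t) has_integral 0) {0..2 * pi}"
    using assms(3) by (simp add: circlepath_def has_contour_integral_part_circlepath_iff)
  then have "((\<lambda>t. \<i> * H (cis t)) has_integral 0) {0..2 * pi}"
    by (simp add: mult.commute)
  then have "((\<lambda>t. - \<i> * (\<i> * H (cis t))) has_integral (- \<i> * 0)) {0..2 * pi}"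
    by (rule has_integral_mult_right)
  then show ?thesis
    by (simp add: integral_unique flip: mult.assoc)
qed

lemma torus_mean_zero:
  assumes F: "torus_continuous F"
    and H: "\<And>z. cmod z = 1 \<Longrightarrow> \<exists>H. continuous_on (cball 0 1) H \<and> H holomorphic_on ball 0 1 \<and> H 0 = 0 \<and>
      (\<forall>w. cmod w = 1 \<longrightarrow> F z w = H w)"
  shows "torus_mean F = 0"
proof -
  have "integral {0..2 * pi} (\<lambda>t. F (cis s) (cis t)) = 0" for s
  proof -
    obtain H where "continuous_on (cball 0 1) H" "H holomorphic_on ball 0 1" "H 0 = 0"
      "\<And>w. cmod w = 1 \<Longrightarrow> F (cis s) w = H w"
      using H[of "cis s"] by auto
    then show ?thesis
      using circle_mean_zero[of H] by simp
  qed
  then show ?thesis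
    unfolding torus_mean_def
    by (subst integral_prod_continuous[OF continuous_on_cis_pair[OF F]]) simp
qed

lemma torus_continuous_pval: "torus_continuous (\<lambda>z w. pval z w e)"
  unfolding torus_continuous_def pval_def by (intro continuous_intros) auto

lemma torus_continuous_eval: "torus_continuous (laurent_eval x)"
proof -
  have "continuous_on (sphere 0 1 \<times> sphere 0 1) (\<lambda>v. \<Sum>e\<in>supp x. coef x e * pval (fst v) (snd v) e)"
    using torus_continuous_pval unfolding torus_continuous_def by (intro continuous_intros)
  then show ?thesis
    by (simp add: torus_continuous_def laurent_eval_eq[of "supp x" x])
qed

lemma torus_continuous_mult:
  "torus_continuous F \<Longrightarrow> torus_continuous G \<Longrightarrow> torus_continuous (\<lambda>z w. F z w * G z w)"
  unfolding torus_continuous_def by (intro continuous_intros)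

lemma torus_continuous_add:
  "torus_continuous F \<Longrightarrow> torus_continuous G \<Longrightarrow> torus_continuous (\<lambda>z w. F z w + G z w)"
  unfolding torus_continuous_def by (intro continuous_intros)

lemma torus_continuous_const: "torus_continuous (\<lambda>z w. c)"
  unfolding torus_continuous_def by (intro continuous_intros)

lemma torus_continuous_divide:
  "torus_continuous F \<Longrightarrow> torus_continuous G \<Longrightarrow> (\<And>z w. cmod z = 1 \<Longrightarrow> cmod w = 1 \<Longrightarrow> G z w \<noteq> 0) \<Longrightarrow>
    torus_continuous (\<lambda>z w. F z w / G z w)"
  unfolding torus_continuous_def by (intro continuous_intros) auto

lemma torus_mean_sum:
  assumes "\<And>a. a \<in> A \<Longrightarrow> torus_continuous (F a)"
  shows "torus_mean (\<lambda>z w. \<Sum>a\<in>A. F a z w) = (\<Sum>a\<in>A. torus_mean (F a))"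
  using assms
proof (induction A rule: infinite_finite_induct)
  case (insert a A)
  have "torus_continuous (\<lambda>z w. \<Sum>a\<in>A. F a z w)"
    using insert.prems unfolding torus_continuous_def by (intro continuous_intros) auto
  then show ?case
    using insert by (simp add: torus_mean_add)
qed (simp_all add: torus_mean_def case_prod_unfold)

lemma torus_mean_pval_pos:
  assumes "0 < j"
  shows "torus_mean (\<lambda>z w. pval z w (i, j)) = 0"
proof (rule torus_mean_zero[OF torus_continuous_pval])
  fix z :: complex assume "cmod z = 1"
  have "pval z w (i, j) = z powi i * w ^ nat j" for w
    using assms by (simp add: pval_def power_int_def)
  then show "\<exists>H. continuous_on (cball 0 1) H \<and> H holomorphic_on ball 0 1 \<and> H 0 = 0 \<and>
      (\<forall>w. cmod w = 1 \<longrightarrow> pval z w (i, j) = H w)"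
    using assms by (intro exI[of _ "\<lambda>w. z powi i * w ^ nat j"]) (auto intro!: continuous_intros holomorphic_intros)
qed

lemma cnj_pval:
  assumes "cmod z = 1" "cmod w = 1"
  shows "cnj (pval z w e) = pval z w (- e)"
  using laurent_eval_dagger_torus[OF assms, of "monomial e"] by simp

lemma torus_mean_pval: "torus_mean (\<lambda>z w. pval z w e) = (if e = 0 then 1 else 0)"
proof -
  have nonzero: "torus_mean (\<lambda>z w. pval z w (i, j)) = 0" if "j \<noteq> 0" for i j
  proof (cases "0 < j")
    case False
    have "torus_mean (\<lambda>z w. pval z w (i, j)) = torus_mean (\<lambda>z w. cnj (pval z w (- i, - j)))"
      by (rule torus_mean_cong) (simp add: cnj_pval)
    then show ?thesis
      using False that by (simp only: torus_mean_cnj) (simp add: torus_mean_pval_pos)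
  qed (rule torus_mean_pval_pos)
  obtain i j where e: "e = (i, j)" by (cases e)
  consider "j \<noteq> 0" | "j = 0" "i \<noteq> 0" | "j = 0" "i = 0" by blast
  then show ?thesis
  proof cases
    case 1
    then show ?thesis by (simp add: e nonzero zero_prod_def)
  next
    case 2
    \<comment> \<open>Exchanging the variables moves the exponent to \<open>w\<close>, the case
      treated by \<open>nonzero\<close>.\<close>
    have "torus_mean (\<lambda>z w. pval z w (i, 0)) = torus_mean (\<lambda>z w. pval w z (i, 0))"
      by (rule torus_mean_swap[OF torus_continuous_pval, symmetric])
    also have "\<dots> = torus_mean (\<lambda>z w. pval z w (0, i))"
      by (simp add: pval_def)
    finally show ?thesis
      using 2 by (simp add: e nonzero zero_prod_def)
  next
    case 3
    then show ?thesis
      by (simp add: e torus_mean_1 flip: zero_prod_def)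
  qed
qed

lemma torus_mean_eval: "torus_mean (laurent_eval x) = coef x 0"
proof -
  have "torus_mean (laurent_eval x) = torus_mean (\<lambda>z w. \<Sum>e\<in>supp x. coef x e * pval z w e)"
    by (rule torus_mean_cong) (simp add: laurent_eval_eq[of "supp x"])
  also have "\<dots> = (\<Sum>e\<in>supp x. coef x e * (if e = 0 then 1 else 0))"
    by (subst torus_mean_sum)
       (auto simp: torus_mean_mult torus_mean_pval intro!: torus_continuous_mult torus_continuous_const torus_continuous_pval)
  also have "\<dots> = coef x 0"
    by (auto simp: if_distrib in_keys_iff cong: if_cong)
  finally show ?thesis .
qed

lemma coef_mult_dagger_0: "coef (x * dagger x) 0 = complex_of_real (nrm x)"
proof -
  have "x * dagger x = (\<Sum>e\<in>supp x. Poly_Mapping.single e (coef x e) * dagger x)"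
    by (subst (1) laurent_sum[of "supp x" x]) (auto simp: sum_distrib_right)
  then have "coef (x * dagger x) 0 = (\<Sum>e\<in>supp x. coef x e * cnj (coef x e))"
    by (simp add: lookup_sum coef_single_mult lookup_dagger)
  then show ?thesis
    by (simp add: nrm_def complex_norm_square del: of_real_power)
qed

text \<open>Parseval's identity, as the constant coefficient of \<open>x * dagger x\<close>.\<close>

lemma torus_mean_norm_eval: "torus_mean (\<lambda>z w. complex_of_real ((cmod (laurent_eval x z w))\<^sup>2)) = complex_of_real (nrm x)"
proof -
  have "torus_mean (\<lambda>z w. complex_of_real ((cmod (laurent_eval x z w))\<^sup>2)) = torus_mean (laurent_eval (x * dagger x))"
  proof (rule torus_mean_cong)
    fix z w :: complex assume *: "cmod z = 1" "cmod w = 1"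
    then have "z \<noteq> 0" "w \<noteq> 0" by auto
    then show "complex_of_real ((cmod (laurent_eval x z w))\<^sup>2) = laurent_eval (x * dagger x) z w"
      by (simp add: laurent_eval_mult laurent_eval_dagger_torus[OF *] complex_norm_square del: of_real_power)
  qed
  then show ?thesis
    by (simp add: torus_mean_eval coef_mult_dagger_0)
qed

section \<open>Weights that are reciprocals of positive Laurent polynomials\<close>

definition torus_positive :: "laurent \<Rightarrow> bool" where
  "torus_positive f \<longleftrightarrow> (\<forall>z w. cmod z = 1 \<longrightarrow> cmod w = 1 \<longrightarrow>
    laurent_eval f z w \<in> \<real> \<and> Re (laurent_eval f z w) > 0)"

lemma torus_positive_eq:
  "torus_positive f \<Longrightarrow> cmod z = 1 \<Longrightarrow> cmod w = 1 \<Longrightarrow>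
    laurent_eval f z w = complex_of_real (Re (laurent_eval f z w))"
  unfolding torus_positive_def by (metis of_real_Re)

lemma torus_positive_nonzero:
  "torus_positive f \<Longrightarrow> cmod z = 1 \<Longrightarrow> cmod w = 1 \<Longrightarrow> laurent_eval f z w \<noteq> 0"
  unfolding torus_positive_def by force

lemma torus_positive_bounds:
  assumes "torus_positive f"
  obtains a b where "0 < a" "0 < b"
    "\<And>z w. cmod z = 1 \<Longrightarrow> cmod w = 1 \<Longrightarrow> a \<le> Re (laurent_eval f z w) \<and> Re (laurent_eval f z w) \<le> b"
proof -
  let ?T = "sphere 0 1 \<times> sphere 0 1 :: (complex \<times> complex) set"
  let ?g = "\<lambda>v. Re (laurent_eval f (fst v) (snd v))"
  have T: "compact ?T" "?T \<noteq> {}"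
    by (auto intro!: compact_Times exI[of _ 1])
  have g: "continuous_on ?T ?g"
    using torus_continuous_eval[of f] unfolding torus_continuous_def by (intro continuous_intros)
  obtain u where u: "u \<in> ?T" "\<And>v. v \<in> ?T \<Longrightarrow> ?g u \<le> ?g v"
    using continuous_attains_inf[OF T g] by blast
  obtain v where v: "v \<in> ?T" "\<And>u. u \<in> ?T \<Longrightarrow> ?g u \<le> ?g v"
    using continuous_attains_sup[OF T g] by blast
  show thesis
  proof
    show "0 < ?g u" "0 < ?g v"
      using u(1) v(1) assms by (auto simp: torus_positive_def)
    show "?g u \<le> Re (laurent_eval f z w) \<and> Re (laurent_eval f z w) \<le> ?g v" if "cmod z = 1" "cmod w = 1" for z w
      using u(2)[of "(z, w)"] v(2)[of "(z, w)"] that by simp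
  qed
qed

lemma recip_functional_eq:
  assumes "torus_positive f"
  shows "recip_functional f g = torus_mean (\<lambda>z w. laurent_eval g z w / laurent_eval f z w)"
proof -
  let ?I = "cbox (0, 0) (2 * pi, 2 * pi) :: (real \<times> real) set"
  let ?h = "\<lambda>(s, t). laurent_eval g (cis s) (cis t) / laurent_eval f (cis s) (cis t)"
  have I: "{0..2 * pi} \<times> {0..2 * pi} = ?I"
    by (simp add: cbox_Pair_eq)
  have "torus_continuous (\<lambda>z w. laurent_eval g z w / laurent_eval f z w)"
    using assms by (intro torus_continuous_divide torus_continuous_eval torus_positive_nonzero)
  then have "set_integrable lborel ?I ?h"
    unfolding set_integrable_def
    by (intro borel_integrable_compact continuous_on_cis_pair compact_cbox)
  then have "set_lebesgue_integral lborel ?I ?h = integral ?I ?h"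
    by (rule set_borel_integral_eq_integral)
  then show ?thesis
    unfolding recip_functional_def torus_mean_def I by simp
qed

lemma torus_continuous_recip:
  "torus_positive f \<Longrightarrow> torus_continuous (\<lambda>z w. laurent_eval x z w / laurent_eval f z w)"
  by (intro torus_continuous_divide torus_continuous_eval torus_positive_nonzero)

lemma recip_functional_self:
  assumes "torus_positive f"
  shows "recip_functional f f = 1"
proof -
  have "recip_functional f f = torus_mean (\<lambda>z w. 1)"
    unfolding recip_functional_eq[OF assms]
    by (rule torus_mean_cong) (simp add: torus_positive_nonzero[OF assms])
  then show ?thesis by (simp add: torus_mean_1)
qed

lemma recip_functional_square:
  assumes "torus_positive f"
  shows "recip_functional f (x * dagger x)
    = torus_mean (\<lambda>z w. complex_of_real ((cmod (laurent_eval x z w))\<^sup>2 / Re (laurent_eval f z w)))"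
  unfolding recip_functional_eq[OF assms]
proof (rule torus_mean_cong)
  fix z w :: complex assume *: "cmod z = 1" "cmod w = 1"
  then have "z \<noteq> 0" "w \<noteq> 0" by auto
  then have "laurent_eval (x * dagger x) z w = complex_of_real ((cmod (laurent_eval x z w))\<^sup>2)"
    by (simp add: laurent_eval_mult laurent_eval_dagger_torus[OF *] complex_norm_square del: of_real_power)
  then show "laurent_eval (x * dagger x) z w / laurent_eval f z w
    = complex_of_real ((cmod (laurent_eval x z w))\<^sup>2 / Re (laurent_eval f z w))"
    using torus_positive_eq[OF assms *] by (metis of_real_divide)
qed

text \<open>By compactness \<open>f\<close> lies between positive constants \<open>a\<close> and
  \<open>b\<close>; comparing \<open>|x|^2 / f\<close> with \<open>|x|^2 / b\<close> and
  \<open>|x|^2 / a\<close> and applying Parseval gives \<open>lower\<close> and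
  \<open>upper\<close>.\<close>

lemma toeplitz_form_recip_functional:
  assumes f: "torus_positive f"
  shows "toeplitz_form (recip_functional f)"
proof
  obtain a b where ab: "0 < a" "0 < b"
    "\<And>z w. cmod z = 1 \<Longrightarrow> cmod w = 1 \<Longrightarrow> a \<le> Re (laurent_eval f z w) \<and> Re (laurent_eval f z w) \<le> b"
    using torus_positive_bounds[OF f] by metis
  note cont = torus_continuous_recip[OF f]
  fix x y :: laurent and c :: complex
  show "recip_functional f (x + y) = recip_functional f x + recip_functional f y"
    by (simp add: recip_functional_eq[OF f] laurent_eval_add add_divide_distrib torus_mean_add cont)
  show "recip_functional f (cst c * x) = c * recip_functional f x"
    by (simp add: recip_functional_eq[OF f] torus_mean_mult flip: times_divide_eq_right)
  show "recip_functional f (dagger x) = cnj (recip_functional f x)"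
  proof -
    have "recip_functional f (dagger x) = torus_mean (\<lambda>z w. cnj (laurent_eval x z w / laurent_eval f z w))"
      unfolding recip_functional_eq[OF f]
    proof (rule torus_mean_cong)
      fix z w :: complex assume *: "cmod z = 1" "cmod w = 1"
      show "laurent_eval (dagger x) z w / laurent_eval f z w = cnj (laurent_eval x z w / laurent_eval f z w)"
        using torus_positive_eq[OF f *]
        by (metis complex_cnj_complex_of_real complex_cnj_divide laurent_eval_dagger_torus[OF *])
    qed
    then show ?thesis
      by (simp only: torus_mean_cnj recip_functional_eq[OF f])
  qed
  have cont2: "torus_continuous (\<lambda>z w. complex_of_real ((cmod (laurent_eval x z w))\<^sup>2 / Re (laurent_eval f z w)))" for x
  proof -
    have nz: "Re (laurent_eval f (fst v) (snd v)) \<noteq> 0" if "v \<in> sphere 0 1 \<times> sphere 0 1" for v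
      using ab(1) ab(3)[of "fst v" "snd v"] that by auto
    then show ?thesis
      using torus_continuous_eval[of x] torus_continuous_eval[of f] unfolding torus_continuous_def
      by (intro continuous_intros ballI) (assumption | rule nz)+
  qed
  have cont1: "torus_continuous (\<lambda>z w. complex_of_real c * complex_of_real ((cmod (laurent_eval x z w))\<^sup>2))" for x c
    using torus_continuous_eval[of x] unfolding torus_continuous_def by (intro continuous_intros)
  have mean1: "Re (torus_mean (\<lambda>z w. complex_of_real c * complex_of_real ((cmod (laurent_eval x z w))\<^sup>2))) = c * nrm x" for x c
    by (simp add: torus_mean_mult torus_mean_norm_eval del: of_real_power)
  show "\<exists>c>0. \<forall>x. c * nrm x \<le> Re (recip_functional f (x * dagger x))"
  proof (intro exI[of _ "1 / b"] conjI allI)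
    fix x :: laurent
    show "1 / b * nrm x \<le> Re (recip_functional f (x * dagger x))"
      unfolding recip_functional_square[OF f] mean1[symmetric]
    proof (rule torus_mean_mono[OF cont1 cont2])
      fix z w :: complex assume *: "cmod z = 1" "cmod w = 1"
      show "Re (complex_of_real (1 / b) * complex_of_real ((cmod (laurent_eval x z w))\<^sup>2))
        \<le> Re (complex_of_real ((cmod (laurent_eval x z w))\<^sup>2 / Re (laurent_eval f z w)))"
        using ab(1,2) ab(3)[OF *] frac_le[of "(cmod (laurent_eval x z w))\<^sup>2" "(cmod (laurent_eval x z w))\<^sup>2" "Re (laurent_eval f z w)" b]
        by (simp add: Re_divide_of_real del: of_real_power)
    qed
  qed (use ab in simp)
  show "\<exists>c>0. \<forall>x. Re (recip_functional f (x * dagger x)) \<le> c * nrm x"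
  proof (intro exI[of _ "1 / a"] conjI allI)
    fix x :: laurent
    show "Re (recip_functional f (x * dagger x)) \<le> 1 / a * nrm x"
      unfolding recip_functional_square[OF f] mean1[symmetric]
    proof (rule torus_mean_mono[OF cont2 cont1])
      fix z w :: complex assume *: "cmod z = 1" "cmod w = 1"
      show "Re (complex_of_real ((cmod (laurent_eval x z w))\<^sup>2 / Re (laurent_eval f z w)))
        \<le> Re (complex_of_real (1 / a) * complex_of_real ((cmod (laurent_eval x z w))\<^sup>2))"
        using ab(1,2) ab(3)[OF *] frac_le[of "(cmod (laurent_eval x z w))\<^sup>2" "(cmod (laurent_eval x z w))\<^sup>2" a "Re (laurent_eval f z w)"]
        by (simp add: Re_divide_of_real del: of_real_power)
    qed
  qed (use ab in simp)
qed

lemma laurent_eval_polynomial: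
  assumes "supp p \<subseteq> {0..} \<times> {0..}"
  shows "laurent_eval p z w = (\<Sum>e\<in>supp p. coef p e * (z ^ nat (fst e) * w ^ nat (snd e)))"
  using assms by (auto simp: laurent_eval_eq[of "supp p" p] pval_def power_int_def intro!: sum.cong)

text \<open>For fixed \<open>z\<close> on the circle the quotient extends holomorphically in
  \<open>w\<close> to the disc and vanishes at its centre, as \<open>0 < j\<close>.\<close>

lemma torus_mean_over_stable_w:
  assumes p: "supp p \<subseteq> {0..} \<times> {0..}"
    and nz: "\<And>z w. cmod z \<le> 1 \<Longrightarrow> cmod w \<le> 1 \<Longrightarrow> laurent_eval p z w \<noteq> 0"
    and "0 < j"
  shows "torus_mean (\<lambda>z w. pval z w (i, j) / laurent_eval p z w) = 0"
proof (rule torus_mean_zero)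
  show "torus_continuous (\<lambda>z w. pval z w (i, j) / laurent_eval p z w)"
    using nz by (intro torus_continuous_divide torus_continuous_pval torus_continuous_eval) auto
  fix z :: complex assume z: "cmod z = 1"
  let ?q = "\<lambda>w. \<Sum>e\<in>supp p. coef p e * (z ^ nat (fst e) * w ^ nat (snd e))"
  have q: "laurent_eval p z w = ?q w" for w
    by (rule laurent_eval_polynomial[OF p])
  have nzq: "?q w \<noteq> 0" if "cmod w \<le> 1" for w
    using nz[of z w] z that unfolding q by simp
  have "pval z w (i, j) = z powi i * w ^ nat j" for w
    using assms by (simp add: pval_def power_int_def)
  moreover have "continuous_on (cball 0 1) (\<lambda>w. z powi i * w ^ nat j / ?q w)"
    using nzq by (intro continuous_intros) auto
  moreover have "(\<lambda>w. z powi i * w ^ nat j / ?q w) holomorphic_on ball 0 1"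
    using nzq by (intro holomorphic_intros) auto
  ultimately show "\<exists>H. continuous_on (cball 0 1) H \<and> H holomorphic_on ball 0 1 \<and> H 0 = 0 \<and>
      (\<forall>w. cmod w = 1 \<longrightarrow> pval z w (i, j) / laurent_eval p z w = H w)"
    using \<open>0 < j\<close> by (intro exI[of _ "\<lambda>w. z powi i * w ^ nat j / ?q w"]) (auto simp: q)
qed

lemma torus_mean_over_stable_z:
  assumes p: "supp p \<subseteq> {0..} \<times> {0..}"
    and nz: "\<And>z w. cmod z \<le> 1 \<Longrightarrow> cmod w \<le> 1 \<Longrightarrow> laurent_eval p z w \<noteq> 0"
    and "0 < i"
  shows "torus_mean (\<lambda>z w. pval z w (i, j) / laurent_eval p z w) = 0"
proof -
  have cont: "torus_continuous (\<lambda>z w. pval z w (i, j) / laurent_eval p z w)"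
    using nz by (intro torus_continuous_divide torus_continuous_pval torus_continuous_eval) auto
  have "torus_mean (\<lambda>z w. pval w z (i, j) / laurent_eval p w z) = 0"
  proof (rule torus_mean_zero)
    show "torus_continuous (\<lambda>z w. pval w z (i, j) / laurent_eval p w z)"
      by (rule torus_continuous_swap[OF cont])
    fix w :: complex assume w: "cmod w = 1"
    let ?q = "\<lambda>z. \<Sum>e\<in>supp p. coef p e * (z ^ nat (fst e) * w ^ nat (snd e))"
    have q: "laurent_eval p z w = ?q z" for z
      by (rule laurent_eval_polynomial[OF p])
    have nzq: "?q z \<noteq> 0" if "cmod z \<le> 1" for z
      using nz[of z w] w that unfolding q by simp
    have "pval z w (i, j) = z ^ nat i * w powi j" for z
      using assms by (simp add: pval_def power_int_def)
    moreover have "continuous_on (cball 0 1) (\<lambda>z. z ^ nat i * w powi j / ?q z)"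
      using nzq by (intro continuous_intros) auto
    moreover have "(\<lambda>z. z ^ nat i * w powi j / ?q z) holomorphic_on ball 0 1"
      using nzq by (intro holomorphic_intros) auto
    ultimately show "\<exists>H. continuous_on (cball 0 1) H \<and> H holomorphic_on ball 0 1 \<and> H 0 = 0 \<and>
        (\<forall>z. cmod z = 1 \<longrightarrow> pval z w (i, j) / laurent_eval p z w = H z)"
      using \<open>0 < i\<close> by (intro exI[of _ "\<lambda>z. z ^ nat i * w powi j / ?q z"]) (auto simp: q)
  qed
  then show ?thesis
    using torus_mean_swap[OF cont] by simp
qed

lemma stable_form_recip_functional:
  fixes n m :: int
  assumes f: "torus_positive f" and nm: "0 \<le> n" "0 \<le> m" and p: "supp p \<subseteq> grid n m"
    and nz: "\<And>z w. cmod z \<le> 1 \<Longrightarrow> cmod w \<le> 1 \<Longrightarrow> laurent_eval p z w \<noteq> 0"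
    and fp: "\<And>z w. cmod z = 1 \<Longrightarrow> cmod w = 1 \<Longrightarrow>
      laurent_eval f z w = complex_of_real ((cmod (laurent_eval p z w))\<^sup>2)"
  shows "stable_form (recip_functional f) p n m"
proof -
  interpret toeplitz_form "recip_functional f"
    by (rule toeplitz_form_recip_functional[OF f])
  have p': "supp p \<subseteq> {0..} \<times> {0..}" using p by auto
  have fp': "laurent_eval f z w = laurent_eval p z w * laurent_eval (dagger p) z w"
    "laurent_eval (dagger p) z w \<noteq> 0" "laurent_eval p z w \<noteq> 0" "z \<noteq> 0" "w \<noteq> 0"
    if "cmod z = 1" "cmod w = 1" for z w
    using nz[of z w] that
    by (auto simp: fp laurent_eval_dagger_torus complex_norm_square simp del: of_real_power)
  \<comment> \<open>On the torus \<open>f = p * dagger p\<close>, so the factor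
    \<open>dagger p\<close> from the inner product cancels.\<close>
  have ip: "ip (monomial e) p = torus_mean (\<lambda>z w. pval z w e / laurent_eval p z w)" for e
    unfolding laurent_inner_def recip_functional_eq[OF f]
    by (rule torus_mean_cong) (simp add: fp' laurent_eval_mult)
  show ?thesis
  proof
    show "ip (monomial (i, j)) p = 0" if "0 < i" for i j
      unfolding ip using torus_mean_over_stable_z[OF p' nz that] by blast
    show "ip (monomial (i, j)) p = 0" if "0 < j" for i j
      unfolding ip using torus_mean_over_stable_w[OF p' nz that] by blast
    show "recip_functional f (x * (p * dagger p)) = coef x 0" for x
    proof -
      have "recip_functional f (x * (p * dagger p)) = torus_mean (laurent_eval x)"
        unfolding recip_functional_eq[OF f]
        by (rule torus_mean_cong) (simp add: fp' laurent_eval_mult)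
      then show ?thesis by (simp add: torus_mean_eval)
    qed
  qed (use nm p in auto)
qed

text \<open>The mean of \<open>(f - g)\<^sup>2 / (f g)\<close> over the torus is the sum of the two functionals minus two.\<close>

lemma torus_positive_eqI:
  assumes f: "torus_positive f" and g: "torus_positive g"
    and "recip_functional f g = 1" "recip_functional g f = 1"
  shows "f = g"
proof -
  obtain b where b: "0 < b"
    "\<And>z w. cmod z = 1 \<Longrightarrow> cmod w = 1 \<Longrightarrow> Re (laurent_eval f z w) \<le> b"
    using torus_positive_bounds[OF f] by metis
  obtain c where c: "0 < c"
    "\<And>z w. cmod z = 1 \<Longrightarrow> cmod w = 1 \<Longrightarrow> Re (laurent_eval g z w) \<le> c"
    using torus_positive_bounds[OF g] by metis
  \<comment> \<open>\<open>?d\<close> replaces the denominator \<open>f g\<close> by its upper bound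
    \<open>b * c\<close>, so Parseval turns its mean into a multiple of \<open>nrm (f - g)\<close>;
    the mean of \<open>?s\<close> is zero.\<close>
  let ?d = "\<lambda>z w. complex_of_real (1 / (b * c)) * complex_of_real ((cmod (laurent_eval (f - g) z w))\<^sup>2)"
  let ?s = "\<lambda>z w. (laurent_eval g z w / laurent_eval f z w + laurent_eval f z w / laurent_eval g z w) + - 2"
  have cont: "torus_continuous (\<lambda>z w. laurent_eval g z w / laurent_eval f z w + laurent_eval f z w / laurent_eval g z w)"
    by (intro torus_continuous_add torus_continuous_recip f g)
  have "torus_mean (\<lambda>z w. - 2 * 1) = - 2 * 1"
    by (subst torus_mean_mult) (simp add: torus_mean_1)
  then have mean: "torus_mean ?s = 0"
    using assms(3,4) torus_mean_add[OF cont torus_continuous_const[of "- 2"]]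
    by (simp add: recip_functional_eq[OF f] recip_functional_eq[OF g]
        torus_mean_add[OF torus_continuous_recip[OF f] torus_continuous_recip[OF g]])
  have "Re (torus_mean ?d) \<le> Re (torus_mean ?s)"
  proof (rule torus_mean_mono)
    show "torus_continuous ?d"
      using torus_continuous_eval[of "f - g"] unfolding torus_continuous_def by (intro continuous_intros)
    show "torus_continuous ?s"
      by (rule torus_continuous_add[OF cont torus_continuous_const])
    fix z w :: complex assume *: "cmod z = 1" "cmod w = 1"
    define F where "F = Re (laurent_eval f z w)"
    have F: "laurent_eval f z w = complex_of_real F" "0 < F" "F \<le> b"
      using torus_positive_eq[OF f *] b(2)[OF *] f * by (simp_all add: torus_positive_def F_def)
    define G where "G = Re (laurent_eval g z w)"
    have G: "laurent_eval g z w = complex_of_real G" "0 < G" "G \<le> c"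
      using torus_positive_eq[OF g *] c(2)[OF *] g * by (simp_all add: torus_positive_def G_def)
    have "laurent_eval (f - g) z w = complex_of_real (F - G)"
      by (simp add: laurent_eval_diff F G)
    then have "Re (?d z w) = (F - G)\<^sup>2 / (b * c)"
      by (simp del: of_real_diff)
    also have "\<dots> \<le> (F - G)\<^sup>2 / (F * G)"
      using F G b(1) c(1) by (intro divide_left_mono mult_mono mult_pos_pos) auto
    also have "\<dots> = G / F + F / G - 2"
      using F G by (simp add: field_simps power2_eq_square)
    also have "\<dots> = Re (?s z w)"
      by (simp add: F G flip: of_real_divide)
    finally show "Re (?d z w) \<le> Re (?s z w)" .
  qed
  then have "1 / (b * c) * nrm (f - g) \<le> 0"
    unfolding mean torus_mean_mult torus_mean_norm_eval
    by (simp only: of_real_mult[symmetric] Re_complex_of_real zero_complex.sel)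
  then have "nrm (f - g) \<le> 0"
    using b(1) c(1) by (simp add: divide_le_0_iff mult_le_0_iff)
  then show "f = g"
    using nrm_nonneg[of "f - g"] by (metis nrm_eq_0_iff antisym eq_iff_diff_eq_0)
qed

subsection \<open>The matrix of mixed inner products\<close>

lemma K_mat_entry:
  assumes "1 \<le> n" "1 \<le> m" "i < m" "j < n"
  shows "K_mat L n m $$ (i, j) = laurent_inner L (lex_poly L n (m - 1) (m - 1 - i)) (revlex_poly L (n - 1) m (n - 1 - j))"
  using assms
  by (simp add: K_mat_def mat_inner_def mat_dagger_def lex_vec_def revlex_vec_def laurent_inner_def scalar_prod_def)

lemma K_mat_eq_0_iff:
  assumes "1 \<le> n" "1 \<le> m"
  shows "K_mat L n m = 0\<^sub>m m n \<longleftrightarrow>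
    (\<forall>l<m. \<forall>k<n. laurent_inner L (lex_poly L n (m - 1) l) (revlex_poly L (n - 1) m k) = 0)"
    (is "?K \<longleftrightarrow> ?R")
proof
  assume ?K
  show ?R
  proof (intro allI impI)
    fix l k assume "l < m" "k < n"
    then have "K_mat L n m $$ (m - 1 - l, n - 1 - k) = 0"
      unfolding \<open>?K\<close> by (intro index_zero_mat) auto
    then show "laurent_inner L (lex_poly L n (m - 1) l) (revlex_poly L (n - 1) m k) = 0"
      using \<open>l < m\<close> \<open>k < n\<close> K_mat_entry[OF assms, of "m - 1 - l" "n - 1 - k" L] by simp
  qed
next
  assume ?R
  show ?K
  proof (rule eq_matI)
    show "dim_row (K_mat L n m) = dim_row (0\<^sub>m m n)" "dim_col (K_mat L n m) = dim_col (0\<^sub>m m n)"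
      using K_mat_carrier[OF assms, of L] by auto
    show "K_mat L n m $$ (i, j) = 0\<^sub>m m n $$ (i, j)" if "i < dim_row (0\<^sub>m m n :: complex mat)" "j < dim_col (0\<^sub>m m n :: complex mat)" for i j
      using that \<open>?R\<close> assms K_mat_entry[OF assms, of i j L] by simp
  qed
qed

lemma image_int_atMost: "int ` {..l} = {0..int l}"
  by (simp add: image_int_atLeastAtMost flip: atLeast0AtMost)

lemma lex_poly_set:
  "{0..<int a} \<times> {0..int b} \<union> {int a} \<times> {0..int l} = {0..<int a} \<times> {0..int b} \<union> (\<lambda>j. (int a, int j)) ` {..l}"
  unfolding image_int_atMost[symmetric] by auto

lemma revlex_poly_set:
  "{0..int a} \<times> {0..<int b} \<union> {0..int l} \<times> {int b} = {0..int a} \<times> {0..<int b} \<union> (\<lambda>j. (int j, int b)) ` {..l}"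
  unfolding image_int_atMost[symmetric] by auto

lemma K_mat_zero_if_stable:
  fixes n m :: nat
  assumes nm: "1 \<le> n" "1 \<le> m" and "stable_form L p (int n) (int m)"
  shows "K_mat L n m = 0\<^sub>m m n"
  unfolding K_mat_eq_0_iff[OF nm]
proof (intro allI impI)
  interpret stable_form L p "int n" "int m" by fact
  fix l k assume l: "l < m" and k: "k < n"
  \<comment> \<open>The polynomial of the larger box \<open>(n, m)\<close>: by
    \<open>top_row_zero\<close> it already lies in the box \<open>(n, m - 1)\<close>, where
    uniqueness identifies it with the entry of \<open>lex_vec\<close>.\<close>
  define y where "y = lex_poly L n m l"
  let ?S = "\<lambda>b. {0..<int n} \<times> {0..int b} \<union> {int n} \<times> {0..int l}"
  have y: "orthonormal_at (?S m) (int n, int l) y"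
    unfolding y_def lex_poly_def by (rule orthonormal_at_orthonormal_poly) auto
  have sy: "supp y \<subseteq> ?S m"
    using y by (simp add: orthonormal_at_def)
  have perp: "ip y (monomial (i, j)) = 0" if "0 \<le> i" "i < int n" "0 \<le> j" "j \<le> int m" for i j
    using y that by (simp add: orthonormal_at_def)
  have "coef y (i, int m) = 0" for i
  proof (rule top_row_zero)
    show "supp y \<subseteq> grid (int n) (int m) - {(int n, int m)}"
      using sy l by force
  qed (rule perp)
  then have "snd e \<noteq> int m" if "e \<in> supp y" for e
    using that by (metis in_keys_iff prod.collapse)
  then have "supp y \<subseteq> ?S (m - 1)"
    using sy nm by (fastforce simp: of_nat_diff)
  then have "orthonormal_at (?S (m - 1)) (int n, int l) y"
    using y by (auto simp: orthonormal_at_def)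
  then have "lex_poly L n (m - 1) l = y"
    unfolding lex_poly_def by (intro orthonormal_poly_eqI) auto
  moreover have "ip y (revlex_poly L (n - 1) m k) = 0"
  proof (rule ip_zero_right)
    fix s assume "s \<in> supp (revlex_poly L (n - 1) m k)"
    moreover have "supp (revlex_poly L (n - 1) m k) \<subseteq> {0..int (n - 1)} \<times> {0..<int m} \<union> {0..int k} \<times> {int m}"
      unfolding revlex_poly_def by (intro orthonormal_polyD) auto
    ultimately have "s \<in> {0..int (n - 1)} \<times> {0..<int m} \<union> {0..int k} \<times> {int m}"
      by blast
    then show "ip y (monomial s) = 0"
      using perp[of "fst s" "snd s"] k by (cases s) auto
  qed
  ultimately show "ip (lex_poly L n (m - 1) l) (revlex_poly L (n - 1) m k) = 0"
    by simp
qed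

text \<open>\<open>orthonormal_polys_span\<close> is used twice: along the
  \<open>revlex_poly\<close> side it makes each \<open>lex_poly\<close> orthogonal to the monomials
  of \<open>grid (n - 1) m\<close>, then along the \<open>lex_poly\<close> side it reaches the
  monomials of \<open>grid n (m - 1)\<close>.\<close>

lemma uncoupled_if_K_mat_zero:
  fixes n m :: nat
  assumes nm: "1 \<le> n" "1 \<le> m" and "toeplitz_form L" and K: "K_mat L n m = 0\<^sub>m m n"
  shows "uncoupled_form L (int n) (int m)"
proof -
  interpret toeplitz_form L by fact
  have K0: "ip (lex_poly L n (m - 1) l) (revlex_poly L (n - 1) m k) = 0" if "l < m" "k < n" for l k
    using K that unfolding K_mat_eq_0_iff[OF nm] by blast
  have n1: "int (n - 1) = int n - 1" and m1: "int (m - 1) = int m - 1"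
    using nm by (auto simp: of_nat_diff)
  have sets: "{0..<int n} = {0..int n - 1}" "{0..<int m} = {0..int m - 1}" by auto
  have lex: "lex_poly L n (m - 1) l
      = orthonormal_poly L (grid (int n - 1) (int m - 1) \<union> (\<lambda>j. (int n, int j)) ` {..l}) (int n, int l)" for l
    unfolding lex_poly_def lex_poly_set by (simp only: sets m1)
  have revlex: "revlex_poly L (n - 1) m k
      = orthonormal_poly L (grid (int n - 1) (int m - 1) \<union> (\<lambda>j. (int j, int m)) ` {..k}) (int k, int m)" for k
    unfolding revlex_poly_def revlex_poly_set by (simp only: sets n1)
  have lex_perp: "ip (lex_poly L n (m - 1) l) (monomial t) = 0"
    if "l < m" "t \<in> grid (int n - 1) (int m)" for l t
  proof -
    let ?y = "lex_poly L n (m - 1) l"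
    have low: "ip (monomial t) ?y = 0" if "t \<in> grid (int n - 1) (int m - 1)" for t
    proof -
      have "ip ?y (monomial t) = 0"
        unfolding lex using that by (intro orthonormal_polyD) auto
      then show ?thesis using ip_swap_zero by blast
    qed
    show ?thesis
    proof (cases "t \<in> grid (int n - 1) (int m - 1)")
      case True
      then show ?thesis using low ip_swap_zero by blast
    next
      case False
      define k where "k = nat (fst t)"
      have k: "t = (int k, int m)" "k \<le> n - 1"
        using False that(2) nm by (cases t, force simp: k_def)+
      have "ip (monomial (int k, int m)) ?y = 0"
      proof (rule orthonormal_polys_span[where U = "grid (int n - 1) (int m - 1)" and e = "\<lambda>j. (int j, int m)" and b = "n - 1"])
        fix j assume "j \<le> n - 1"
        then have "ip ?y (revlex_poly L (n - 1) m j) = 0"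
          using K0 that(1) nm by simp
        then show "ip (orthonormal_poly L (grid (int n - 1) (int m - 1) \<union> (\<lambda>j. (int j, int m)) ` {..j}) (int j, int m)) ?y = 0"
          unfolding revlex using ip_swap_zero by blast
      qed (use low k in auto)
      then show ?thesis
        using k ip_swap_zero by simp
    qed
  qed
  show ?thesis
  proof
    show "1 \<le> int n" "1 \<le> int m" using nm by auto
    fix q r
    assume q: "supp q \<subseteq> grid (int n) (int m - 1)" and r: "supp r \<subseteq> grid (int n - 1) (int m)"
      and r0: "\<And>t. t \<in> grid (int n - 1) (int m - 1) \<Longrightarrow> ip r (monomial t) = 0"
    have low: "ip (monomial t) r = 0" if "t \<in> grid (int n - 1) (int m - 1)" for t
      using r0[OF that] ip_swap_zero by blast
    have top: "ip (monomial (int n, int l)) r = 0" if "l \<le> m - 1" for l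
    proof (rule orthonormal_polys_span[where U = "grid (int n - 1) (int m - 1)" and e = "\<lambda>j. (int n, int j)" and b = "m - 1"])
      fix j assume "j \<le> m - 1"
      then have "j < m" using nm by simp
      have "ip (lex_poly L n (m - 1) j) r = 0"
        by (rule ip_zero_right, rule lex_perp[OF \<open>j < m\<close>]) (use r in blast)
      then show "ip (orthonormal_poly L (grid (int n - 1) (int m - 1) \<union> (\<lambda>j. (int n, int j)) ` {..j}) (int n, int j)) r = 0"
        unfolding lex .
    qed (use low that in auto)
    show "ip q r = 0"
    proof (rule ip_zero_left)
      fix s assume "s \<in> supp q"
      then have s: "s \<in> grid (int n) (int m - 1)" using q by blast
      show "ip (monomial s) r = 0"
      proof (cases "fst s = int n")
        case True
        then have "s = (int n, int (nat (snd s)))" "nat (snd s) \<le> m - 1"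
          using s by (cases s, force)+
        then show ?thesis using top by metis
      next
        case False
        then show ?thesis using s by (intro low) auto
      qed
    qed
  qed
qed

lemma factorization_if_uncoupled:
  fixes n m :: int
  assumes f: "torus_positive f" and fS: "supp f \<subseteq> {- n..n} \<times> {- m..m}"
    and "uncoupled_form (recip_functional f) n m"
  obtains p where "supp p \<subseteq> grid n m" "f = p * dagger p"
    "\<And>z w. cmod z \<le> 1 \<Longrightarrow> cmod w \<le> 1 \<Longrightarrow> laurent_eval p z w \<noteq> 0"
proof -
  interpret uncoupled_form "recip_functional f" n m by fact
  define g where "g = base * dagger base"
  have eval_g: "laurent_eval g z w = complex_of_real ((cmod (laurent_eval base z w))\<^sup>2)"
    if "cmod z = 1" "cmod w = 1" for z w
  proof -
    have "z \<noteq> 0" "w \<noteq> 0" using that by auto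
    then show ?thesis
      using that by (simp add: g_def laurent_eval_mult laurent_eval_dagger_torus complex_norm_square del: of_real_power)
  qed
  have g: "torus_positive g"
    using base_nonzero by (simp add: torus_positive_def eval_g del: of_real_power)
  have "stable_form (recip_functional g) base n m"
    using nm1 base_nonzero by (intro stable_form_recip_functional g supp_base eval_g) auto
  then interpret matching_forms "recip_functional f" n m "recip_functional g"
    using uncoupled_form_axioms by (simp add: matching_forms_def)
  have gS: "supp g \<subseteq> {- n..n} \<times> {- m..m}"
  proof
    fix e assume "e \<in> supp g"
    then obtain a b where ab: "a \<in> supp base" "b \<in> supp base" "e = a + - b"
      unfolding g_def using supp_mult_in[of e base "dagger base"] by (auto simp: supp_dagger)
    then have "a \<in> grid n m" "b \<in> grid n m"
      using supp_base by blast+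
    then show "e \<in> {- n..n} \<times> {- m..m}"
      using ab(3) by auto
  qed
  \<comment> \<open>Both \<open>f\<close> and \<open>g\<close> lie in the box where the two
    functionals agree, so each mixed mean equals a mean of \<open>1\<close>.\<close>
  have "recip_functional f g = 1" "recip_functional g f = 1"
    using L_agree[OF gS] L_agree[OF fS] recip_functional_self[OF g] recip_functional_self[OF f] by simp_all
  then have "f = base * dagger base"
    using torus_positive_eqI[OF f g] by (simp add: g_def)
  then show thesis
    using that supp_base base_nonzero by blast
qed

theorem theorem7p3:
  fixes n m :: nat and f :: laurent
  assumes "n \<ge> 1" and "m \<ge> 1"
    and "Poly_Mapping.keys f \<subseteq> {- int n..int n} \<times> {- int m..int m}"
    and "\<And>z w. cmod z = 1 \<Longrightarrow> cmod w = 1 \<Longrightarrow>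
           laurent_eval f z w \<in> \<real> \<and> Re (laurent_eval f z w) > 0"
  shows "(\<exists>p :: laurent. Poly_Mapping.keys p \<subseteq> {0..int n} \<times> {0..int m} \<and>
            (\<forall>z w. cmod z \<le> 1 \<longrightarrow> cmod w \<le> 1 \<longrightarrow> laurent_eval p z w \<noteq> 0) \<and>
            (\<forall>z w. cmod z = 1 \<longrightarrow> cmod w = 1 \<longrightarrow>
               laurent_eval f z w = complex_of_real ((cmod (laurent_eval p z w))\<^sup>2)))
         \<longleftrightarrow> K_mat (recip_functional f) n m = 0\<^sub>m m n"
proof
  have f: "torus_positive f"
    using assms(4) by (simp add: torus_positive_def)
  {
    assume "\<exists>p :: laurent. Poly_Mapping.keys p \<subseteq> {0..int n} \<times> {0..int m} \<and>
      (\<forall>z w. cmod z \<le> 1 \<longrightarrow> cmod w \<le> 1 \<longrightarrow> laurent_eval p z w \<noteq> 0) \<and>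
      (\<forall>z w. cmod z = 1 \<longrightarrow> cmod w = 1 \<longrightarrow>
         laurent_eval f z w = complex_of_real ((cmod (laurent_eval p z w))\<^sup>2))"
    then obtain p where "supp p \<subseteq> grid (int n) (int m)"
      "\<And>z w. cmod z \<le> 1 \<Longrightarrow> cmod w \<le> 1 \<Longrightarrow> laurent_eval p z w \<noteq> 0"
      "\<And>z w. cmod z = 1 \<Longrightarrow> cmod w = 1 \<Longrightarrow>
         laurent_eval f z w = complex_of_real ((cmod (laurent_eval p z w))\<^sup>2)"
      by blast
    then have "stable_form (recip_functional f) p (int n) (int m)"
      by (intro stable_form_recip_functional[OF f]) auto
    then show "K_mat (recip_functional f) n m = 0\<^sub>m m n"
      by (rule K_mat_zero_if_stable[OF assms(1,2)])
  next
    assume "K_mat (recip_functional f) n m = 0\<^sub>m m n"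
    then have "uncoupled_form (recip_functional f) (int n) (int m)"
      by (rule uncoupled_if_K_mat_zero[OF assms(1,2) toeplitz_form_recip_functional[OF f]])
    then obtain p where p: "supp p \<subseteq> grid (int n) (int m)" "f = p * dagger p"
      "\<And>z w. cmod z \<le> 1 \<Longrightarrow> cmod w \<le> 1 \<Longrightarrow> laurent_eval p z w \<noteq> 0"
      using factorization_if_uncoupled[OF f assms(3)] by blast
    have "laurent_eval f z w = complex_of_real ((cmod (laurent_eval p z w))\<^sup>2)"
      if "cmod z = 1" "cmod w = 1" for z w
    proof -
      have "z \<noteq> 0" "w \<noteq> 0" using that by auto
      then show ?thesis
        using that by (simp add: p(2) laurent_eval_mult laurent_eval_dagger_torus complex_norm_square del: of_real_power)
    qed
    then show "\<exists>p :: laurent. Poly_Mapping.keys p \<subseteq> {0..int n} \<times> {0..int m} \<and>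
      (\<forall>z w. cmod z \<le> 1 \<longrightarrow> cmod w \<le> 1 \<longrightarrow> laurent_eval p z w \<noteq> 0) \<and>
      (\<forall>z w. cmod z = 1 \<longrightarrow> cmod w = 1 \<longrightarrow>
         laurent_eval f z w = complex_of_real ((cmod (laurent_eval p z w))\<^sup>2))"
      using p(1,3) by blast
  }
qed

end
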